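(* Let $p\geqslant 0$ be an integer, $q=p+1$, let $\lambda,\mu\in\mathbb{R}$ and $\delta=\mu-\lambda$. For every $t\in\mathbb{R}$, the $\mathfrak{psl}(p+1|p+1)$-equivariant quantization $Q\colon\mathcal{S}_\delta\to\mathcal{D}_{\lambda,\mu}$ over $\mathbb{R}^{p|p+1}$ given on $\mathcal{S}^k_\delta$ for $k\neq 1$ by $$Q(S)(f)=\sum_{r=0}^kC_{k,r}\,Q_{\mathrm{Aff}}(\mathrm{div}^rS)(f),\qquad C_{k,0}=1,\quad C_{k,r}=\frac{\prod_{j=1}^r(k-j)}{r!\,\prod_{j=1}^r(2k-1-j)}\ \ (r\geqslant 1),$$ and on $\mathcal{S}^1_\delta$ by $Q(S)(f)=Q_{\mathrm{Aff}}(S)f+t\,\mathrm{div}(S)f$, is equivariant with respect to $\mathfrak{pgl}(p+1|p+1)$.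
   Context: All Lie superalgebras are over $\mathbb{R}$. Here $q=p+1$. The parity of a homogeneous object $a$ is $\tilde a$; for an index $i\in\{1,\ldots,p+q\}$, $\tilde i=0$ if $i\leqslant p$ and $\tilde i=1$ otherwise. The coordinates of $\mathbb{R}^{p|q}$ are $y^1,\ldots,y^{p+q}$, where $y^1=x^1,\ldots,y^p=x^p$ are even and $y^{p+1}=\theta^1,\ldots,y^{p+q}=\theta^q$ are odd (anticommuting), so $\tilde{y^i}=\tilde i$. $\mathcal{F}=C^\infty(\mathbb{R}^{p|q})=C^\infty(\mathbb{R}^p)\otimes\Lambda(\theta^1,\ldots,\theta^q)$, and $\mathrm{Vect}(\mathbb{R}^{p|q})$ is the Lie superalgebra of vector fields $X=\sum_i X^i\partial_{y^i}$, $X^i\in\mathcal{F}$. Formulas with signs are written for homogeneous elements and extended linearly. Let $e_1,\ldots,e_{p+q}$ be the standard basis of the superspace $\mathbb{R}^{p|q}$ (parity of $e_i$ is $\tilde i$), $\varepsilon^1,\ldots,\varepsilon^{p+q}$ the standard basis of row vectors of $(\mathbb{R}^{p|q})^*$ (parity of $\varepsilon^i$ is $\tilde i$), and let $\mathrm{str}(A)=\sum_i(-1)^{\tilde i}A^i_i$ for $A\in\mathfrak{gl}(p|q)$. Densities. For $X=\sum_i X^i\partial_{y^i}$ put $\mathrm{div}(X)=\sum_i(-1)^{\tilde{y^i}\widetilde{X^i}}\partial_{y^i}X^i$. $\mathcal{F}_\lambda$ is the space $\mathcal{F}$ with the action $L^\lambda_Xf=X(f)+\lambda\,\mathrm{div}(X)f$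 of $\mathrm{Vect}(\mathbb{R}^{p|q})$. Symbols. $S^k$ is the degree $k$ part of the (super)symmetric algebra of $\mathbb{R}^{p|q}$, with product $\vee$ satisfying $v\vee w=(-1)^{\tilde v\tilde w}w\vee v$. $\mathfrak{gl}(p|q)$ acts on $S^k$ by $\rho(A)(v_1\vee\cdots\vee v_k)=\sum_j(-1)^{\tilde A(\tilde v_1+\cdots+\tilde v_{j-1})}v_1\vee\cdots\vee Av_j\vee\cdots\vee v_k$. $B^\delta$ is the space of dimension $1|0$ spanned by $u$ with $\rho(A)u=-\delta\,\mathrm{str}(A)u$, and $S^k_\delta=B^\delta\otimes S^k$ with the tensor product representation $\rho$. $\mathcal{S}^k_\delta=\mathcal{F}\otimes S^k_\delta$ with the action $$L_X(f\otimes v)=X(f)\otimes v+(-1)^{\widetilde X\tilde f}\sum_{i,j}fJ_i^j\otimes\rho(e^i_j)v,\qquad J_i^j=(-1)^{\tilde{y^i}\widetilde X+1}\partial_{y^i}X^j,$$ where $e^i_j(e_k)=\delta^i_ke_j$; and $\mathcal{S}_\delta=\bigoplus_{k\geqslant 0}\mathcal{S}^k_\delta$. The generator $u$ is omitted from the notation. Differential operators. $\mathcal{D}_{\lambda,\mu}$ is the space of linear differential operators $\mathcal{F}_\lambda\to\mathcal{F}_\mu$ with action $\mathcal{L}_XD=L^\mu_X\circ D-(-1)^{\widetilde X\widetilde D}D\circ L^\lambda_X$; $\mathcal{D}^k_{\lambda,\mu}$ is the subspace of operators of order at most $k$. Every $D\in\mathcal{D}^k_{\lambda,\mu}$ is uniquely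 $D=\sum_{|\alpha|\leqslant k}f_\alpha\,\partial_{y^1}^{\alpha_1}\cdots\partial_{y^{p+q}}^{\alpha_{p+q}}$ with $f_\alpha\in\mathcal{F}$ and $\alpha_{p+1},\ldots,\alpha_{p+q}\in\{0,1\}$. The principal symbol is $\sigma_k\colon\mathcal{D}^k_{\lambda,\mu}\to\mathcal{S}^k_\delta$, $D\mapsto\sum_{|\alpha|=k}f_\alpha\otimes e_1^{\alpha_1}\vee\cdots\vee e_{p+q}^{\alpha_{p+q}}$, with $\delta=\mu-\lambda$. The affine quantization map $Q_{\mathrm{Aff}}\colon\mathcal{S}_\delta\to\mathcal{D}_{\lambda,\mu}$ is the linear bijection inverse to the total symbol map $D\mapsto\sum_{|\alpha|\leqslant k}f_\alpha\otimes e_1^{\alpha_1}\vee\cdots\vee e_{p+q}^{\alpha_{p+q}}$. A quantization is a linear bijection $Q\colon\mathcal{S}_\delta\to\mathcal{D}_{\lambda,\mu}$ such that $Q(T)\in\mathcal{D}^k_{\lambda,\mu}$ and $\sigma_k(Q(T))=T$ for all $T\in\mathcal{S}^k_\delta$ and all $k\in\mathbb{N}$. Divergence operator on symbols. For $h\in(\mathbb{R}^{p|q})^*$, the interior product is $i(h)(h_1\vee\cdots\vee h_k)=\sum_{j=1}^k(-1)^{\tilde h(\tilde h_1+\cdots+\tilde h_{j-1})}\langle h,h_j\rangle\,h_1\vee\cdots\widehat{j}\cdots\vee h_k$, where $\langle h,x\rangle$ is the matrix product of the row $h$ by the column $x$ and $\widehat{j}$ means that $h_j$ is omitted; it is extended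 to $\mathcal{S}_\delta$ by $i(h)u=0$ and as a differential operator of order zero and parity $\tilde h$, i.e. $i(h)(f\otimes w)=(-1)^{\tilde h\tilde f}f\otimes i(h)w$. Then $\mathrm{div}\colon\mathcal{S}^k_\delta\to\mathcal{S}^{k-1}_\delta$ is $\mathrm{div}\,S=\sum_{j=1}^{p+q}(-1)^{\tilde{y^j}}i(\varepsilon^j)\partial_{y^j}S$, where $\partial_{y^j}(f\otimes w)=(\partial_{y^j}f)\otimes w$, and $\mathrm{div}^r$ is its $r$-th iterate. Projective superalgebra. $\mathfrak{pgl}(p+1|q)=\mathfrak{gl}(p+1|q)/\mathbb{R}\,\mathrm{Id}$ is identified with $\mathbb{R}^{p|q}\oplus\mathfrak{gl}(p|q)\oplus(\mathbb{R}^{p|q})^*$ (columns, matrices, rows), through $\left[\begin{pmatrix}a&\xi\\ h&A\end{pmatrix}\right]\mapsto(h,A-a\,\mathrm{Id},\xi)$. It is realized in $\mathrm{Vect}(\mathbb{R}^{p|q})$ by the linear map $h\mapsto X^h$ with $X^v=-\sum_iv^i\partial_{y^i}$ for $v\in\mathbb{R}^{p|q}$, $X^A=-\sum_{i,j}(-1)^{\tilde j(\tilde i+\tilde j)}A^i_jy^j\partial_{y^i}$ for $A\in\mathfrak{gl}(p|q)$, and $X^\xi=\sum_j\xi_jy^j(-1)^{\tilde j}\mathcal{E}$ for $\xi\in(\mathbb{R}^{p|q})^*$, where $\mathcal{E}=\sum_iy^i\partial_{y^i}$. For $q=p+1$, $\mathfrak{psl}(p+1|p+1)=\mathfrak{sl}(p+1|p+1)/\mathbb{R}\,\mathrm{Id}$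 is a codimension one ideal of $\mathfrak{pgl}(p+1|p+1)$, corresponding under this identification to $\mathbb{R}^{p|p+1}\oplus\mathfrak{sl}(p|p+1)\oplus(\mathbb{R}^{p|p+1})^*$. A quantization $Q\colon\mathcal{S}_\delta\to\mathcal{D}_{\lambda,\mu}$ is equivariant with respect to $\mathfrak{psl}(p+1|p+1)$ (resp. $\mathfrak{pgl}(p+1|p+1)$) if $\mathcal{L}_{X^h}\circ Q=Q\circ L_{X^h}$ for every $h$ in that algebra. *)

theory Defs
  imports
    "HOL-Analysis.Analysis"
    "HOL-Library.Multiset"
    "HOL-Library.Function_Algebras"
begin

text \<open>
  Coordinates of the superspace of dimension \<open>p|q\<close> are numbered from 0: index \<open>i < p\<close> is even,
  \<open>p \<le> i < p + q\<close> is odd.  Parities are natural numbers read modulo 2.  Sums and differences of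
  functions are the pointwise ones of \<^theory>\<open>HOL-Library.Function_Algebras\<close>.  A formula whose signs
  depend on the parity of its arguments is extended linearly by summing it explicitly over the two
  homogeneous components (index set \<open>{0, 1}\<close>) of every such argument.
\<close>

definition par :: "nat \<Rightarrow> nat \<Rightarrow> nat" where
  "par p i = (if i < p then 0 else 1)"

definition sg :: "nat \<Rightarrow> real" where
  "sg n = (-1) ^ n"


section \<open>Superfunctions\<close>

text \<open>
  A function on $\mathbb{R}^p$ is a function of \<open>nat \<Rightarrow> real\<close> depending on the first \<open>p\<close> coordinates
  only, so that \<open>p\<close> may be any natural number, including 0.  For such functions, continuity in the
  product topology is continuity on $\mathbb{R}^p$.
\<close>

definition even_pd :: "nat \<Rightarrow> ((nat \<Rightarrow> real) \<Rightarrow> real) \<Rightarrow> (nat \<Rightarrow> real) \<Rightarrow> real" where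
  "even_pd i g = (\<lambda>x. deriv (\<lambda>s. g (x(i := s))) (x i))"

definition smooth_funs :: "nat \<Rightarrow> ((nat \<Rightarrow> real) \<Rightarrow> real) set" where
  "smooth_funs p = {g.
     (\<forall>x y. (\<forall>i<p. x i = y i) \<longrightarrow> g x = g y) \<and>
     (\<forall>w. set w \<subseteq> {..<p} \<longrightarrow>
        continuous_on UNIV (foldr even_pd w g) \<and>
        (\<forall>i<p. \<forall>x. (\<lambda>s. foldr even_pd w g (x(i := s))) differentiable (at (x i))))}"

text \<open>
  \<open>f I\<close> is the coefficient of the product, in increasing order, of the odd coordinates with index
  in \<open>I\<close>.
\<close>

type_synonym sfun = "nat set \<Rightarrow> (nat \<Rightarrow> real) \<Rightarrow> real"

definition superfuns :: "nat \<Rightarrow> nat \<Rightarrow> sfun set" where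
  "superfuns p q = {f. (\<forall>I. f I \<in> smooth_funs p) \<and> (\<forall>I. \<not> I \<subseteq> {p..<p+q} \<longrightarrow> f I = 0)}"

definition scl :: "real \<Rightarrow> sfun \<Rightarrow> sfun" where
  "scl c f = (\<lambda>I x. c * f I x)"

definition const_sfun :: "real \<Rightarrow> sfun" where
  "const_sfun c = (\<lambda>I x. if I = {} then c else 0)"

definition coord :: "nat \<Rightarrow> nat \<Rightarrow> sfun" where
  "coord p j = (\<lambda>I x. if j < p then (if I = {} then x j else 0) else (if I = {j} then 1 else 0))"

definition smult :: "sfun \<Rightarrow> sfun \<Rightarrow> sfun" (infixl "\<star>" 70) where
  "f \<star> g = (\<lambda>K x. \<Sum>I\<in>Pow K.
      sg (card {(i, j). i \<in> I \<and> j \<in> K - I \<and> j < i}) * f I x * g (K - I) x)"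

text \<open>The homogeneous component of parity \<open>b\<close>.\<close>

definition part :: "nat \<Rightarrow> sfun \<Rightarrow> sfun" where
  "part b f = (\<lambda>I. if even (card I + b) then f I else 0)"

text \<open>Odd partial derivatives act from the left.\<close>

definition pd :: "nat \<Rightarrow> nat \<Rightarrow> sfun \<Rightarrow> sfun" where
  "pd p j f = (if j < p then (\<lambda>I. even_pd j (f I))
     else (\<lambda>I x. if j \<in> I then 0 else sg (card {i \<in> I. i < j}) * f (insert j I) x))"


section \<open>Vector fields and densities\<close>

text \<open>\<open>X i\<close> is the coefficient of the \<open>i\<close>-th partial derivative.\<close>

type_synonym vfield = "nat \<Rightarrow> sfun"

definition vpart :: "nat \<Rightarrow> nat \<Rightarrow> vfield \<Rightarrow> vfield" where
  "vpart p a X = (\<lambda>i. part (a + par p i) (X i))"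

definition vapply :: "nat \<Rightarrow> nat \<Rightarrow> vfield \<Rightarrow> sfun \<Rightarrow> sfun" where
  "vapply p q X f = (\<Sum>i<p+q. X i \<star> pd p i f)"

definition vdiv :: "nat \<Rightarrow> nat \<Rightarrow> vfield \<Rightarrow> sfun" where
  "vdiv p q X = (\<Sum>i<p+q. \<Sum>b\<in>{0, 1}. scl (sg (par p i * b)) (pd p i (part b (X i))))"

definition lie_density :: "nat \<Rightarrow> nat \<Rightarrow> real \<Rightarrow> vfield \<Rightarrow> sfun \<Rightarrow> sfun" where
  "lie_density p q l X f = vapply p q X f + scl l (vdiv p q X \<star> f)"


section \<open>The supersymmetric algebra\<close>

text \<open>
  The multiset \<open>M\<close> stands for the monomial \<open>e\<^sup>M\<close>, the product of the basis vectors with index in \<open>M\<close>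
  in increasing order.  An element of the supersymmetric algebra is its family of coefficients.
\<close>

type_synonym ssym = "nat multiset \<Rightarrow> real"

definition odd_simple :: "nat \<Rightarrow> nat multiset \<Rightarrow> bool" where
  "odd_simple p M \<longleftrightarrow> (\<forall>i\<ge>p. count M i \<le> 1)"

definition sym_monos :: "nat \<Rightarrow> nat \<Rightarrow> nat multiset set" where
  "sym_monos p q = {M. set_mset M \<subseteq> {..<p+q} \<and> odd_simple p M}"

definition smono :: "nat multiset \<Rightarrow> ssym" where
  "smono M = (\<lambda>K. if K = M then 1 else 0)"

text \<open>
  Only the odd vectors contribute to the sign when a product of two monomials is reordered.
\<close>

definition vee :: "nat \<Rightarrow> ssym \<Rightarrow> ssym \<Rightarrow> ssym" where
  "vee p u v = (\<lambda>K. if odd_simple p K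
     then \<Sum>M | M \<subseteq># K.
       sg (card {(i, j). i \<in># M \<and> j \<in># K - M \<and> p \<le> j \<and> j < i}) * u M * v (K - M)
     else 0)"

definition vees :: "nat \<Rightarrow> ssym list \<Rightarrow> ssym" where
  "vees p us = foldr (vee p) us (smono {#})"

definition basis_vec :: "nat \<Rightarrow> ssym" where
  "basis_vec i = smono {#i#}"

text \<open>Matrices: \<open>A i j\<close> is the entry in row \<open>i\<close> and column \<open>j\<close>.\<close>

type_synonym smat = "nat \<Rightarrow> nat \<Rightarrow> real"

definition gl :: "nat \<Rightarrow> nat \<Rightarrow> smat set" where
  "gl p q = {A. \<forall>i j. A i j \<noteq> 0 \<longrightarrow> i < p + q \<and> j < p + q}"

definition str :: "nat \<Rightarrow> nat \<Rightarrow> smat \<Rightarrow> real" where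
  "str p q A = (\<Sum>i<p+q. sg (par p i) * A i i)"

definition sl :: "nat \<Rightarrow> nat \<Rightarrow> smat set" where
  "sl p q = {A \<in> gl p q. str p q A = 0}"

text \<open>The matrix that sends the \<open>i\<close>-th basis vector to the \<open>j\<close>-th one.\<close>

definition unit_mat :: "nat \<Rightarrow> nat \<Rightarrow> smat" where
  "unit_mat i j = (\<lambda>r c. if r = j \<and> c = i then 1 else 0)"

definition mat_basis :: "nat \<Rightarrow> nat \<Rightarrow> smat \<Rightarrow> nat \<Rightarrow> ssym" where
  "mat_basis p q A i = (\<lambda>K. \<Sum>m<p+q. A m i * basis_vec m K)"

text \<open>The action on \<open>e\<^sup>M\<close> of a matrix \<open>A\<close> that is homogeneous of parity \<open>a\<close>.\<close>

definition rho_sym :: "nat \<Rightarrow> nat \<Rightarrow> nat \<Rightarrow> smat \<Rightarrow> nat multiset \<Rightarrow> ssym" where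
  "rho_sym p q a A M = (let w = sorted_list_of_multiset M in
     (\<lambda>K. \<Sum>l<length w. sg (a * (\<Sum>m<l. par p (w ! m))) *
        vees p (map basis_vec (take l w) @ [mat_basis p q A (w ! l)]
                 @ map basis_vec (drop (Suc l) w)) K))"

definition rho :: "nat \<Rightarrow> nat \<Rightarrow> real \<Rightarrow> nat \<Rightarrow> smat \<Rightarrow> nat multiset \<Rightarrow> ssym" where
  "rho p q \<delta> a A M = (\<lambda>K. - \<delta> * str p q A * smono M K + rho_sym p q a A M K)"

text \<open>The interior product with \<open>e\<^sup>M\<close> of a row \<open>h\<close> that is homogeneous of parity \<open>b\<close>.\<close>

definition interior_sym :: "nat \<Rightarrow> nat \<Rightarrow> (nat \<Rightarrow> real) \<Rightarrow> nat multiset \<Rightarrow> ssym" where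
  "interior_sym p b h M = (let w = sorted_list_of_multiset M in
     (\<lambda>K. \<Sum>l<length w. sg (b * (\<Sum>m<l. par p (w ! m))) * h (w ! l) *
        vees p (map basis_vec (take l w) @ map basis_vec (drop (Suc l) w)) K))"

definition basis_row :: "nat \<Rightarrow> nat \<Rightarrow> real" where
  "basis_row j = (\<lambda>i. if i = j then 1 else 0)"


section \<open>Symbols\<close>

text \<open>
  \<open>T\<close> stands for the sum over \<open>M\<close> of \<open>T M \<otimes> e\<^sup>M\<close>.  The weight enters only through the action of
  vector fields.
\<close>

type_synonym symb = "nat multiset \<Rightarrow> sfun"

definition symbols :: "nat \<Rightarrow> nat \<Rightarrow> symb set" where
  "symbols p q = {T. (\<forall>M. T M \<in> superfuns p q) \<and> finite {M. T M \<noteq> 0} \<and>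
     (\<forall>M. T M \<noteq> 0 \<longrightarrow> M \<in> sym_monos p q)}"

definition symbols_deg :: "nat \<Rightarrow> nat \<Rightarrow> nat \<Rightarrow> symb set" where
  "symbols_deg p q k = {T \<in> symbols p q. \<forall>M. T M \<noteq> 0 \<longrightarrow> size M = k}"

definition symbols_le :: "nat \<Rightarrow> nat \<Rightarrow> nat \<Rightarrow> symb set" where
  "symbols_le p q k = {T \<in> symbols p q. \<forall>M. T M \<noteq> 0 \<longrightarrow> size M \<le> k}"

definition deg_part :: "nat \<Rightarrow> symb \<Rightarrow> symb" where
  "deg_part k T = (\<lambda>M. if size M = k then T M else 0)"

definition tensor :: "sfun \<Rightarrow> ssym \<Rightarrow> symb" where
  "tensor f v = (\<lambda>M. scl (v M) f)"

text \<open>The coefficients \<open>J i j\<close> of a vector field \<open>X\<close> that is homogeneous of parity \<open>a\<close>.\<close>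

definition jac :: "nat \<Rightarrow> nat \<Rightarrow> vfield \<Rightarrow> nat \<Rightarrow> nat \<Rightarrow> sfun" where
  "jac p a X i j = scl (sg (par p i * a + 1)) (pd p i (X j))"

definition lie_symbol :: "nat \<Rightarrow> nat \<Rightarrow> real \<Rightarrow> vfield \<Rightarrow> symb \<Rightarrow> symb" where
  "lie_symbol p q \<delta> X T = (\<Sum>M | T M \<noteq> 0.
     tensor (vapply p q X (T M)) (smono M) +
     (\<Sum>a\<in>{0, 1}. \<Sum>b\<in>{0, 1}. \<Sum>i<p+q. \<Sum>j<p+q.
        tensor (scl (sg (a * b)) (part b (T M) \<star> jac p a (vpart p a X) i j))
          (rho p q \<delta> (par p i + par p j) (unit_mat i j) M)))"

definition interior :: "nat \<Rightarrow> nat \<Rightarrow> (nat \<Rightarrow> real) \<Rightarrow> symb \<Rightarrow> symb" where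
  "interior p b h T = (\<Sum>M | T M \<noteq> 0. \<Sum>a\<in>{0, 1}.
     tensor (scl (sg (b * a)) (part a (T M))) (interior_sym p b h M))"

definition sdiv :: "nat \<Rightarrow> nat \<Rightarrow> symb \<Rightarrow> symb" where
  "sdiv p q S = (\<Sum>j<p+q. (\<lambda>M. scl (sg (par p j))
     (interior p (par p j) (basis_row j) (\<lambda>N. pd p j (S N)) M)))"


section \<open>Differential operators\<close>

text \<open>
  Operators are represented by maps that vanish outside \<open>superfuns p q\<close>, so that equality of
  operators is equality of maps.
\<close>

type_synonym sop = "sfun \<Rightarrow> sfun"

definition pd_mono :: "nat \<Rightarrow> nat multiset \<Rightarrow> sop" where
  "pd_mono p M f = foldr (pd p) (sorted_list_of_multiset M) f"

definition diff_op :: "nat \<Rightarrow> nat \<Rightarrow> symb \<Rightarrow> sop" where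
  "diff_op p q T = (\<lambda>f. if f \<in> superfuns p q then \<Sum>M | T M \<noteq> 0. T M \<star> pd_mono p M f else 0)"

definition diff_ops_le :: "nat \<Rightarrow> nat \<Rightarrow> nat \<Rightarrow> sop set" where
  "diff_ops_le p q k = diff_op p q ` symbols_le p q k"

definition diff_ops :: "nat \<Rightarrow> nat \<Rightarrow> sop set" where
  "diff_ops p q = (\<Union>k. diff_ops_le p q k)"

definition total_symbol :: "nat \<Rightarrow> nat \<Rightarrow> sop \<Rightarrow> symb" where
  "total_symbol p q D = (THE T. T \<in> symbols p q \<and> D = diff_op p q T)"

definition principal_symbol :: "nat \<Rightarrow> nat \<Rightarrow> nat \<Rightarrow> sop \<Rightarrow> symb" where
  "principal_symbol p q k D = deg_part k (total_symbol p q D)"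

definition Q_aff :: "nat \<Rightarrow> nat \<Rightarrow> symb \<Rightarrow> sop" where
  "Q_aff p q = inv_into (diff_ops p q) (total_symbol p q)"

definition op_part :: "nat \<Rightarrow> sop \<Rightarrow> sop" where
  "op_part a D = (\<lambda>f. \<Sum>b\<in>{0, 1}. part (a + b) (D (part b f)))"

definition lie_op :: "nat \<Rightarrow> nat \<Rightarrow> real \<Rightarrow> real \<Rightarrow> vfield \<Rightarrow> sop \<Rightarrow> sop" where
  "lie_op p q lam mu X D = (\<lambda>f. if f \<in> superfuns p q then
     (\<Sum>a\<in>{0, 1}. \<Sum>b\<in>{0, 1}.
        lie_density p q mu (vpart p a X) (op_part b D f)
        - scl (sg (a * b)) (op_part b D (lie_density p q lam (vpart p a X) f)))
     else 0)"


section \<open>The projective superalgebra\<close>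

text \<open>
  A class of matrices of dimension \<open>p+1|q\<close> modulo multiples of the identity is identified with a
  triple of a column, a matrix and a row of dimension \<open>p|q\<close>.  Index 0 of the large matrix is the
  additional even direction; the kernel of \<open>pgl_ident p q\<close> on \<open>gl (Suc p) q\<close> consists of the
  multiples of the identity.
\<close>

type_synonym triple = "(nat \<Rightarrow> real) \<times> smat \<times> (nat \<Rightarrow> real)"

definition pgl_ident :: "nat \<Rightarrow> nat \<Rightarrow> smat \<Rightarrow> triple" where
  "pgl_ident p q B =
     ((\<lambda>i. B (Suc i) 0),
      (\<lambda>i j. B (Suc i) (Suc j) - (if i = j \<and> i < p + q then B 0 0 else 0)),
      (\<lambda>j. B 0 (Suc j)))"

definition pgl :: "nat \<Rightarrow> nat \<Rightarrow> triple set" where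
  "pgl p q = pgl_ident p q ` gl (Suc p) q"

text \<open>
  For \<open>q = p + 1\<close> the identity has supertrace zero, and this is the quotient of \<open>sl (Suc p) q\<close> by
  the multiples of the identity.
\<close>

definition psl :: "nat \<Rightarrow> nat \<Rightarrow> triple set" where
  "psl p q = pgl_ident p q ` sl (Suc p) q"

definition X_vec :: "(nat \<Rightarrow> real) \<Rightarrow> vfield" where
  "X_vec v = (\<lambda>i. const_sfun (- v i))"

definition X_mat :: "nat \<Rightarrow> nat \<Rightarrow> smat \<Rightarrow> vfield" where
  "X_mat p q A = (\<lambda>i. \<Sum>j<p+q. scl (- (sg (par p j * (par p i + par p j)) * A i j)) (coord p j))"

definition X_row :: "nat \<Rightarrow> nat \<Rightarrow> (nat \<Rightarrow> real) \<Rightarrow> vfield" where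
  "X_row p q \<xi> = (\<lambda>i. \<Sum>j<p+q. scl (\<xi> j * sg (par p j)) (coord p j \<star> coord p i))"

definition pgl_field :: "nat \<Rightarrow> nat \<Rightarrow> triple \<Rightarrow> vfield" where
  "pgl_field p q h = (case h of (v, A, \<xi>) \<Rightarrow> X_vec v + X_mat p q A + X_row p q \<xi>)"


section \<open>Quantizations\<close>

definition quantization :: "nat \<Rightarrow> nat \<Rightarrow> (symb \<Rightarrow> sop) \<Rightarrow> bool" where
  "quantization p q Q \<longleftrightarrow>
     (\<forall>S\<in>symbols p q. \<forall>T\<in>symbols p q. Q (S + T) = Q S + Q T) \<and>
     (\<forall>c. \<forall>T\<in>symbols p q. Q (\<lambda>M. scl c (T M)) = (\<lambda>f. scl c (Q T f))) \<and>
     bij_betw Q (symbols p q) (diff_ops p q) \<and>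
     (\<forall>k. \<forall>T\<in>symbols_deg p q k. Q T \<in> diff_ops_le p q k \<and> principal_symbol p q k (Q T) = T)"

text \<open>
  \<open>Q\<close> is a map from the symbols of weight \<open>mu - lam\<close> to the operators from \<open>lam\<close>-densities to
  \<open>mu\<close>-densities, and \<open>\<g>\<close> is a set of elements of \<open>pgl p q\<close>.
\<close>

definition equivariant :: "nat \<Rightarrow> nat \<Rightarrow> real \<Rightarrow> real \<Rightarrow> triple set \<Rightarrow> (symb \<Rightarrow> sop) \<Rightarrow> bool" where
  "equivariant p q lam mu \<g> Q \<longleftrightarrow>
     (\<forall>h\<in>\<g>. \<forall>T\<in>symbols p q.
        lie_op p q lam mu (pgl_field p q h) (Q T)
        = Q (lie_symbol p q (mu - lam) (pgl_field p q h) T))"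

definition C_coeff :: "nat \<Rightarrow> nat \<Rightarrow> real" where
  "C_coeff k r = (\<Prod>j=1..r. real k - real j) / (fact r * (\<Prod>j=1..r. 2 * real k - 1 - real j))"

definition Q_deg :: "nat \<Rightarrow> nat \<Rightarrow> real \<Rightarrow> nat \<Rightarrow> symb \<Rightarrow> sop" where
  "Q_deg p q t k S = (\<lambda>f. if f \<in> superfuns p q then
     (if k = 1 then Q_aff p q S f + scl t (sdiv p q S {#} \<star> f)
      else \<Sum>r=0..k. scl (C_coeff k r) (Q_aff p q ((sdiv p q ^^ r) S) f))
     else 0)"

text \<open>The linear map that is \<open>Q_deg p q t k\<close> on the symbols of degree \<open>k\<close>, for every \<open>k\<close>.\<close>

definition Q_map :: "nat \<Rightarrow> nat \<Rightarrow> real \<Rightarrow> symb \<Rightarrow> sop" where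
  "Q_map p q t T = (\<Sum>k\<in>size ` {M. T M \<noteq> 0}. Q_deg p q t k (deg_part k T))"

end

theory Submission
  imports Defs
begin

text \<open>
  On symbols, let \<open>Y j\<close>, \<open>P j\<close>, \<open>E j\<close> and \<open>I j\<close> be the multiplication by the coordinate \<open>y j\<close>, the
  partial derivative, the product with the basis vector $e_j$ and the interior product with
  $\varepsilon^j$.  With the Koszul signs they satisfy the relations of a Weyl superalgebra, with
  $[P_i, Y_j] = [I_i, E_j] = \delta_{ij}$.  Let \<open>\<Phi> T\<close> be the operator with total symbol \<open>T\<close>.  Composing
  it on the left with \<open>y j\<close> and $\partial_i$ amounts to applying \<open>Y j\<close> and \<open>P i + E i\<close> to \<open>T\<close>; composing it
  on the right (with sign) amounts to applying $Y_j + (-1)^{\tilde j} I_j$ and \<open>E i\<close>.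

  So the fields $\partial_i$ and $y^j \partial_i$ act in the same way on \<open>T\<close> and on \<open>\<Phi> T\<close>, and their action
  commutes with the divergence.  The field $y^j \mathcal{E}$ has divergence $(p - q + 1) y^j = 0$; it acts
  on symbols by an operator $L$ and on operators by $L - (-1)^{\tilde j} K I_j$, where $K = \sum_i E_i I_i$
  is the degree, and $[\mathrm{div}, L] = -2 (-1)^{\tilde j} K I_j$, again because $p - q = -1$.  The recurrence
  $(r + 1) (2 k - 2 - r) C_{k, r+1} = (k - 1 - r) C_{k, r}$ then says that $\sum_r C_{k, r} \mathrm{div}^r$
  intertwines the two actions.  It leaves $C_{1,1}$ free.  All these fields span the image of
  $\mathfrak{pgl}(p+1|p+1)$.
\<close>

text \<open>Koszul signs are carried by parity automorphisms, \<open>twist\<close> on superfunctions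
  and \<open>Tw\<close> on symbols. They are linear and defined on inhomogeneous elements, so the
  relations hold without splitting into components. The sums over homogeneous components in the
  definitions become such twists, and the sign in the commutator of a field with an operator becomes
  conjugation by one. Left composition is the Leibniz rule. Right composition is harder, since the
  new factor stands behind the whole monomial; it is propagated from degree 0 by compatibility with
  left derivatives. Its rule for coordinates also shows that an operator determines its symbol: the
  commutator with a coordinate lowers the degree. Beyond \<open>psl\<close>, the larger algebra
  contains linear fields of nonzero divergence. Their weight term is the same scalar on symbols and
  on operators, because \<delta> = \<mu> - \<lambda>, and scalars commute with the divergence. The
  quadratic fields are divergence free, so no weight is exceptional. In degree 1 the contraction
  \<open>I j T\<close> has degree 0 and is killed by the degree operator, so the two actions agree
  there and commute with the divergence: hence the free parameter.\<close>

lemma sum_fun_apply: "(\<Sum>i\<in>A. f i) x = (\<Sum>i\<in>A. f i x)" for f :: "'i \<Rightarrow> 'a \<Rightarrow> 'b::comm_monoid_add"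
  by (induction A rule: infinite_finite_induct) auto

section \<open>Smooth functions\<close>

lemma double_difference_mean_value:
  fixes F :: "real \<Rightarrow> real \<Rightarrow> real"
  assumes 1: "\<And>s t. ((\<lambda>s. F s t) has_real_derivative F1 s t) (at s)"
    and 12: "\<And>s t. ((\<lambda>t. F1 s t) has_real_derivative F12 s t) (at t)"
    and h: "h > 0"
  shows "\<exists>x y. a < x \<and> x < a + h \<and> b < y \<and> y < b + h \<and>
    F (a + h) (b + h) - F (a + h) b - F a (b + h) + F a b = h * h * F12 x y"
proof -
  \<comment> \<open>The mean value theorem is applied to the increment in the second variable, as a
    function of the first one.\<close>
  have "\<exists>x>a. x < a + h \<and> (F (a + h) (b + h) - F (a + h) b) - (F a (b + h) - F a b)
      = (a + h - a) * (F1 x (b + h) - F1 x b)"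
    using h by (intro MVT2) (auto intro!: derivative_eq_intros 1)
  then obtain x where x: "a < x" "x < a + h"
      "(F (a + h) (b + h) - F (a + h) b) - (F a (b + h) - F a b) = h * (F1 x (b + h) - F1 x b)"
    by auto
  have "\<exists>y>b. y < b + h \<and> F1 x (b + h) - F1 x b = (b + h - b) * F12 x y"
    using h by (intro MVT2) (auto intro!: 12)
  then obtain y where "b < y" "y < b + h" "F1 x (b + h) - F1 x b = h * F12 x y" by auto
  with x show ?thesis by (intro exI[of _ x] exI[of _ y]) (simp add: algebra_simps)
qed

text \<open>Over a square of side \<open>h\<close> the second difference of \<open>F\<close> is
  \<open>h * h\<close> times either mixed derivative, each taken at some point of the square.
  Continuity lets the square shrink to \<open>(a, b)\<close>.\<close>

lemma mixed_partials_eq: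
  fixes F :: "real \<Rightarrow> real \<Rightarrow> real"
  assumes 1: "\<And>s t. ((\<lambda>s. F s t) has_real_derivative F1 s t) (at s)"
    and 2: "\<And>s t. ((\<lambda>t. F s t) has_real_derivative F2 s t) (at t)"
    and 12: "\<And>s t. ((\<lambda>t. F1 s t) has_real_derivative F12 s t) (at t)"
    and 21: "\<And>s t. ((\<lambda>s. F2 s t) has_real_derivative F21 s t) (at s)"
    and c12: "continuous_on UNIV (\<lambda>z. F12 (fst z) (snd z))"
    and c21: "continuous_on UNIV (\<lambda>z. F21 (fst z) (snd z))"
  shows "F12 a b = F21 a b"
proof -
  define h where "h = (\<lambda>n. 1 / real (Suc n))"
  have h: "h n > 0" for n by (simp add: h_def)
  have lim: "h \<longlonglongrightarrow> 0"
    unfolding h_def using LIMSEQ_inverse_real_of_nat by (simp add: divide_inverse)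
  have "\<exists>x y x' y'. a < x \<and> x < a + h n \<and> b < y \<and> y < b + h n \<and>
      a < x' \<and> x' < a + h n \<and> b < y' \<and> y' < b + h n \<and> F12 x y = F21 x' y'" for n
  proof -
    obtain x y where xy: "a < x" "x < a + h n" "b < y" "y < b + h n"
      "F (a + h n) (b + h n) - F (a + h n) b - F a (b + h n) + F a b = h n * h n * F12 x y"
      using double_difference_mean_value[OF 1 12 h] by metis
    \<comment> \<open>The same with the variables exchanged; the second difference is symmetric
      under this exchange.\<close>
    obtain x' y' where xy': "b < y'" "y' < b + h n" "a < x'" "x' < a + h n"
      "F (a + h n) (b + h n) - F a (b + h n) - F (a + h n) b + F a b = h n * h n * F21 x' y'"
      using double_difference_mean_value[of "\<lambda>t s. F s t", OF 2 21 h] by metis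
    have "h n * h n * F12 x y = h n * h n * F21 x' y'"
      unfolding xy(5)[symmetric] xy'(5)[symmetric] by simp
    then have "F12 x y = F21 x' y'" using h[of n] by simp
    with xy xy' show ?thesis by blast
  qed
  then obtain x y x' y' where *: "\<And>n. a < x n \<and> x n < a + h n" "\<And>n. b < y n \<and> y n < b + h n"
      "\<And>n. a < x' n \<and> x' n < a + h n" "\<And>n. b < y' n \<and> y' n < b + h n"
      "\<And>n. F12 (x n) (y n) = F21 (x' n) (y' n)"
    by metis
  have sq: "z \<longlonglongrightarrow> c" if "\<And>n. c < z n \<and> z n < c + h n" for z and c :: real
  proof (rule tendsto_sandwich[of "\<lambda>_. c" _ _ "\<lambda>n. c + h n"])
    show "(\<lambda>n. c + h n) \<longlonglongrightarrow> c" using tendsto_add[OF tendsto_const lim, of c] by simp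
  qed (use that in \<open>auto intro!: always_eventually less_imp_le\<close>)
  have lims: "(\<lambda>n. G (u n) (v n)) \<longlonglongrightarrow> G a b"
    if "continuous_on UNIV (\<lambda>z. G (fst z) (snd z))" "u \<longlonglongrightarrow> a" "v \<longlonglongrightarrow> b"
    for G :: "real \<Rightarrow> real \<Rightarrow> real" and u v
    using continuous_on_tendsto_compose[OF that(1) tendsto_Pair[OF that(2,3)]] by simp
  have "(\<lambda>n. F12 (x n) (y n)) \<longlonglongrightarrow> F12 a b" "(\<lambda>n. F21 (x' n) (y' n)) \<longlonglongrightarrow> F21 a b"
    using sq[OF *(1)] sq[OF *(2)] sq[OF *(3)] sq[OF *(4)] lims[OF c12] lims[OF c21] by blast+
  with *(5) show ?thesis using LIMSEQ_unique by auto
qed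

section \<open>Closure properties of smooth functions\<close>

lemma smooth_depends: "g \<in> smooth_funs p \<Longrightarrow> (\<And>i. i < p \<Longrightarrow> x i = y i) \<Longrightarrow> g x = g y"
  unfolding smooth_funs_def by blast

lemma smooth_continuous: "g \<in> smooth_funs p \<Longrightarrow> continuous_on UNIV g"
  unfolding smooth_funs_def by (force dest: spec[of _ "[]"])

lemma smooth_differentiable:
  "g \<in> smooth_funs p \<Longrightarrow> i < p \<Longrightarrow> (\<lambda>s. g (x(i := s))) differentiable (at (x i))"
  unfolding smooth_funs_def by (force dest: spec[of _ "[]"])

lemma even_pd_DERIV_at:
  assumes "(\<lambda>s. g (x(i := s))) differentiable (at (x i))"
  shows "((\<lambda>s. g (x(i := s))) has_real_derivative even_pd i g x) (at (x i))"
  using assms unfolding even_pd_def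
  by (simp add: DERIV_deriv_iff_real_differentiable)

lemma even_pd_DERIV:
  assumes "g \<in> smooth_funs p" "i < p"
  shows "((\<lambda>s. g (x(i := s))) has_real_derivative even_pd i g (x(i := s))) (at s)"
  using even_pd_DERIV_at[OF smooth_differentiable[OF assms, of "x(i := s)"]]
  by (simp only: fun_upd_upd fun_upd_same)

lemma even_pd_eqI:
  assumes "\<And>x. ((\<lambda>s. g (x(i := s))) has_real_derivative D x) (at (x i))"
  shows "even_pd i g = D"
  unfolding even_pd_def using DERIV_imp_deriv[OF assms] by auto

lemma even_pd_smooth: "g \<in> smooth_funs p \<Longrightarrow> i < p \<Longrightarrow> even_pd i g \<in> smooth_funs p"
proof -
  assume g: "g \<in> smooth_funs p" and i: "i < p"
  have "even_pd i g x = even_pd i g y" if "\<And>j. j < p \<Longrightarrow> x j = y j" for x y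
  proof -
    have "g (x(i := s)) = g (y(i := s))" for s
      using that by (intro smooth_depends[OF g]) auto
    then show ?thesis using that[OF i] by (simp add: even_pd_def)
  qed
  moreover have "continuous_on UNIV (foldr even_pd w (even_pd i g)) \<and>
      (\<forall>j<p. \<forall>x. (\<lambda>s. foldr even_pd w (even_pd i g) (x(j := s))) differentiable (at (x j)))"
    if "set w \<subseteq> {..<p}" for w
  proof -
    have "set (w @ [i]) \<subseteq> {..<p}" using that i by auto
    moreover have "foldr even_pd w (even_pd i g) = foldr even_pd (w @ [i]) g" by simp
    ultimately show ?thesis using g unfolding smooth_funs_def mem_Collect_eq by metis
  qed
  ultimately show ?thesis unfolding smooth_funs_def by blast
qed

text \<open>Smoothness is the largest property that implies the three regularity conditions and
  passes to partial derivatives, so one set with these features that contains \<open>g\<close> is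
  enough.\<close>

lemma smooth_coinduct:
  assumes "g \<in> A"
    and "\<And>g x y. g \<in> A \<Longrightarrow> (\<And>i. i < p \<Longrightarrow> x i = y i) \<Longrightarrow> g x = g y"
    and "\<And>g. g \<in> A \<Longrightarrow> continuous_on UNIV g"
    and "\<And>g x i. g \<in> A \<Longrightarrow> i < p \<Longrightarrow> (\<lambda>s. g (x(i := s))) differentiable (at (x i))"
    and "\<And>g i. g \<in> A \<Longrightarrow> i < p \<Longrightarrow> even_pd i g \<in> A"
  shows "g \<in> smooth_funs p"
proof -
  have "foldr even_pd w g \<in> A" if "set w \<subseteq> {..<p}" for w
    using that by (induction w) (auto intro: assms(1,5))
  then show ?thesis unfolding smooth_funs_def using assms(1-4) by auto
qed

text \<open>The derivative of a product is a sum of products, so smoothness cannot be proved for one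
  product in isolation. This set contains the products and is stable under partial
  derivatives.\<close>

inductive_set smooth_closure :: "nat \<Rightarrow> ((nat \<Rightarrow> real) \<Rightarrow> real) set" for p where
  base: "g \<in> smooth_funs p \<Longrightarrow> g \<in> smooth_closure p"
| const: "(\<lambda>x. c) \<in> smooth_closure p"
| coord: "i < p \<Longrightarrow> (\<lambda>x. x i) \<in> smooth_closure p"
| add: "f \<in> smooth_closure p \<Longrightarrow> g \<in> smooth_closure p \<Longrightarrow> (\<lambda>x. f x + g x) \<in> smooth_closure p"
| mult: "f \<in> smooth_closure p \<Longrightarrow> g \<in> smooth_closure p \<Longrightarrow> (\<lambda>x. f x * g x) \<in> smooth_closure p"

lemma even_pd_const: "even_pd i (\<lambda>x. c) = (\<lambda>x. 0)"
  by (rule even_pd_eqI) simp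

lemma even_pd_coord: "even_pd i (\<lambda>x. x j) = (\<lambda>x. if i = j then 1 else 0)"
  by (rule even_pd_eqI) (auto intro!: derivative_eq_intros)

text \<open>Only differentiability along one coordinate is assumed, because the rule is applied
  before sums of smooth functions are known to be smooth.\<close>

lemma even_pd_add_at:
  assumes "\<And>x. (\<lambda>s. f (x(i := s))) differentiable (at (x i))"
    and "\<And>x. (\<lambda>s. g (x(i := s))) differentiable (at (x i))"
  shows "even_pd i (\<lambda>x. f x + g x) = (\<lambda>x. even_pd i f x + even_pd i g x)"
  by (rule even_pd_eqI) (intro DERIV_add even_pd_DERIV_at assms)

lemma even_pd_mult_at:
  assumes "\<And>x. (\<lambda>s. f (x(i := s))) differentiable (at (x i))"
    and "\<And>x. (\<lambda>s. g (x(i := s))) differentiable (at (x i))"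
  shows "even_pd i (\<lambda>x. f x * g x) = (\<lambda>x. even_pd i f x * g x + f x * even_pd i g x)"
proof (rule even_pd_eqI)
  fix x
  show "((\<lambda>s. f (x(i := s)) * g (x(i := s))) has_real_derivative
      even_pd i f x * g x + f x * even_pd i g x) (at (x i))"
    using DERIV_mult[OF even_pd_DERIV_at[OF assms(1)[of x]] even_pd_DERIV_at[OF assms(2)[of x]]]
    by (simp only: fun_upd_triv ac_simps)
qed

lemma smooth_closure_subset: "smooth_closure p \<subseteq> smooth_funs p"
proof
  fix g assume "g \<in> smooth_closure p"
  then show "g \<in> smooth_funs p"
  proof (rule smooth_coinduct)
    show dep: "g x = g y" if "g \<in> smooth_closure p" "\<And>i. i < p \<Longrightarrow> x i = y i" for g x y
      using that by induction (auto dest: smooth_depends)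
    show "continuous_on UNIV g" if "g \<in> smooth_closure p" for g
      using that
    proof induction
      case (base g) then show ?case by (rule smooth_continuous)
    qed (auto intro: continuous_intros)
    show diff: "(\<lambda>s. g (x(i := s))) differentiable (at (x i))" if "g \<in> smooth_closure p" "i < p" for g x i
      using that
    proof induction
      case (coord j) show ?case by (cases "i = j") auto
    qed (auto dest: smooth_differentiable)
    show "even_pd i g \<in> smooth_closure p" if "g \<in> smooth_closure p" "i < p" for g i
      using that
    proof induction
      case (base g) then show ?case by (auto intro: smooth_closure.base even_pd_smooth)
    next
      case (const c) show ?case by (simp add: even_pd_const smooth_closure.const)
    next
      case (coord j) show ?case by (simp add: even_pd_coord smooth_closure.const)
    next
      case (add f g) then show ?case
        by (subst even_pd_add_at) (auto intro: diff smooth_closure.add)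
    next
      case (mult f g) then show ?case
        by (subst even_pd_mult_at) (auto intro!: diff smooth_closure.add smooth_closure.mult)
    qed
  qed
qed

lemma smooth_const: "(\<lambda>x. c) \<in> smooth_funs p"
  using smooth_closure.const smooth_closure_subset by blast

lemma smooth_zero: "0 \<in> smooth_funs p"
  using smooth_const[of 0] by (simp add: zero_fun_def)

lemma smooth_coord: "i < p \<Longrightarrow> (\<lambda>x. x i) \<in> smooth_funs p"
  using smooth_closure.coord smooth_closure_subset by blast

lemma smooth_add: "f \<in> smooth_funs p \<Longrightarrow> g \<in> smooth_funs p \<Longrightarrow> (\<lambda>x. f x + g x) \<in> smooth_funs p"
  using smooth_closure.add smooth_closure.base smooth_closure_subset by blast

lemma smooth_mult: "f \<in> smooth_funs p \<Longrightarrow> g \<in> smooth_funs p \<Longrightarrow> (\<lambda>x. f x * g x) \<in> smooth_funs p"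
  using smooth_closure.mult smooth_closure.base smooth_closure_subset by blast

lemma smooth_cmult: "g \<in> smooth_funs p \<Longrightarrow> (\<lambda>x. c * g x) \<in> smooth_funs p"
  by (rule smooth_mult[OF smooth_const])

lemma smooth_sum: "(\<And>a. a \<in> A \<Longrightarrow> f a \<in> smooth_funs p) \<Longrightarrow> (\<lambda>x. \<Sum>a\<in>A. f a x) \<in> smooth_funs p"
  by (induction A rule: infinite_finite_induct) (auto intro: smooth_const smooth_add)

lemma even_pd_add:
  "f \<in> smooth_funs p \<Longrightarrow> g \<in> smooth_funs p \<Longrightarrow> i < p \<Longrightarrow>
    even_pd i (\<lambda>x. f x + g x) = (\<lambda>x. even_pd i f x + even_pd i g x)"
  by (intro even_pd_add_at smooth_differentiable)

lemma even_pd_mult: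
  "f \<in> smooth_funs p \<Longrightarrow> g \<in> smooth_funs p \<Longrightarrow> i < p \<Longrightarrow>
    even_pd i (\<lambda>x. f x * g x) = (\<lambda>x. even_pd i f x * g x + f x * even_pd i g x)"
  by (intro even_pd_mult_at smooth_differentiable)

lemma even_pd_cmult:
  "g \<in> smooth_funs p \<Longrightarrow> i < p \<Longrightarrow> even_pd i (\<lambda>x. c * g x) = (\<lambda>x. c * even_pd i g x)"
  by (simp add: even_pd_mult[OF smooth_const] even_pd_const)

lemma even_pd_sum:
  "(\<And>a. a \<in> A \<Longrightarrow> f a \<in> smooth_funs p) \<Longrightarrow> i < p \<Longrightarrow>
    even_pd i (\<lambda>x. \<Sum>a\<in>A. f a x) = (\<lambda>x. \<Sum>a\<in>A. even_pd i (f a) x)"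
  by (induction A rule: infinite_finite_induct)
     (auto simp: even_pd_const even_pd_add[where p = p] smooth_sum)

text \<open>Freezing all coordinates but \<open>i\<close> and \<open>j\<close> reduces the claim to
  functions on a plane.\<close>

lemma even_pd_commute:
  assumes g: "g \<in> smooth_funs p" and i: "i < p" and j: "j < p"
  shows "even_pd i (even_pd j g) = even_pd j (even_pd i g)"
proof (cases "i = j")
  case False
  show ?thesis
  proof
    fix x :: "nat \<Rightarrow> real"
    \<comment> \<open>In the product topology the embedding of the plane is continuous because each
      of its coordinates is.\<close>
    have cont: "continuous_on UNIV (\<lambda>z. G (x(i := fst z, j := snd z)))"
      if "G \<in> smooth_funs p" for G
    proof -
      have "continuous_on UNIV (\<lambda>z::real \<times> real. x(i := fst z, j := snd z))"
      proof (rule continuous_on_coordinatewise_then_product)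
        show "continuous_on UNIV (\<lambda>z::real \<times> real. (x(i := fst z, j := snd z)) k)" for k
          by (cases "k = j"; cases "k = i") (auto intro!: continuous_intros)
      qed
      then show ?thesis
        using continuous_on_compose2[OF smooth_continuous[OF that]] by auto
    qed
    have sw: "x(i := s, j := t) = x(j := t, i := s)" for s t using False by auto
    have d1: "((\<lambda>s. G (x(i := s, j := t))) has_real_derivative even_pd i G (x(i := s, j := t))) (at s)"
      if "G \<in> smooth_funs p" for G s t
      using even_pd_DERIV[OF that i, of "x(j := t)"] by (simp add: sw)
    have d2: "((\<lambda>t. G (x(i := s, j := t))) has_real_derivative even_pd j G (x(i := s, j := t))) (at t)"
      if "G \<in> smooth_funs p" for G s t
      using even_pd_DERIV[OF that j, of "x(i := s)"] by simp
    have "even_pd j (even_pd i g) (x(i := x i, j := x j)) = even_pd i (even_pd j g) (x(i := x i, j := x j))"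
      by (rule mixed_partials_eq[of "\<lambda>s t. g (x(i := s, j := t))" "\<lambda>s t. even_pd i g (x(i := s, j := t))"
            "\<lambda>s t. even_pd j g (x(i := s, j := t))"])
         (intro d1 d2 cont even_pd_smooth g i j)+
    then show "even_pd i (even_pd j g) x = even_pd j (even_pd i g) x" by simp
  qed
qed simp

lemma additive_sum:
  assumes "F 0 = 0" "\<And>a b. F (a + b) = F a + F b"
  shows "F (\<Sum>i\<in>A. f i) = (\<Sum>i\<in>A. F (f i))"
  by (induction A rule: infinite_finite_induct) (simp_all add: assms)

section \<open>The algebra of superfunctions\<close>

lemma sg_add: "sg (a + b) = sg a * sg b"
  by (simp add: sg_def power_add)

lemma sg_0 [simp]: "sg 0 = 1" and sg_1 [simp]: "sg (Suc 0) = -1"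
  by (simp_all add: sg_def)

lemma sg_Suc: "sg (Suc n) = - sg n"
  by (simp add: sg_def)

lemma sg_sq [simp]: "sg n * sg n = 1" and sg_sq' [simp]: "sg n * (sg n * x) = x"
  by (simp_all add: sg_def flip: power_add mult.assoc)

lemma sg_if: "sg n = (if even n then 1 else -1)"
  by (simp add: sg_def)

lemma par_cases: "par p i = 0 \<and> i < p \<or> par p i = 1 \<and> p \<le> i"
  by (simp add: par_def)

text \<open>The \<open>n\<close>-th power of the parity automorphism: a component of parity
  \<open>b\<close> is multiplied by \<open>(-1)^(n * b)\<close>.\<close>

definition twist :: "nat \<Rightarrow> sfun \<Rightarrow> sfun" where
  "twist n f = (\<lambda>I x. sg (n * card I) * f I x)"

text \<open>The sign that sorts the odd coordinates of \<open>I\<close> followed by those of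
  \<open>J\<close>, for disjoint \<open>I\<close> and \<open>J\<close>.\<close>

definition eps :: "nat set \<Rightarrow> nat set \<Rightarrow> real" where
  "eps I J = sg (card {(i, j). i \<in> I \<and> j \<in> J \<and> j < i})"

lemma smult_eps: "(f \<star> g) K x = (\<Sum>I\<in>Pow K. eps I (K - I) * f I x * g (K - I) x)"
  by (simp add: smult_def eps_def)

text \<open>\<open>Pow K\<close> is infinite, and a sum over an infinite set is 0 by convention.
  Sign identities are therefore needed for finite index sets only.\<close>

lemma smult_infinite: "infinite K \<Longrightarrow> (f \<star> g) K x = 0"
  by (simp add: smult_eps)

lemma eps_finite: "finite I \<Longrightarrow> finite J \<Longrightarrow> finite {(i, j). i \<in> I \<and> j \<in> J \<and> j < i}"
  by (rule finite_subset[of _ "I \<times> J"]) auto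

lemma eps_Un1:
  assumes "finite I" "finite I'" "finite J" "I \<inter> I' = {}"
  shows "eps (I \<union> I') J = eps I J * eps I' J"
proof -
  have "{(i, j). i \<in> I \<union> I' \<and> j \<in> J \<and> j < i} =
      {(i, j). i \<in> I \<and> j \<in> J \<and> j < i} \<union> {(i, j). i \<in> I' \<and> j \<in> J \<and> j < i}" by auto
  then show ?thesis using assms unfolding eps_def sg_add[symmetric]
    by (simp only:) (subst card_Un_disjoint; auto simp: eps_finite)
qed

lemma eps_Un2:
  assumes "finite I" "finite J" "finite J'" "J \<inter> J' = {}"
  shows "eps I (J \<union> J') = eps I J * eps I J'"
proof -
  have "{(i, j). i \<in> I \<and> j \<in> J \<union> J' \<and> j < i} =
      {(i, j). i \<in> I \<and> j \<in> J \<and> j < i} \<union> {(i, j). i \<in> I \<and> j \<in> J' \<and> j < i}" by auto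
  then show ?thesis using assms unfolding eps_def sg_add[symmetric]
    by (simp only:) (subst card_Un_disjoint; auto simp: eps_finite)
qed

text \<open>Every pair in \<open>I \<times> J\<close> is inverted in exactly one of the two orders,
  so the two inversion numbers add up to \<open>card I * card J\<close>.\<close>

lemma eps_swap:
  assumes "finite I" "finite J" "I \<inter> J = {}"
  shows "eps I J * eps J I = sg (card I * card J)"
proof -
  have "{(i, j). i \<in> J \<and> j \<in> I \<and> j < i} = prod.swap ` {(i, j). i \<in> I \<and> j \<in> J \<and> i < j}" by auto
  then have "card {(i, j). i \<in> J \<and> j \<in> I \<and> j < i} = card {(i, j). i \<in> I \<and> j \<in> J \<and> i < j}"
    by (simp add: card_image)
  moreover have "card {(i, j). i \<in> I \<and> j \<in> J \<and> j < i} + card {(i, j). i \<in> I \<and> j \<in> J \<and> i < j}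
      = card (I \<times> J)"
  proof (subst card_Un_disjoint[symmetric])
    show "finite {(i, j). i \<in> I \<and> j \<in> J \<and> i < j}"
      by (rule finite_subset[of _ "I \<times> J"]) (use assms in auto)
    have "j < i \<or> i < j" if "i \<in> I" "j \<in> J" for i j
      using assms(3) that by (metis IntI emptyE linorder_neqE_nat)
    then have "{(i, j). i \<in> I \<and> j \<in> J \<and> j < i} \<union> {(i, j). i \<in> I \<and> j \<in> J \<and> i < j} = I \<times> J"
      by blast
    then show "card ({(i, j). i \<in> I \<and> j \<in> J \<and> j < i} \<union> {(i, j). i \<in> I \<and> j \<in> J \<and> i < j}) =
        card (I \<times> J)" by simp
  qed (use assms in \<open>auto simp: eps_finite\<close>)
  ultimately show ?thesis
    by (simp add: eps_def sg_add[symmetric] card_cartesian_product)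
qed

lemma eps_empty [simp]: "eps {} J = 1" "eps I {} = 1"
  by (simp_all add: eps_def)

lemma eps_single: "eps {j} J = sg (card {i \<in> J. i < j})"
proof -
  have "{(i, i'). i \<in> {j} \<and> i' \<in> J \<and> i' < i} = Pair j ` {i \<in> J. i < j}" by auto
  then show ?thesis by (simp add: eps_def card_image inj_on_def)
qed

lemma eps_sq [simp]: "eps I J * eps I J = 1" "eps I J * (eps I J * x) = x"
  by (simp_all add: eps_def)

lemma eps_insert1: "finite I \<Longrightarrow> finite J \<Longrightarrow> j \<notin> I \<Longrightarrow> eps (insert j I) J = eps {j} J * eps I J"
  using eps_Un1[of "{j}" I J] by simp

lemma eps_insert2: "finite I \<Longrightarrow> finite J \<Longrightarrow> j \<notin> J \<Longrightarrow> eps I (insert j J) = eps I {j} * eps I J"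
  using eps_Un2[of I "{j}" J] by simp

lemma eps_to_single: "finite I \<Longrightarrow> j \<notin> I \<Longrightarrow> eps I {j} = sg (card I) * eps {j} I"
proof -
  assume "finite I" "j \<notin> I"
  then have "eps I {j} * eps {j} I = sg (card I)" using eps_swap[of I "{j}"] by simp
  then show ?thesis by (metis eps_sq(1) mult.assoc mult.right_neutral)
qed

text \<open>Both sides are sums over the ordered partitions of \<open>K\<close> into three blocks,
  with the same sign: the product of \<open>eps\<close> over the three pairs of blocks.\<close>

lemma smult_assoc: "f \<star> g \<star> h = f \<star> (g \<star> h)"
proof (intro ext)
  fix K x
  show "(f \<star> g \<star> h) K x = (f \<star> (g \<star> h)) K x"
  proof (cases "finite K")
    case True
    note fin = finite_subset[OF _ True]
    have "(f \<star> g \<star> h) K x = (\<Sum>(L, I)\<in>(SIGMA L:Pow K. Pow L).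
        eps L (K - L) * eps I (L - I) * f I x * g (L - I) x * h (K - L) x)"
      unfolding smult_eps sum_distrib_left sum_distrib_right
      by (subst sum.Sigma) (use True fin in \<open>auto simp: mult.assoc intro!: sum.cong\<close>)
    also have "\<dots> = (\<Sum>(I, J)\<in>(SIGMA I:Pow K. Pow (K - I)).
        eps I (K - I) * eps J (K - I - J) * f I x * g J x * h (K - I - J) x)"
    proof (rule sum.reindex_bij_witness[of _ "\<lambda>(I, J). (I \<union> J, I)" "\<lambda>(L, I). (I, L - I)"],
        goal_cases)
      case (5 a)
      obtain L I where a: "a = (L, I)" "L \<subseteq> K" "I \<subseteq> L" using 5 by auto
      define J M where "J = L - I" and "M = K - L"
      have L: "L = I \<union> J" "K - I = J \<union> M" "K - I - J = M" and dj: "I \<inter> J = {}" "J \<inter> M = {}" "I \<inter> M = {}"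
        using a by (auto simp: J_def M_def)
      have f: "finite I" "finite J" "finite M"
        using fin[of I] fin[of J] fin[of M] a by (auto simp: J_def M_def)
      have "eps L M * eps I J = eps I (J \<union> M) * eps J M"
        unfolding L(1) using f dj by (simp add: eps_Un1 eps_Un2)
      then show ?case
        unfolding a prod.case J_def[symmetric] M_def[symmetric] L(3) by (simp add: L(2))
    qed auto
    also have "\<dots> = (f \<star> (g \<star> h)) K x"
      unfolding smult_eps sum_distrib_left sum_distrib_right
      by (subst sum.Sigma) (use True in \<open>auto simp: mult_ac intro!: sum.cong\<close>)
    finally show ?thesis .
  qed (simp add: smult_infinite)
qed

section \<open>Linearity, parity and supercommutativity\<close>

lemma scl_apply: "scl c f I x = c * f I x"
  by (simp add: scl_def)

lemma scl_scl [simp]: "scl a (scl b f) = scl (a * b) f"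
  by (simp add: scl_def mult.assoc)

lemma scl_0 [simp]: "scl 0 f = 0" "scl c 0 = 0" and scl_1 [simp]: "scl 1 f = f"
  by (simp_all add: scl_def fun_eq_iff)

lemma scl_add: "scl c (f + g) = scl c f + scl c g"
  by (simp add: scl_def fun_eq_iff algebra_simps)

lemma scl_add_left: "scl (a + b) f = scl a f + scl b f"
  by (simp add: scl_def fun_eq_iff algebra_simps)

lemma scl_sum: "scl c (\<Sum>i\<in>A. f i) = (\<Sum>i\<in>A. scl c (f i))"
  by (rule additive_sum[of "scl c"]) (simp_all add: scl_add)

lemma scl_sum_left: "scl (\<Sum>i\<in>A. c i) f = (\<Sum>i\<in>A. scl (c i) f)"
  by (induction A rule: infinite_finite_induct) (simp_all add: scl_add_left)

lemma smult_add_left: "(f + g) \<star> h = f \<star> h + g \<star> h"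
  by (simp add: smult_def fun_eq_iff algebra_simps sum.distrib)

lemma smult_add_right: "f \<star> (g + h) = f \<star> g + f \<star> h"
  by (simp add: smult_def fun_eq_iff algebra_simps sum.distrib)

lemma smult_scl_left [simp]: "scl c f \<star> g = scl c (f \<star> g)"
  by (simp add: smult_def scl_def fun_eq_iff sum_distrib_left mult_ac)

lemma smult_scl_right [simp]: "f \<star> scl c g = scl c (f \<star> g)"
  by (simp add: smult_def scl_def fun_eq_iff sum_distrib_left mult_ac)

lemma smult_0 [simp]: "0 \<star> f = 0" "f \<star> 0 = 0"
  by (simp_all add: smult_def fun_eq_iff)

lemma smult_sum_left: "(\<Sum>i\<in>A. f i) \<star> g = (\<Sum>i\<in>A. f i \<star> g)"
  by (rule additive_sum[of "\<lambda>f. f \<star> g"]) (simp_all add: smult_add_left)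

lemma smult_sum_right: "g \<star> (\<Sum>i\<in>A. f i) = (\<Sum>i\<in>A. g \<star> f i)"
  by (rule additive_sum[of "\<lambda>f. g \<star> f"]) (simp_all add: smult_add_right)

lemma twist_0 [simp]: "twist 0 f = f" "twist n 0 = 0"
  by (simp_all add: twist_def fun_eq_iff)

lemma twist_twist [simp]: "twist m (twist n f) = twist (m + n) f"
  by (simp add: twist_def fun_eq_iff sg_add algebra_simps)

lemma twist_cong: "even (m + n) \<Longrightarrow> twist m f = twist n f"
  unfolding twist_def fun_eq_iff by (auto simp: sg_if)

lemma twist_add: "twist n (f + g) = twist n f + twist n g"
  by (simp add: twist_def fun_eq_iff algebra_simps)

lemma twist_scl [simp]: "twist n (scl c f) = scl c (twist n f)"
  by (simp add: twist_def scl_def fun_eq_iff)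

lemma twist_sum: "twist n (\<Sum>i\<in>A. f i) = (\<Sum>i\<in>A. twist n (f i))"
  by (rule additive_sum[of "twist n"]) (simp_all add: twist_add)

lemma twist_smult: "twist n (f \<star> g) = twist n f \<star> twist n g"
proof (intro ext)
  fix K x
  show "twist n (f \<star> g) K x = (twist n f \<star> twist n g) K x"
  proof (cases "finite K")
    case True
    show ?thesis unfolding twist_def smult_eps sum_distrib_left
    proof (rule sum.cong[OF refl])
      fix I assume "I \<in> Pow K"
      then have "card K = card I + card (K - I)"
        using True by (metis PowD card_mono card_Diff_subset finite_subset le_add_diff_inverse)
      then show "sg (n * card K) * (eps I (K - I) * f I x * g (K - I) x) =
          eps I (K - I) * (sg (n * card I) * f I x) * (sg (n * card (K - I)) * g (K - I) x)"
        by (simp add: sg_add algebra_simps)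
    qed
  qed (simp add: smult_infinite twist_def)
qed

definition homog :: "nat \<Rightarrow> sfun \<Rightarrow> bool" where
  "homog d f \<longleftrightarrow> (\<forall>I. f I \<noteq> 0 \<longrightarrow> even (card I + d))"

lemma homog_part: "homog d f \<Longrightarrow> part b f = (if even (b + d) then f else 0)"
  by (fastforce simp: homog_def part_def fun_eq_iff)

text \<open>Exchanging a block of parity \<open>d\<close> with the block \<open>K - J\<close> costs
  \<open>(-1)^(d * card (K - J))\<close>, and the twist records this for each component of
  \<open>f\<close> separately. So \<open>f\<close> may be inhomogeneous.\<close>

lemma smult_commute: "homog d g \<Longrightarrow> f \<star> g = g \<star> twist d f"
proof (intro ext)
  fix K x assume g: "homog d g"
  show "(f \<star> g) K x = (g \<star> twist d f) K x"
  proof (cases "finite K")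
    case True
    have "(f \<star> g) K x = (\<Sum>J\<in>Pow K. eps (K - J) J * f (K - J) x * g J x)"
      unfolding smult_eps
      by (rule sum.reindex_bij_witness[of _ "\<lambda>J. K - J" "\<lambda>J. K - J"]) (auto simp: double_diff)
    also have "\<dots> = (g \<star> twist d f) K x"
      unfolding smult_eps
    proof (rule sum.cong[OF refl])
      fix J assume J: "J \<in> Pow K"
      then have fin: "finite J" "finite (K - J)" using True finite_subset by auto
      show "eps (K - J) J * f (K - J) x * g J x = eps J (K - J) * g J x * twist d f (K - J) x"
      proof (cases "g J x = 0")
        case False
        then have "even (card J + d)" using g by (force simp: homog_def)
        then have "sg (card J * card (K - J)) = sg (d * card (K - J))" by (auto simp: sg_if)
        moreover have "eps J (K - J) * sg (card J * card (K - J)) = eps (K - J) J"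
          using eps_swap[of J "K - J"] fin by (metis Diff_disjoint eps_sq(2))
        ultimately have "eps (K - J) J = eps J (K - J) * sg (d * card (K - J))" by simp
        then show ?thesis by (simp only: twist_def) (simp only: mult_ac)
      qed simp
    qed
    finally show ?thesis .
  qed (simp add: smult_infinite)
qed

section \<open>The Leibniz rule for odd derivatives\<close>

lemma sum_Pow_insert:
  fixes F :: "nat set \<Rightarrow> real"
  assumes "finite K" "j \<notin> K"
  shows "(\<Sum>I\<in>Pow (insert j K). F I) = (\<Sum>I\<in>Pow K. F I + F (insert j I))"
proof -
  have "(\<Sum>I\<in>Pow (insert j K). F I) = (\<Sum>I\<in>Pow K. F I) + (\<Sum>I\<in>insert j ` Pow K. F I)"
    unfolding Pow_insert using assms by (intro sum.union_disjoint) auto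
  also have "inj_on (insert j) (Pow K)"
    using assms by (auto simp: inj_on_def)
  then have "(\<Sum>I\<in>insert j ` Pow K. F I) = (\<Sum>I\<in>Pow K. F (insert j I))"
    by (simp add: sum.reindex)
  finally show ?thesis by (simp add: sum.distrib)
qed

lemma pd_odd: "p \<le> j \<Longrightarrow> pd p j f = (\<lambda>I x. if j \<in> I then 0 else eps {j} I * f (insert j I) x)"
  unfolding pd_def eps_single by simp

text \<open>If \<open>j\<close> is not in \<open>K\<close>, it can be restored to either factor, and
  reaching the second factor costs the parity of the first. If \<open>j\<close> is in
  \<open>K\<close>, the left side is 0, and on the right the sets \<open>I\<close> and
  \<open>insert j I\<close> each keep one summand; these two have opposite signs.\<close>

lemma pd_smult_odd:
  assumes j: "p \<le> j"
  shows "pd p j (f \<star> g) = pd p j f \<star> g + twist 1 f \<star> pd p j g"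
proof (intro ext)
  fix K x
  show "pd p j (f \<star> g) K x = (pd p j f \<star> g + twist 1 f \<star> pd p j g) K x"
  proof (cases "finite K")
    case True
    show ?thesis
    proof (cases "j \<in> K")
      case False
      have "pd p j (f \<star> g) K x = (\<Sum>I\<in>Pow K.
          eps {j} K * (eps I (insert j K - I) * f I x * g (insert j K - I) x +
          eps (insert j I) (insert j K - insert j I) * f (insert j I) x * g (insert j K - insert j I) x))"
        using j False by (simp only: pd_odd smult_eps sum_Pow_insert[OF True False] if_False sum_distrib_left distrib_left)
      also have "\<dots> = (\<Sum>I\<in>Pow K. eps I (K - I) * pd p j f I x * g (K - I) x +
           eps I (K - I) * twist 1 f I x * pd p j g (K - I) x)"
      proof (rule sum.cong[OF refl])
        fix I assume I: "I \<in> Pow K"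
        define J where "J = K - I"
        have f: "finite I" "finite J" using I True finite_subset by (auto simp: J_def)
        have n: "j \<notin> I" "j \<notin> J" and K: "I \<inter> J = {}" "K = I \<union> J"
          using I False by (auto simp: J_def)
        have e: "insert j K - I = insert j J" "insert j K - insert j I = J" using K n by auto
        have s: "eps {j} K = eps {j} I * eps {j} J" using K f by (simp add: eps_Un2)
        show "eps {j} K * (eps I (insert j K - I) * f I x * g (insert j K - I) x +
          eps (insert j I) (insert j K - insert j I) * f (insert j I) x * g (insert j K - insert j I) x)
          = eps I (K - I) * pd p j f I x * g (K - I) x + eps I (K - I) * twist 1 f I x * pd p j g (K - I) x"
          using n f unfolding e s J_def[symmetric]
          by (simp add: eps_insert1[of I J j] eps_insert2[of I J j] eps_to_single[of I j] pd_odd[OF j] twist_def algebra_simps)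
      qed
      finally show ?thesis by (simp add: smult_eps sum.distrib)
    next
      case jK: True
      define K' where "K' = K - {j}"
      have K': "finite K'" "j \<notin> K'" "K = insert j K'" using jK True by (auto simp: K'_def)
      have "(pd p j f \<star> g + twist 1 f \<star> pd p j g) K x =
          (\<Sum>I\<in>Pow K. eps I (K - I) * pd p j f I x * g (K - I) x +
           eps I (K - I) * twist 1 f I x * pd p j g (K - I) x)"
        by (simp add: smult_eps sum.distrib)
      also have "\<dots> = (\<Sum>I\<in>Pow K'. 0)"
        unfolding K'(3) sum_Pow_insert[OF K'(1,2)]
      proof (rule sum.cong[OF refl])
        fix I assume I: "I \<in> Pow K'"
        define J where "J = K' - I"
        have f: "finite I" "finite J" using I K' finite_subset by (auto simp: J_def)
        have n: "j \<notin> I" "j \<notin> J" and K: "I \<inter> J = {}" "K' = I \<union> J"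
          using I K' by (auto simp: J_def)
        have e: "insert j K' - I = insert j J" "insert j K' - insert j I = J" using K n by auto
        show "eps I (insert j K' - I) * pd p j f I x * g (insert j K' - I) x +
          eps I (insert j K' - I) * twist 1 f I x * pd p j g (insert j K' - I) x +
          (eps (insert j I) (insert j K' - insert j I) * pd p j f (insert j I) x * g (insert j K' - insert j I) x +
          eps (insert j I) (insert j K' - insert j I) * twist 1 f (insert j I) x * pd p j g (insert j K' - insert j I) x) = 0"
          using n f unfolding e
          by (simp add: eps_insert1[of I J j] eps_insert2[of I J j] eps_to_single[of I j] pd_odd[OF j] twist_def sg_Suc algebra_simps)
      qed
      finally show ?thesis using jK by (simp add: pd_odd[OF j])
    qed
  qed (simp add: smult_infinite pd_odd[OF j])
qed

lemma twist_same [simp]: "twist (m + m) f = f"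
  using twist_cong[of "m + m" 0 f] by simp

lemma twist_homog: "homog d f \<Longrightarrow> twist m f = scl (sg (m * d)) f"
proof (intro ext)
  fix I x assume "homog d f"
  then have "f I x = 0 \<or> even (card I + d)" by (auto simp: homog_def fun_eq_iff)
  then show "twist m f I x = scl (sg (m * d)) f I x" by (auto simp: twist_def scl_def sg_if)
qed

text \<open>The bridge from the sums over homogeneous components in the definitions to
  twists.\<close>

lemma sum_part_twist: "(\<Sum>b\<in>{0, 1}. scl (sg (m * b)) (part b f)) = twist m f"
  by (auto simp: fun_eq_iff scl_def part_def twist_def sg_if)

lemma part_add: "part b (f + g) = part b f + part b g"
  by (simp add: fun_eq_iff part_def)

lemma part_0 [simp]: "part b 0 = 0"
  by (simp add: fun_eq_iff part_def)

lemma part_scl [simp]: "part b (scl c f) = scl c (part b f)"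
  by (simp add: fun_eq_iff part_def scl_def)

lemma homog_const: "homog 0 (const_sfun c)"
  by (auto simp: homog_def const_sfun_def fun_eq_iff)

lemma homog_coord: "homog (par p j) (coord p j)"
  by (auto simp: homog_def coord_def par_def fun_eq_iff split: if_splits)

lemma homog_smult:
  assumes "homog a f" "homog b g"
  shows "homog (a + b) (f \<star> g)"
  unfolding homog_def
proof (intro allI impI)
  fix K assume "(f \<star> g) K \<noteq> 0"
  then obtain x where x: "(f \<star> g) K x \<noteq> 0" by (auto simp: fun_eq_iff)
  then have fin: "finite K" using smult_infinite by metis
  from x obtain I where I: "I \<subseteq> K" "f I x \<noteq> 0" "g (K - I) x \<noteq> 0"
    unfolding smult_eps by (auto elim!: sum.not_neutral_contains_not_neutral)
  then have "even (card I + a)" "even (card (K - I) + b)"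
    using assms unfolding homog_def by (metis zero_fun_apply)+
  moreover have "card K = card I + card (K - I)"
    using I fin by (metis card_mono card_Diff_subset finite_subset le_add_diff_inverse)
  ultimately show "even (card K + (a + b))" by auto
qed

lemma coord_commute: "f \<star> coord p j = coord p j \<star> twist (par p j) f"
  by (rule smult_commute[OF homog_coord])

section \<open>Superfunctions on a fixed superspace and their derivatives\<close>

locale superspace =
  fixes p q :: nat
begin

abbreviation "SF \<equiv> superfuns p q"
abbreviation "n \<equiv> p + q"
abbreviation "d \<equiv> pd p"
abbreviation "y \<equiv> coord p"
abbreviation "\<pi> \<equiv> par p"

lemma SF_smooth: "f \<in> SF \<Longrightarrow> f I \<in> smooth_funs p"
  by (simp add: superfuns_def)

lemma SF_support: "f \<in> SF \<Longrightarrow> \<not> I \<subseteq> {p..<n} \<Longrightarrow> f I = 0"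
  by (simp add: superfuns_def)

lemma SF_infinite: "f \<in> SF \<Longrightarrow> infinite I \<Longrightarrow> f I x = 0"
  by (metis SF_support finite_atLeastLessThan finite_subset zero_fun_apply)

lemma SF_0 [simp]: "0 \<in> SF"
  using smooth_zero by (auto simp: superfuns_def)

lemma SF_add [simp]: "f \<in> SF \<Longrightarrow> g \<in> SF \<Longrightarrow> f + g \<in> SF"
  by (auto simp: superfuns_def plus_fun_def intro: smooth_add)

lemma SF_scl [simp]: "f \<in> SF \<Longrightarrow> scl c f \<in> SF"
  by (auto simp: superfuns_def scl_def zero_fun_def intro: smooth_cmult)

lemma SF_sum: "(\<And>i. i \<in> A \<Longrightarrow> f i \<in> SF) \<Longrightarrow> (\<Sum>i\<in>A. f i) \<in> SF"
  by (induction A rule: infinite_finite_induct) simp_all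

lemma SF_twist [simp]: "f \<in> SF \<Longrightarrow> twist m f \<in> SF"
  by (auto simp: superfuns_def twist_def zero_fun_def intro: smooth_cmult)

lemma SF_part [simp]: "f \<in> SF \<Longrightarrow> part b f \<in> SF"
  using smooth_zero by (auto simp: superfuns_def part_def)

lemma SF_const [simp]: "const_sfun c \<in> SF"
  using smooth_const by (auto simp: superfuns_def const_sfun_def zero_fun_def)

lemma SF_coord [simp]: "j < n \<Longrightarrow> y j \<in> SF"
proof -
  assume "j < n"
  then have "y j I \<in> smooth_funs p \<and> (\<not> I \<subseteq> {p..<n} \<longrightarrow> y j I = 0)" for I
    by (cases "j < p"; cases "I = {}"; cases "I = {j}")
       (auto simp: coord_def zero_fun_def smooth_const smooth_coord)
  then show ?thesis by (simp add: superfuns_def)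
qed

lemma SF_smult [simp]:
  assumes f: "f \<in> SF" and g: "g \<in> SF"
  shows "f \<star> g \<in> SF"
proof -
  have "(\<lambda>x. \<Sum>I\<in>Pow K. eps I (K - I) * f I x * g (K - I) x) \<in> smooth_funs p" for K
    by (intro smooth_sum smooth_mult smooth_const SF_smooth f g)
  moreover have "(f \<star> g) K = 0" if "\<not> K \<subseteq> {p..<n}" for K
  proof
    fix x
    have "f I x * g (K - I) x = 0" if "I \<subseteq> K" for I
    proof (cases "I \<subseteq> {p..<n}")
      case True
      then have "\<not> K - I \<subseteq> {p..<n}" using \<open>\<not> K \<subseteq> {p..<n}\<close> by blast
      then show ?thesis using SF_support[OF g] by simp
    qed (use SF_support[OF f] in simp)
    then show "(f \<star> g) K x = 0 x" unfolding smult_eps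
      by (auto intro!: sum.neutral)
  qed
  ultimately show ?thesis by (auto simp: superfuns_def smult_eps[abs_def])
qed

lemma d_odd: "p \<le> j \<Longrightarrow> d j f = (\<lambda>I x. if j \<in> I then 0 else eps {j} I * f (insert j I) x)"
  by (rule pd_odd)

lemma d_even: "i < p \<Longrightarrow> d i f = (\<lambda>I. even_pd i (f I))"
  by (simp add: pd_def)

lemma d_0 [simp]: "d i 0 = 0"
  by (auto simp: pd_def fun_eq_iff zero_fun_def even_pd_const)

lemma SF_d [simp]:
  assumes "f \<in> SF" "i < n"
  shows "d i f \<in> SF"
proof (cases "i < p")
  case True
  then show ?thesis using assms unfolding d_even[OF True] superfuns_def
    by (auto intro: even_pd_smooth simp: zero_fun_def even_pd_const)
next
  case False
  then have p: "p \<le> i" by simp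
  have "(\<lambda>x. if i \<in> I then 0 else eps {i} I * f (insert i I) x) \<in> smooth_funs p" for I
    using smooth_const[of 0 p] smooth_cmult[OF SF_smooth[OF assms(1)]] by (cases "i \<in> I") auto
  moreover have "(\<lambda>x. if i \<in> I then 0 else eps {i} I * f (insert i I) x) = 0" if "\<not> I \<subseteq> {p..<n}" for I
    using SF_support[OF assms(1), of "insert i I"] that by auto
  ultimately show ?thesis unfolding d_odd[OF p] superfuns_def by blast
qed

lemma d_add: "f \<in> SF \<Longrightarrow> g \<in> SF \<Longrightarrow> d i (f + g) = d i f + d i g"
  by (cases "i < p")
     (auto simp: d_even d_odd not_less fun_eq_iff plus_fun_def even_pd_add[OF SF_smooth SF_smooth] algebra_simps)

lemma d_scl: "f \<in> SF \<Longrightarrow> d i (scl c f) = scl c (d i f)"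
  by (cases "i < p")
     (auto simp: d_even d_odd not_less fun_eq_iff scl_def even_pd_cmult[OF SF_smooth] algebra_simps)

lemma d_twist:
  assumes "f \<in> SF"
  shows "d i (twist m f) = scl (sg (m * \<pi> i)) (twist m (d i f))"
proof (cases "i < p")
  case True
  then show ?thesis using assms
    by (simp add: d_even twist_def scl_def par_def even_pd_cmult[OF SF_smooth])
next
  case False
  then have p: "p \<le> i" by simp
  show ?thesis
  proof (intro ext)
    fix I x
    show "d i (twist m f) I x = scl (sg (m * \<pi> i)) (twist m (d i f)) I x"
      \<comment> \<open>On an infinite set \<open>card\<close> is 0 and does not change when
        \<open>i\<close> is inserted. Superfunctions vanish there, so the sign rule
        survives.\<close>
      using p SF_infinite[OF assms, of "insert i I"]
      by (cases "finite I") (auto simp: d_odd twist_def scl_def par_def sg_add algebra_simps)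
  qed
qed

lemma d_smult:
  assumes f: "f \<in> SF" and g: "g \<in> SF" and i: "i < n"
  shows "d i (f \<star> g) = d i f \<star> g + twist (\<pi> i) f \<star> d i g"
proof (cases "i < p")
  case True
  have "even_pd i ((f \<star> g) K) x = (\<Sum>I\<in>Pow K. eps I (K - I) * even_pd i (f I) x * g (K - I) x
      + eps I (K - I) * f I x * even_pd i (g (K - I)) x)" for K x
  proof -
    note fg = SF_smooth[OF f] SF_smooth[OF g]
    have "(f \<star> g) K = (\<lambda>x. \<Sum>I\<in>Pow K. (\<lambda>x. eps I (K - I) * (f I x * g (K - I) x)) x)"
      by (simp add: smult_eps fun_eq_iff mult.assoc)
    moreover have "even_pd i (\<lambda>x. \<Sum>I\<in>Pow K. (\<lambda>x. eps I (K - I) * (f I x * g (K - I) x)) x) = (\<lambda>x. \<Sum>I\<in>Pow K. even_pd i (\<lambda>x. eps I (K - I) * (f I x * g (K - I) x)) x)"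
      by (rule even_pd_sum[OF _ True]) (intro smooth_cmult smooth_mult fg)
    ultimately show ?thesis
      by (simp only: even_pd_cmult[OF smooth_mult[OF fg] True] even_pd_mult[OF fg True]
          distrib_left mult.assoc)
  qed
  then show ?thesis using True
    by (simp add: d_even par_def fun_eq_iff smult_eps sum.distrib)
next
  case False
  then show ?thesis using pd_smult_odd[of p i f g] by (simp add: par_def)
qed

lemma d_d:
  assumes f: "f \<in> SF" and i: "i < n" and j: "j < n"
  shows "d i (d j f) = scl (sg (\<pi> i * \<pi> j)) (d j (d i f))"
proof -
  have mixed: "d i (d j f) = d j (d i f)" if "i < p" "p \<le> j" for i j
  proof (intro ext)
    fix I x
    show "d i (d j f) I x = d j (d i f) I x"
      using that even_pd_cmult[OF SF_smooth[OF f, of "insert j I"] that(1)]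
      by (cases "j \<in> I") (simp_all add: d_even d_odd even_pd_const)
  qed
  consider "i < p" "j < p" | "i < p" "p \<le> j" | "p \<le> i" "j < p" | "p \<le> i" "p \<le> j" by linarith
  then show ?thesis
  proof cases
    case 1
    then show ?thesis using even_pd_commute[OF SF_smooth[OF f] 1] by (simp add: d_even par_def)
  next
    case 2
    then show ?thesis using mixed by (simp add: par_def)
  next
    case 3
    then show ?thesis using mixed by (simp add: par_def)
  next
    case 4
    show ?thesis
    proof (intro ext)
      fix I x
      show "d i (d j f) I x = scl (sg (\<pi> i * \<pi> j)) (d j (d i f)) I x"
      proof (cases "finite I \<and> i \<noteq> j \<and> i \<notin> I \<and> j \<notin> I")
        case True
        \<comment> \<open>Exactly one of the two orders of \<open>i\<close> and \<open>j\<close> is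
          an inversion, which makes odd derivatives anticommute.\<close>
        then have "eps {i} {j} * eps {j} {i} = -1"
          using eps_swap[of "{i}" "{j}"] by simp
        then have "eps {i} {j} = - eps {j} {i}"
          by (metis eps_sq(2) mult.commute mult_minus1)
        then show ?thesis using True 4
          by (simp add: d_odd scl_def par_def eps_insert2[of "{j}" I i] eps_insert2[of "{i}" I j] insert_commute)
      next
        case False
        \<comment> \<open>Otherwise both sides are 0: an odd derivative squares to 0, gives nothing
          at a set that contains its index, and infinite sets carry no coefficient.\<close>
        then show ?thesis using 4 SF_infinite[OF f, of "insert i (insert j I)"]
          by (auto simp: d_odd scl_def insert_commute)
      qed
    qed
  qed
qed

lemma d_const [simp]: "d i (const_sfun c) = 0"
  by (auto simp: pd_def const_sfun_def fun_eq_iff even_pd_const)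

lemma d_coord: "d i (y j) = (if i = j then const_sfun 1 else 0)"
proof (intro ext)
  fix I x
  show "d i (y j) I x = (if i = j then const_sfun 1 else 0) I x"
    using even_pd_coord[of i j]
    by (cases "i < p"; cases "j < p")
       (auto simp: d_even d_odd coord_def const_sfun_def even_pd_const fun_eq_iff eps_single
         split: if_splits)
qed

lemma const_smult: "f \<in> SF \<Longrightarrow> const_sfun c \<star> f = scl c f"
proof (intro ext)
  fix K x assume f: "f \<in> SF"
  show "(const_sfun c \<star> f) K x = scl c f K x"
  proof (cases "finite K")
    case True
    have "(const_sfun c \<star> f) K x = (\<Sum>I\<in>Pow K. if I = {} then c * f K x else 0)"
      unfolding smult_eps by (rule sum.cong) (auto simp: const_sfun_def)
    then show ?thesis using True by (simp add: scl_def)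
  qed (use SF_infinite[OF f] in \<open>simp add: smult_infinite scl_def\<close>)
qed

lemma smult_const: "f \<in> SF \<Longrightarrow> f \<star> const_sfun c = scl c f"
  by (simp add: smult_commute[OF homog_const] const_smult)

lemma homog_d: "homog a f \<Longrightarrow> f \<in> SF \<Longrightarrow> homog (a + \<pi> i) (d i f)"
  unfolding homog_def
proof (intro allI impI)
  fix I assume f: "\<forall>I. f I \<noteq> 0 \<longrightarrow> even (card I + a)" "f \<in> SF" and I: "d i f I \<noteq> 0"
  show "even (card I + (a + \<pi> i))"
  proof (cases "i < p")
    case True
    then have "f I \<noteq> 0" using I by (auto simp: d_even zero_fun_def even_pd_const)
    then show ?thesis using f True by (simp add: par_def)
  next
    case False
    then have "f (insert i I) \<noteq> 0" "i \<notin> I" using I by (auto simp: d_odd fun_eq_iff split: if_splits)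
    moreover from this have "finite I" using SF_infinite[OF f(2), of "insert i I"] by (auto simp: fun_eq_iff)
    ultimately show ?thesis using f(1) False by (auto simp: par_def)
  qed
qed

section \<open>Operators on symbols\<close>


definition bel :: "nat \<Rightarrow> nat multiset \<Rightarrow> nat" where
  "bel i K = size (filter_mset (\<lambda>j. p \<le> j \<and> j < i) K)"

definition mpar :: "nat multiset \<Rightarrow> nat" where
  "mpar M = size (filter_mset (\<lambda>j. p \<le> j) M)"

text \<open>Left multiplication by \<open>e_i\<close> on coefficients. The exponent
  \<open>bel i K\<close> counts the odd vectors that \<open>e_i\<close> passes on the way to its
  sorted place; it is 0 for even \<open>i\<close>.\<close>

definition ev :: "nat \<Rightarrow> ssym \<Rightarrow> ssym" where
  "ev i u = (\<lambda>K. if odd_simple p K \<and> i \<in># K then sg (bel i K) * u (K - {#i#}) else 0)"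

text \<open>Interior product with the dual basis row \<open>i\<close> on coefficients. The numerical
  factor is the multiplicity of \<open>i\<close> in the contracted monomial
  \<open>add_mset i K\<close>.\<close>

definition iv :: "nat \<Rightarrow> ssym \<Rightarrow> ssym" where
  "iv i u = (\<lambda>K. real (Suc (count K i)) * sg (bel i K) * u (add_mset i K))"

lemma bel_empty [simp]: "bel i {#} = 0" and mpar_empty [simp]: "mpar {#} = 0"
  by (simp_all add: bel_def mpar_def)

lemma bel_add: "bel i (add_mset j K) = bel i K + (if p \<le> j \<and> j < i then 1 else 0)"
  by (simp add: bel_def)

lemma mpar_add: "mpar (add_mset j K) = mpar K + \<pi> j"
  by (simp add: mpar_def par_def)

lemma odd_simple_add:
  "odd_simple p (add_mset i K) \<longleftrightarrow> odd_simple p K \<and> (i < p \<or> i \<notin># K)"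
proof
  assume A: "odd_simple p (add_mset i K)"
  have "count K j \<le> 1" if "p \<le> j" for j
    using A that unfolding odd_simple_def by (metis count_add_mset le_trans le_SucI order_refl)
  moreover have "i \<notin># K" if "p \<le> i"
    using A that unfolding odd_simple_def not_in_iff by force
  ultimately show "odd_simple p K \<and> (i < p \<or> i \<notin># K)" unfolding odd_simple_def by force
next
  assume "odd_simple p K \<and> (i < p \<or> i \<notin># K)"
  then show "odd_simple p (add_mset i K)"
    unfolding odd_simple_def not_in_iff count_add_mset by force
qed

lemma ev_add: "ev i u (add_mset i K) = (if odd_simple p (add_mset i K) then sg (bel i K) * u K else 0)"
  by (simp add: ev_def bel_add)

lemma ev_eq_0: "i \<notin># K \<or> \<not> odd_simple p K \<Longrightarrow> ev i u K = 0"
  by (auto simp: ev_def)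

text \<open>Of two different odd vectors the larger one passes the smaller one in one order only.
  For equal odd indices both sides are 0, since \<open>odd_simple\<close> excludes the doubled
  index.\<close>

lemma ev_ev: "ev i (ev j u) K = sg (\<pi> i * \<pi> j) * ev j (ev i u) K"
proof (cases "i \<in># K \<and> j \<in># K - {#i#}")
  case True
  then obtain K' where K: "K = add_mset i (add_mset j K')" by (metis insert_DiffM)
  then have K': "K = add_mset j (add_mset i K')" by (simp add: add_mset_commute)
  have "ev i (ev j u) K = (if odd_simple p K then sg (bel i (add_mset j K')) * sg (bel j K') * u K' else 0)"
    unfolding K by (auto simp: ev_add odd_simple_add)
  moreover have "ev j (ev i u) K = (if odd_simple p K then sg (bel j (add_mset i K')) * sg (bel i K') * u K' else 0)"
    unfolding K' by (auto simp: ev_add odd_simple_add)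
  moreover have "\<not> odd_simple p K" if "i = j" "p \<le> i"
    using that by (simp add: K odd_simple_add)
  ultimately show ?thesis
    by (cases "i < j"; cases "i = j") (auto simp: bel_add par_def sg_add)
next
  case False
  have "\<not> (j \<in># K \<and> i \<in># K - {#j#})"
  proof
    assume "j \<in># K \<and> i \<in># K - {#j#}"
    then obtain K' where "K = add_mset j (add_mset i K')" by (metis insert_DiffM)
    then have "K = add_mset i (add_mset j K')" by (simp add: add_mset_commute)
    then show False using False by simp
  qed
  then show ?thesis using False by (auto simp: ev_def)
qed

text \<open>The support condition serves the case of equal odd indices: the sign is then -1, and
  both sides are coefficients at a monomial with a repeated odd index. In general the product of the
  two multiplicities does not depend on the order.\<close>

lemma iv_iv:
  assumes u: "\<And>M. \<not> odd_simple p M \<Longrightarrow> u M = 0"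
  shows "iv i (iv j u) K = sg (\<pi> i * \<pi> j) * iv j (iv i u) K"
proof (cases "i = j \<and> p \<le> i")
  case True
  then have "u (add_mset i (add_mset i K)) = 0" by (intro u) (simp add: odd_simple_add)
  then show ?thesis using True by (simp add: iv_def)
next
  case False
  have e: "sg (if p \<le> i \<and> i < j then 1 else 0) = sg (\<pi> i * \<pi> j) * sg (if p \<le> j \<and> j < i then 1 else 0)"
    using False by (cases "i < j"; cases "i = j") (auto simp: par_def)
  have c: "real (Suc (count K i)) * real (Suc (count (add_mset i K) j)) =
      real (Suc (count K j)) * real (Suc (count (add_mset j K) i))"
    by (cases "i = j") simp_all
  have "iv i (iv j u) K = real (Suc (count K i)) * real (Suc (count (add_mset i K) j)) *
      (sg (bel i K) * sg (bel j K) * u (add_mset j (add_mset i K))) * sg (if p \<le> i \<and> i < j then 1 else 0)"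
    by (simp only: iv_def bel_add sg_add mult_ac)
  moreover have "iv j (iv i u) K = real (Suc (count K j)) * real (Suc (count (add_mset j K) i)) *
      (sg (bel i K) * sg (bel j K) * u (add_mset j (add_mset i K))) * sg (if p \<le> j \<and> j < i then 1 else 0)"
    by (simp only: iv_def bel_add sg_add mult_ac add_mset_commute[of i j])
  ultimately show ?thesis by (simp only: e c mult_ac)
qed

text \<open>For equal even indices this is the difference of the multiplicities
  \<open>count + 1\<close> and \<open>count\<close>. For equal odd indices only one of the two
  compositions can be nonzero at \<open>K\<close>, depending on whether the index occurs in
  \<open>K\<close>.\<close>

lemma iv_ev:
  assumes u: "\<And>M. \<not> odd_simple p M \<Longrightarrow> u M = 0"
  shows "iv i (ev j u) K = (if i = j then u K else 0) + sg (\<pi> i * \<pi> j) * ev j (iv i u) K"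
proof (cases "j \<in># K")
  case True
  then obtain K' where K: "K = add_mset j K'" by (metis insert_DiffM)
  show ?thesis
  proof (cases "i = j")
    case True
    have "iv i (ev j u) K = real (Suc (Suc (count K' j))) * (if odd_simple p K \<and> j < p then u K else 0)"
      using True by (auto simp: K iv_def ev_add odd_simple_add)
    moreover have "ev j (iv i u) K = (if odd_simple p K then real (Suc (count K' j)) * u K else 0)"
      using True by (simp add: K iv_def ev_add)
    moreover have "count K' j = 0" if "odd_simple p K" "p \<le> j"
      using that by (simp add: K odd_simple_add not_in_iff)
    ultimately show ?thesis using u[of K] True
      by (cases "odd_simple p K"; cases "j < p") (simp_all add: par_def algebra_simps)
  next
    case False
    have K2: "add_mset i K = add_mset j (add_mset i K')" by (simp add: K add_mset_commute)
    have "iv i (ev j u) K = real (Suc (count K i)) * sg (bel i K) *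
        (if odd_simple p (add_mset i K) then sg (bel j (add_mset i K')) * u (add_mset i K') else 0)"
      unfolding iv_def K2 by (simp add: ev_add)
    moreover have "ev j (iv i u) K =
        (if odd_simple p K then sg (bel j K') * (real (Suc (count K i)) * sg (bel i K') * u (add_mset i K')) else 0)"
      using False unfolding K by (simp add: ev_add iv_def)
    moreover have "u (add_mset i K') = 0" if "odd_simple p K" "\<not> odd_simple p (add_mset i K)"
      using that False by (intro u) (auto simp: K odd_simple_add)
    moreover have "odd_simple p K" if "odd_simple p (add_mset i K)"
      using that by (simp add: odd_simple_add)
    ultimately show ?thesis using False
      by (cases "i < j") (auto simp: K bel_add par_def sg_add)
  qed
next
  case False
  have "iv i (ev j u) K = (if i = j then u K else 0)"
  proof (cases "i = j")
    case True
    have "u K = 0" if "\<not> odd_simple p (add_mset j K)" using that False u[of K] by (simp add: odd_simple_add)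
    then show ?thesis using True False by (simp add: iv_def ev_add not_in_iff)
  next
    case neq: False
    then show ?thesis using False by (simp add: iv_def ev_eq_0)
  qed
  then show ?thesis using False by (simp add: ev_eq_0)
qed

section \<open>Operators on symbols with superfunction coefficients\<close>

abbreviation "S \<equiv> symbols p q"

definition Y :: "nat \<Rightarrow> symb \<Rightarrow> symb" where
  "Y j T = (\<lambda>M. y j \<star> T M)"

definition P :: "nat \<Rightarrow> symb \<Rightarrow> symb" where
  "P j T = (\<lambda>M. d j (T M))"

text \<open>The twist is the sign for moving \<open>e_i\<close> past the coefficient; the twist in
  \<open>I\<close> has the same origin.\<close>

definition E :: "nat \<Rightarrow> symb \<Rightarrow> symb" where
  "E i T = (\<lambda>K. if odd_simple p K \<and> i \<in># K
     then scl (sg (bel i K)) (twist (\<pi> i) (T (K - {#i#}))) else 0)"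

definition I :: "nat \<Rightarrow> symb \<Rightarrow> symb" where
  "I i T = (\<lambda>K. scl (real (Suc (count K i)) * sg (bel i K)) (twist (\<pi> i) (T (add_mset i K))))"

definition ssc :: "real \<Rightarrow> symb \<Rightarrow> symb" where
  "ssc c T = (\<lambda>M. scl c (T M))"

text \<open>The parity automorphism of symbols, to the power \<open>m\<close>: the parity of a term
  is that of its coefficient plus that of its monomial.\<close>

definition Tw :: "nat \<Rightarrow> symb \<Rightarrow> symb" where
  "Tw m T = (\<lambda>M. scl (sg (m * mpar M)) (twist m (T M)))"

text \<open>A function of the degree operator, which is \<open>Dg real\<close>. Degree-dependent
  coefficients kept in this form move past other operators by a shift in the argument of
  \<open>\<phi>\<close>.\<close>

definition Dg :: "(nat \<Rightarrow> real) \<Rightarrow> symb \<Rightarrow> symb" where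
  "Dg \<phi> T = (\<lambda>M. scl (\<phi> (size M)) (T M))"

definition sing :: "nat multiset \<Rightarrow> sfun \<Rightarrow> symb" where
  "sing M g = (\<lambda>K. if K = M then g else 0)"

lemma E_apply: "E i T K J x = sg (\<pi> i * card J) * ev i (\<lambda>M. T M J x) K"
  by (auto simp: E_def ev_def scl_def twist_def)

lemma I_apply: "I i T K J x = sg (\<pi> i * card J) * iv i (\<lambda>M. T M J x) K"
  by (auto simp: I_def iv_def scl_def twist_def)

lemma symbolsI:
  assumes "\<And>M. T M \<in> SF" "finite A" "\<And>M. T M \<noteq> 0 \<Longrightarrow> M \<in> A \<and> set_mset M \<subseteq> {..<n} \<and> odd_simple p M"
  shows "T \<in> S"
proof -
  have "finite {M. T M \<noteq> 0}" by (rule finite_subset[OF _ assms(2)]) (use assms(3) in blast)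
  then show ?thesis using assms(1,3) unfolding symbols_def sym_monos_def by blast
qed

lemma S_SF [simp]: "T \<in> S \<Longrightarrow> T M \<in> SF"
  unfolding symbols_def by blast

lemma S_finite: "T \<in> S \<Longrightarrow> finite {M. T M \<noteq> 0}"
  unfolding symbols_def by blast

lemma S_support: "T \<in> S \<Longrightarrow> T M \<noteq> 0 \<Longrightarrow> set_mset M \<subseteq> {..<n} \<and> odd_simple p M"
  unfolding symbols_def sym_monos_def by blast

lemma S_odd_simple: "T \<in> S \<Longrightarrow> \<not> odd_simple p M \<Longrightarrow> T M = 0"
  using S_support by blast

lemma S_transfer:
  assumes "T \<in> S" "\<And>M. T M \<in> SF \<Longrightarrow> F M (T M) \<in> SF" "\<And>M. F M 0 = 0"
  shows "(\<lambda>M. F M (T M)) \<in> S"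
proof (rule symbolsI[OF _ S_finite[OF assms(1)]])
  show "M \<in> {M. T M \<noteq> 0} \<and> set_mset M \<subseteq> {..<n} \<and> odd_simple p M" if "F M (T M) \<noteq> 0" for M
  proof -
    have "T M \<noteq> 0" using that assms(3) by metis
    then show ?thesis using S_support[OF assms(1)] by blast
  qed
qed (use assms in simp)

lemma S_0 [simp]: "0 \<in> S"
  by (rule symbolsI[of _ "{}"]) auto

lemma S_add [simp]:
  assumes "T \<in> S" "U \<in> S" shows "T + U \<in> S"
proof (rule symbolsI)
  show "finite ({M. T M \<noteq> 0} \<union> {M. U M \<noteq> 0})" using assms S_finite by simp
  show "M \<in> {M. T M \<noteq> 0} \<union> {M. U M \<noteq> 0} \<and> set_mset M \<subseteq> {..<n} \<and> odd_simple p M"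
    if "(T + U) M \<noteq> 0" for M
    using that S_support[OF assms(1), of M] S_support[OF assms(2), of M]
    by (cases "T M = 0"; cases "U M = 0") auto
qed (use assms in auto)

lemma S_ssc [simp]: "T \<in> S \<Longrightarrow> ssc c T \<in> S"
  unfolding ssc_def using S_transfer[of T "\<lambda>M. scl c"] by simp

lemma S_diff [simp]: "T \<in> S \<Longrightarrow> U \<in> S \<Longrightarrow> T - U \<in> S"
proof -
  assume *: "T \<in> S" "U \<in> S"
  have "T - U = T + ssc (-1) U" by (auto simp: ssc_def scl_def fun_eq_iff)
  with * show ?thesis by (simp only: S_add S_ssc)
qed

lemma S_sum: "(\<And>a. a \<in> A \<Longrightarrow> f a \<in> S) \<Longrightarrow> (\<Sum>a\<in>A. f a) \<in> S"
  by (induction A rule: infinite_finite_induct) simp_all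

lemma S_Y [simp]: "T \<in> S \<Longrightarrow> j < n \<Longrightarrow> Y j T \<in> S"
  unfolding Y_def using S_transfer[of T "\<lambda>M. smult (y j)"] by simp

lemma S_P [simp]: "T \<in> S \<Longrightarrow> j < n \<Longrightarrow> P j T \<in> S"
  unfolding P_def using S_transfer[of T "\<lambda>M. d j"] by simp

lemma S_Tw [simp]: "T \<in> S \<Longrightarrow> Tw m T \<in> S"
  unfolding Tw_def using S_transfer[of T "\<lambda>M f. scl (sg (m * mpar M)) (twist m f)"] by simp

lemma S_Dg [simp]: "T \<in> S \<Longrightarrow> Dg \<phi> T \<in> S"
  unfolding Dg_def using S_transfer[of T "\<lambda>M. scl (\<phi> (size M))"] by simp

lemma S_E [simp]:
  assumes "T \<in> S" "i < n" shows "E i T \<in> S"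
proof (rule symbolsI)
  show "finite (add_mset i ` {M. T M \<noteq> 0})" using assms S_finite by simp
  show "M \<in> add_mset i ` {M. T M \<noteq> 0} \<and> set_mset M \<subseteq> {..<n} \<and> odd_simple p M"
    if "E i T M \<noteq> 0" for M
  proof -
    from that have M: "odd_simple p M" "i \<in># M" "T (M - {#i#}) \<noteq> 0"
      by (auto simp: E_def split: if_splits)
    then have "M = add_mset i (M - {#i#})" by simp
    moreover from this have "set_mset M = insert i (set_mset (M - {#i#}))" by (metis set_mset_add_mset_insert)
    moreover have "M \<in> add_mset i ` {M. T M \<noteq> 0}"
      by (rule image_eqI[of _ _ "M - {#i#}"]) (use M in simp_all)
    ultimately show ?thesis using M S_support[OF assms(1) M(3)] assms(2) by auto
  qed
qed (use assms in \<open>auto simp: E_def\<close>)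

lemma S_I [simp]:
  assumes "T \<in> S" shows "I i T \<in> S"
proof (rule symbolsI)
  show "finite ((\<lambda>M. M - {#i#}) ` {M. T M \<noteq> 0})" using assms S_finite by simp
  show "M \<in> (\<lambda>M. M - {#i#}) ` {M. T M \<noteq> 0} \<and> set_mset M \<subseteq> {..<n} \<and> odd_simple p M"
    if "I i T M \<noteq> 0" for M
  proof -
    from that have M: "T (add_mset i M) \<noteq> 0" by (auto simp: I_def)
    moreover have "M \<in> (\<lambda>M. M - {#i#}) ` {M. T M \<noteq> 0}"
      by (rule image_eqI[of _ _ "add_mset i M"]) (use M in simp_all)
    ultimately show ?thesis using S_support[OF assms M] by (simp add: odd_simple_add)
  qed
qed (use assms in \<open>auto simp: I_def\<close>)

lemma S_sing [simp]:
  assumes "g \<in> SF" "M \<in> sym_monos p q" shows "sing M g \<in> S"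
  by (rule symbolsI[of _ "{M}"]) (use assms in \<open>auto simp: sing_def sym_monos_def split: if_splits\<close>)

lemma S_induct [consumes 1, case_names sing add]:
  assumes T: "T \<in> S"
    and sing: "\<And>M g. M \<in> sym_monos p q \<Longrightarrow> g \<in> SF \<Longrightarrow> Q (sing M g)"
    and add: "\<And>T U. T \<in> S \<Longrightarrow> U \<in> S \<Longrightarrow> Q T \<Longrightarrow> Q U \<Longrightarrow> Q (T + U)"
  shows "Q T"
proof -
  have Q0: "Q 0"
  proof -
    have "sing {#} 0 = 0" by (auto simp: sing_def)
    moreover have "{#} \<in> sym_monos p q" by (simp add: sym_monos_def odd_simple_def)
    ultimately show ?thesis using sing[of "{#}" 0] by simp
  qed
  have "Q (\<Sum>M\<in>A. sing M (T M)) \<and> (\<Sum>M\<in>A. sing M (T M)) \<in> S" if "finite A" "A \<subseteq> sym_monos p q" for A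
    using that by (induction A) (auto simp: Q0 T intro!: add sing)
  moreover have "T = (\<Sum>M\<in>{M. T M \<noteq> 0}. sing M (T M))"
  proof
    fix K
    have "(\<Sum>M\<in>{M. T M \<noteq> 0}. sing M (T M)) K = (\<Sum>M\<in>{M. T M \<noteq> 0}. if K = M then T M else 0)"
      by (simp only: sum_fun_apply sing_def)
    then show "T K = (\<Sum>M\<in>{M. T M \<noteq> 0}. sing M (T M)) K" using S_finite[OF T] by simp
  qed
  moreover have "{M. T M \<noteq> 0} \<subseteq> sym_monos p q" using S_support[OF T] by (auto simp: sym_monos_def)
  ultimately show ?thesis using S_finite[OF T] by metis
qed

lemma ssc_ssc [simp]: "ssc a (ssc b T) = ssc (a * b) T"
  and ssc_1 [simp]: "ssc 1 T = T"
  and ssc_0 [simp]: "ssc c 0 = 0" "ssc 0 T = 0"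
  and ssc_add: "ssc c (T + U) = ssc c T + ssc c U"
  and ssc_add_left: "ssc (a + b) T = ssc a T + ssc b T"
  by (auto simp: ssc_def fun_eq_iff scl_def algebra_simps)

lemma ssc_diff: "ssc c (T - U) = ssc c T - ssc c U"
  and ssc_minus_left: "ssc (- c) T = - ssc c T"
  by (auto simp: ssc_def fun_eq_iff scl_def algebra_simps)

lemma ssc_sum: "ssc c (\<Sum>a\<in>A. f a) = (\<Sum>a\<in>A. ssc c (f a))"
  by (rule additive_sum[of "ssc c"]) (simp_all add: ssc_add)

lemma Y_lin: "Y j (T + U) = Y j T + Y j U" "Y j (ssc c T) = ssc c (Y j T)"
  by (auto simp: Y_def ssc_def fun_eq_iff smult_add_right)

lemma E_lin: "E j (T + U) = E j T + E j U" "E j (ssc c T) = ssc c (E j T)"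
  by (auto simp: E_def ssc_def fun_eq_iff twist_add scl_add scl_def twist_def algebra_simps)

lemma I_lin: "I j (T + U) = I j T + I j U" "I j (ssc c T) = ssc c (I j T)"
  by (auto simp: I_def ssc_def fun_eq_iff twist_add scl_add scl_def twist_def algebra_simps)

lemma Tw_lin: "Tw j (T + U) = Tw j T + Tw j U" "Tw j (ssc c T) = ssc c (Tw j T)"
  by (auto simp: Tw_def ssc_def fun_eq_iff twist_add scl_add scl_def twist_def algebra_simps)

lemma Dg_lin: "Dg j (T + U) = Dg j T + Dg j U" "Dg j (ssc c T) = ssc c (Dg j T)"
  by (auto simp: Dg_def ssc_def fun_eq_iff scl_add scl_def algebra_simps)

lemma P_lin: "T \<in> S \<Longrightarrow> U \<in> S \<Longrightarrow> P j (T + U) = P j T + P j U" "T \<in> S \<Longrightarrow> P j (ssc c T) = ssc c (P j T)"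
  by (auto simp: P_def ssc_def fun_eq_iff d_add d_scl)

lemma op_0 [simp]: "Y j 0 = 0" "P j 0 = 0" "E j 0 = 0" "I j 0 = 0" "Tw j 0 = 0" "Dg \<phi> 0 = 0"
  by (auto simp: Y_def P_def E_def I_def Tw_def Dg_def fun_eq_iff)

section \<open>Supercommutation relations\<close>

lemma P_Y: "T \<in> S \<Longrightarrow> i < n \<Longrightarrow> j < n \<Longrightarrow>
    P i (Y j T) = (if i = j then T else 0) + ssc (sg (\<pi> i * \<pi> j)) (Y j (P i T))"
  by (rule ext) (auto simp: P_def Y_def ssc_def d_smult d_coord const_smult twist_homog[OF homog_coord])

lemma P_P: "T \<in> S \<Longrightarrow> i < n \<Longrightarrow> j < n \<Longrightarrow> P i (P j T) = ssc (sg (\<pi> i * \<pi> j)) (P j (P i T))"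
  by (rule ext) (simp add: P_def ssc_def d_d[of _ i j])

lemma Y_Y: "Y i (Y j T) = ssc (sg (\<pi> i * \<pi> j)) (Y j (Y i T))"
  by (rule ext) (simp add: Y_def ssc_def smult_assoc[symmetric] coord_commute[of "y i" p j]
      twist_homog[OF homog_coord] mult.commute)

lemma P_E: "T \<in> S \<Longrightarrow> P i (E j T) = ssc (sg (\<pi> i * \<pi> j)) (E j (P i T))"
  by (rule ext) (simp add: P_def E_def ssc_def d_scl d_twist mult_ac)

lemma P_I: "T \<in> S \<Longrightarrow> P i (I j T) = ssc (sg (\<pi> i * \<pi> j)) (I j (P i T))"
  by (rule ext) (simp add: P_def I_def ssc_def d_scl d_twist mult_ac)

lemma E_Y: "E i (Y j T) = ssc (sg (\<pi> i * \<pi> j)) (Y j (E i T))"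
  by (rule ext) (simp add: Y_def E_def ssc_def twist_smult twist_homog[OF homog_coord] mult_ac)

lemma I_Y: "I i (Y j T) = ssc (sg (\<pi> i * \<pi> j)) (Y j (I i T))"
  by (rule ext) (simp add: Y_def I_def ssc_def twist_smult twist_homog[OF homog_coord] mult_ac)

lemma ev_cmult: "ev i (\<lambda>M. c * u M) K = c * ev i u K"
  by (simp add: ev_def)

lemma iv_cmult: "iv i (\<lambda>M. c * u M) K = c * iv i u K"
  by (simp add: iv_def)

lemma E_E: "E i (E j T) = ssc (sg (\<pi> i * \<pi> j)) (E j (E i T))"
  by (intro ext) (simp add: E_apply ssc_def scl_apply ev_cmult ev_ev[of i j] mult_ac)

lemma I_I: "T \<in> S \<Longrightarrow> I i (I j T) = ssc (sg (\<pi> i * \<pi> j)) (I j (I i T))"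
  by (intro ext) (simp add: I_apply ssc_def scl_apply iv_cmult iv_iv[of _ i j] S_odd_simple mult_ac)

lemma I_E: "T \<in> S \<Longrightarrow> I i (E j T) = (if i = j then T else 0) + ssc (sg (\<pi> i * \<pi> j)) (E j (I i T))"
  by (intro ext) (simp add: I_apply E_apply ssc_def scl_apply iv_cmult ev_cmult iv_ev[of _ i j]
      S_odd_simple algebra_simps)

lemma Tw_Y: "Tw m (Y j T) = ssc (sg (m * \<pi> j)) (Y j (Tw m T))"
  by (rule ext) (simp add: Tw_def Y_def ssc_def twist_smult twist_homog[OF homog_coord] mult_ac)

lemma Tw_P: "T \<in> S \<Longrightarrow> P j (Tw m T) = ssc (sg (m * \<pi> j)) (Tw m (P j T))"
  by (rule ext) (simp add: Tw_def P_def ssc_def d_scl d_twist mult_ac)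

lemma Tw_E: "Tw m (E j T) = ssc (sg (m * \<pi> j)) (E j (Tw m T))"
proof
  fix K
  show "Tw m (E j T) K = ssc (sg (m * \<pi> j)) (E j (Tw m T)) K"
  proof (cases "j \<in># K")
    case True
    then obtain K' where K: "K = add_mset j K'" by (metis insert_DiffM)
    show ?thesis by (simp add: K Tw_def E_def ssc_def mpar_add sg_add distrib_left add.commute mult_ac)
  qed (simp add: Tw_def E_def ssc_def)
qed

lemma Tw_I: "I j (Tw m T) = ssc (sg (m * \<pi> j)) (Tw m (I j T))"
  by (rule ext) (simp add: Tw_def I_def ssc_def mpar_add sg_add distrib_left add.commute mult_ac)

lemma Tw_Tw: "Tw m (Tw k T) = Tw (m + k) T"
  by (rule ext) (simp add: Tw_def sg_add distrib_right mult_ac)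

lemma Tw_same [simp]: "Tw (m + m) T = T"
  by (rule ext) (simp add: Tw_def sg_add distrib_right)

lemma Dg_Y: "Dg \<phi> (Y j T) = Y j (Dg \<phi> T)"
  by (rule ext) (simp add: Dg_def Y_def)

lemma Dg_P: "T \<in> S \<Longrightarrow> Dg \<phi> (P j T) = P j (Dg \<phi> T)"
  by (rule ext) (simp add: Dg_def P_def d_scl)

lemma Dg_E: "Dg \<phi> (E j T) = E j (Dg (\<lambda>k. \<phi> (Suc k)) T)"
  by (rule ext) (auto simp: Dg_def E_def mult.commute dest: size_Suc_Diff1)

lemma Dg_I: "I j (Dg \<phi> T) = Dg (\<lambda>k. \<phi> (Suc k)) (I j T)"
  by (rule ext) (simp add: Dg_def I_def mult_ac)

lemma Dg_Dg: "Dg \<phi> (Dg \<psi> T) = Dg (\<lambda>k. \<phi> k * \<psi> k) T"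
  by (rule ext) (simp add: Dg_def)

lemma E_sing: "E i (sing M g) =
    (if odd_simple p (add_mset i M) then sing (add_mset i M) (scl (sg (bel i M)) (twist (\<pi> i) g)) else 0)"
proof
  fix K
  show "E i (sing M g) K = (if odd_simple p (add_mset i M)
      then sing (add_mset i M) (scl (sg (bel i M)) (twist (\<pi> i) g)) else 0) K"
  proof (cases "i \<in># K")
    case True
    then obtain K' where K: "K = add_mset i K'" by (metis insert_DiffM)
    show ?thesis by (simp add: K E_def sing_def bel_add)
  qed (auto simp: E_def sing_def)
qed


section \<open>The given algebraic operations in terms of multiplication and contraction\<close>

lemma finite_submultisets: "finite {M. M \<subseteq># K}" for K :: "nat multiset"
proof (induction K)
  case (add x K)
  have "{M. M \<subseteq># add_mset x K} \<subseteq> {M. M \<subseteq># K} \<union> add_mset x ` {M. M \<subseteq># K}"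
  proof
    fix M assume "M \<in> {M. M \<subseteq># add_mset x K}"
    then have M: "M \<subseteq># add_mset x K" by simp
    show "M \<in> {M. M \<subseteq># K} \<union> add_mset x ` {M. M \<subseteq># K}"
    proof (cases "x \<in># M")
      case True
      then obtain N where "M = add_mset x N" by (metis insert_DiffM)
      then show ?thesis using M by auto
    next
      case False
      then show ?thesis using M
        by (metis UnI1 diff_single_trivial mem_Collect_eq subset_eq_diff_conv add_mset_add_single)
    qed
  qed
  then show ?case by (rule finite_subset) (use add in auto)
qed simp

text \<open>The product counts a set of indices, \<open>bel\<close> counts with multiplicity; the
  two agree because odd indices are not repeated.\<close>

lemma card_bel: "odd_simple p K \<Longrightarrow> card {j. j \<in># K \<and> p \<le> j \<and> j < i} = bel i K"
proof (induction K)
  case (add x K)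
  have "{j. j \<in># add_mset x K \<and> p \<le> j \<and> j < i} =
      (if p \<le> x \<and> x < i then insert x {j. j \<in># K \<and> p \<le> j \<and> j < i} else {j. j \<in># K \<and> p \<le> j \<and> j < i})"
    by auto
  moreover have "finite {j. j \<in># K \<and> p \<le> j \<and> j < i}"
    by (rule finite_subset[of _ "set_mset K"]) auto
  moreover have "card {j. j \<in># K \<and> p \<le> j \<and> j < i} = bel i K" and "p \<le> x \<Longrightarrow> x \<notin># K"
    using add by (auto simp: odd_simple_add)
  ultimately show ?case
    by (cases "p \<le> x \<and> x < i") (simp_all only: if_True if_False bel_add card_insert_disjoint
      mem_Collect_eq simp_thms not_False_eq_True Suc_eq_plus1 add_0_right)
qed simp

text \<open>Only the submultiset \<open>{#i#}\<close> contributes, and its inversions are the odd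
  vectors below \<open>i\<close>.\<close>

lemma vee_basis_vec: "vee p (basis_vec i) u = ev i u"
proof
  fix K
  show "vee p (basis_vec i) u K = ev i u K"
  proof (cases "odd_simple p K \<and> i \<in># K")
    case True
    then obtain K' where K: "K = add_mset i K'" by (metis insert_DiffM)
    have "vee p (basis_vec i) u K = (\<Sum>M | M \<subseteq># K. if M = {#i#} then
       sg (card {(i', j). i' \<in># M \<and> j \<in># K - M \<and> p \<le> j \<and> j < i'}) * u (K - M) else 0)"
      using True unfolding vee_def by (auto simp: basis_vec_def smono_def intro!: sum.cong)
    also have "\<dots> = sg (card {(i', j). i' \<in># {#i#} \<and> j \<in># K' \<and> p \<le> j \<and> j < i'}) * u K'"
      using True finite_submultisets[of K] by (simp add: K)
    also have "{(i', j). i' \<in># {#i#} \<and> j \<in># K' \<and> p \<le> j \<and> j < i'} = Pair i ` {j. j \<in># K' \<and> p \<le> j \<and> j < i}"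
      by auto
    also have "card \<dots> = bel i K'"
      using True by (subst card_image) (auto simp: inj_on_def K odd_simple_add card_bel)
    finally show ?thesis using True by (simp add: K ev_add)
  next
    case False
    have "smono {#i#} M = 0" if "M \<subseteq># K" "odd_simple p K" for M
      using that False by (auto simp: smono_def)
    then show ?thesis using False by (simp add: ev_eq_0 vee_def basis_vec_def)
  qed
qed

lemma vee_zero: "vee p 0 u = 0"
  by (simp add: vee_def fun_eq_iff)

lemma ev_zero [simp]: "ev i 0 = 0"
  by (simp add: ev_def fun_eq_iff)

lemma foldr_ev_zero [simp]: "foldr ev w 0 = 0"
  by (induction w) (simp_all only: foldr.simps comp_apply id_apply ev_zero)

lemma vees_append: "vees p (map basis_vec u @ vs) = foldr ev u (vees p vs)"
  by (induction u) (simp_all add: vees_def vee_basis_vec)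

lemma vees_basis: "vees p (map basis_vec u) = foldr ev u (smono {#})"
  using vees_append[of u "[]"] by (simp add: vees_def)

lemma ev_smono:
  "ev i (smono M) = (if odd_simple p (add_mset i M) then (\<lambda>K. sg (bel i M) * smono (add_mset i M) K) else 0)"
proof
  fix K
  show "ev i (smono M) K =
    (if odd_simple p (add_mset i M) then (\<lambda>K. sg (bel i M) * smono (add_mset i M) K) else 0) K"
  proof (cases "i \<in># K")
    case True
    then obtain K' where K: "K = add_mset i K'" by (metis insert_DiffM)
    show ?thesis by (simp add: K ev_add smono_def)
  qed (auto simp: ev_def smono_def)
qed

lemma bel_eq_0: "(\<And>j. j \<in># M \<Longrightarrow> i \<le> j) \<Longrightarrow> bel i M = 0"
proof (induction M)
  case (add x M)
  then have "i \<le> x" "bel i M = 0" by simp_all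
  then show ?case by (simp add: bel_add)
qed simp

text \<open>In a sorted word no vector has to pass a smaller one, so no sign arises.\<close>

lemma foldr_ev_sorted:
  "sorted w \<Longrightarrow> odd_simple p (mset w) \<Longrightarrow> foldr ev w (smono {#}) = smono (mset w)"
proof (induction w)
  case (Cons a w)
  then have "bel a (mset w) = 0" by (intro bel_eq_0) auto
  with Cons show ?case by (simp add: odd_simple_add ev_smono)
qed simp

lemma foldr_ev_ev:
  "foldr ev u (ev j z) = (\<lambda>K. sg (\<pi> j * sum_list (map \<pi> u)) * ev j (foldr ev u z) K)"
proof (induction u)
  case (Cons i u)
  show ?case
  proof
    fix K
    have "foldr ev (i # u) (ev j z) K = sg (\<pi> j * sum_list (map \<pi> u)) * (sg (\<pi> i * \<pi> j) * ev j (ev i (foldr ev u z)) K)"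
      by (simp add: Cons ev_cmult ev_ev[of i j])
    then show "foldr ev (i # u) (ev j z) K = sg (\<pi> j * sum_list (map \<pi> (i # u))) * ev j (foldr ev (i # u) z) K"
      by (simp add: sg_add distrib_left mult_ac)
  qed
qed simp

lemma sum_take: "l \<le> length w \<Longrightarrow> (\<Sum>m<l. f (w ! m)) = sum_list (map f (take l w))"
  for f :: "nat \<Rightarrow> nat"
  by (simp add: sum_list_sum_nth atLeast0LessThan)

lemma ev_sum: "ev i (\<lambda>K. \<Sum>l\<in>A. f l K) K = (\<Sum>l\<in>A. ev i (f l) K)"
proof (cases "odd_simple p K \<and> i \<in># K")
  case False
  then have "ev i u K = 0" for u by (auto simp: ev_def)
  then show ?thesis by simp
qed (simp add: ev_def sum_distrib_left)

lemma mat_basis_unit: "j < n \<Longrightarrow> mat_basis p q (unit_mat i j) c = (if c = i then basis_vec j else 0)"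
  by (auto simp: mat_basis_def unit_mat_def fun_eq_iff if_distrib if_distribR cong: if_cong)

text \<open>Replacing an occurrence of \<open>e_i\<close> by \<open>e_j\<close> amounts to deleting
  it and multiplying by \<open>e_j\<close> in front. Pulling \<open>e_j\<close> to the front removes
  \<open>\<pi> j\<close> from the sign of the matrix, and the remaining sign is that of the interior
  product.\<close>

lemma rho_sym_unit:
  assumes "j < n"
  shows "rho_sym p q (\<pi> i + \<pi> j) (unit_mat i j) M K = ev j (interior_sym p (\<pi> i) (basis_row i) M) K"
proof -
  define w where "w = sorted_list_of_multiset M"
  define z where "z = (\<lambda>l. foldr ev (take l w @ drop (Suc l) w) (smono {#}))"
  define s where "s = (\<lambda>l. \<Sum>m<l. \<pi> (w ! m))"
  have *: "vees p (map basis_vec (take l w) @ [mat_basis p q (unit_mat i j) (w ! l)]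
      @ map basis_vec (drop (Suc l) w)) K =
      (if w ! l = i then sg (\<pi> j * s l) * ev j (z l) K else 0)" if "l < length w" for l
  proof (cases "w ! l = i")
    case True
    have "vees p ([basis_vec j] @ map basis_vec (drop (Suc l) w)) =
        ev j (foldr ev (drop (Suc l) w) (smono {#}))"
      using vees_basis[of "j # drop (Suc l) w"] by simp
    then show ?thesis using True that assms
      by (simp add: mat_basis_unit vees_append foldr_ev_ev z_def s_def sum_take)
  next
    case False
    have "vees p ([0] @ map basis_vec (drop (Suc l) w)) = 0"
      by (simp add: vees_def vee_zero)
    then show ?thesis using False assms by (simp add: mat_basis_unit vees_append)
  qed
  have "rho_sym p q (\<pi> i + \<pi> j) (unit_mat i j) M K =
      (\<Sum>l<length w. sg ((\<pi> i + \<pi> j) * s l) * (if w ! l = i then sg (\<pi> j * s l) * ev j (z l) K else 0))"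
    unfolding rho_sym_def Let_def w_def[symmetric]
    by (intro sum.cong refl) (simp only: *[unfolded s_def] s_def lessThan_iff)
  also have "\<dots> = (\<Sum>l<length w. ev j (\<lambda>K. sg (\<pi> i * s l) * basis_row i (w ! l) * z l K) K)"
    by (rule sum.cong) (simp_all add: ev_cmult basis_row_def sg_add distrib_right mult.assoc)
  also have "\<dots> = ev j (interior_sym p (\<pi> i) (basis_row i) M) K"
    unfolding interior_sym_def Let_def w_def[symmetric] s_def z_def ev_sum[symmetric] map_append[symmetric]
      vees_basis ..
  finally show ?thesis .
qed

text \<open>For even \<open>i\<close> all signs are 1 and the positions are counted. For odd
  \<open>i\<close> there is at most one position, and the odd letters before it are those below
  \<open>i\<close>.\<close>

lemma sorted_occurrences:
  "sorted w \<Longrightarrow> odd_simple p (mset w) \<Longrightarrow>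
    (\<Sum>l<length w. sg (\<pi> i * (\<Sum>m<l. \<pi> (w ! m))) * (if w ! l = i then 1 else 0)) =
    real (count (mset w) i) * sg (bel i (mset w))"
proof (induction w)
  case (Cons a w)
  have "(\<Sum>l<length (a # w). sg (\<pi> i * (\<Sum>m<l. \<pi> ((a # w) ! m))) * (if (a # w) ! l = i then 1 else 0)) =
      (if a = i then 1 else 0) + (\<Sum>l<length w. sg (\<pi> i * (\<pi> a + (\<Sum>m<l. \<pi> (w ! m)))) * (if w ! l = i then 1 else 0))"
    by (simp add: sum.lessThan_Suc_shift del: sum.lessThan_Suc)
  also have "\<dots> = (if a = i then 1 else 0) + sg (\<pi> i * \<pi> a) *
      (\<Sum>l<length w. sg (\<pi> i * (\<Sum>m<l. \<pi> (w ! m))) * (if w ! l = i then 1 else 0))"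
    by (simp only: sg_add distrib_left[of "\<pi> i"] mult.assoc sum_distrib_left[where r = "sg (\<pi> i * \<pi> a)"])
  also have "\<dots> = (if a = i then 1 else 0) + sg (\<pi> i * \<pi> a) * (real (count (mset w) i) * sg (bel i (mset w)))"
    using Cons by (simp add: odd_simple_add)
  also have "\<dots> = real (count (mset (a # w)) i) * sg (bel i (mset (a # w)))"
  proof -
    have "bel i (mset w) = 0" if "i \<le> a" using that Cons.prems(1) by (intro bel_eq_0) fastforce
    moreover have "count (mset w) i = 0" if "i < a" using that Cons.prems(1) by (auto simp: count_eq_zero_iff)
    moreover have "count (mset w) i = 0" if "a = i" "p \<le> i"
      using that Cons.prems(2) by (auto simp: odd_simple_add count_eq_zero_iff)
    ultimately show ?thesis
      by (cases a i rule: linorder_cases) (auto simp: bel_add par_def sg_add)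
  qed
  finally show ?case .
qed simp

lemma interior_sym_basis:
  assumes M: "odd_simple p M"
  shows "interior_sym p (\<pi> i) (basis_row i) M K =
    (if M = add_mset i K then real (Suc (count K i)) * sg (bel i K) else 0)"
proof -
  define w where "w = sorted_list_of_multiset M"
  have w: "sorted w" "mset w = M" by (simp_all add: w_def)
  have *: "foldr ev (take l w @ drop (Suc l) w) (smono {#}) = smono (M - {#i#})"
    if "l < length w" "w ! l = i" for l
  proof -
    have "w = take l w @ i # drop (Suc l) w" using that by (metis id_take_nth_drop)
    then have s: "sorted (take l w @ i # drop (Suc l) w)" and "M = add_mset i (mset (take l w @ drop (Suc l) w))"
      using w by (metis, metis mset.simps(2) mset_append union_mset_add_mset_right)
    moreover have "sorted (take l w @ drop (Suc l) w)" using s by (auto simp: sorted_append)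
    ultimately show ?thesis using M by (subst foldr_ev_sorted) (auto simp: odd_simple_add)
  qed
  have "interior_sym p (\<pi> i) (basis_row i) M K =
      (\<Sum>l<length w. (sg (\<pi> i * (\<Sum>m<l. \<pi> (w ! m))) * (if w ! l = i then 1 else 0)) * smono (M - {#i#}) K)"
    unfolding interior_sym_def Let_def w_def[symmetric]
    unfolding map_append[symmetric] vees_basis basis_row_def
  proof (intro sum.cong refl)
    show "sg (\<pi> i * (\<Sum>m<l. \<pi> (w ! m))) * (if w ! l = i then 1 else 0) *
        foldr ev (take l w @ drop (Suc l) w) (smono {#}) K =
        sg (\<pi> i * (\<Sum>m<l. \<pi> (w ! m))) * (if w ! l = i then 1 else 0) * smono (M - {#i#}) K"
      if "l \<in> {..<length w}" for l
      using that by (cases "w ! l = i") (simp_all only: * lessThan_iff if_False mult_zero_left mult_zero_right)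
  qed
  also have "\<dots> = real (count M i) * sg (bel i M) * smono (M - {#i#}) K"
    using sorted_occurrences[of w i] w M by (simp add: sum_distrib_right[symmetric])
  also have "\<dots> = (if M = add_mset i K then real (Suc (count K i)) * sg (bel i K) else 0)"
  proof (cases "i \<in># M")
    case True
    then obtain M' where "M = add_mset i M'" by (metis insert_DiffM)
    then show ?thesis by (auto simp: smono_def bel_add)
  qed (auto simp: not_in_iff)
  finally show ?thesis .
qed

lemma interior_eq:
  assumes T: "T \<in> S"
  shows "interior p (\<pi> i) (basis_row i) T = I i T"
proof
  fix K
  have "interior p (\<pi> i) (basis_row i) T K =
      (\<Sum>M | T M \<noteq> 0. scl (interior_sym p (\<pi> i) (basis_row i) M K) (twist (\<pi> i) (T M)))"
    unfolding interior_def sum_fun_apply tensor_def scl_sum[symmetric] sum_part_twist ..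
  also have "\<dots> = (\<Sum>M | T M \<noteq> 0. if M = add_mset i K then I i T K else 0)"
    by (rule sum.cong) (auto simp: interior_sym_basis S_support[OF T] I_def)
  also have "\<dots> = I i T K"
    using S_finite[OF T] by (auto simp: I_def)
  finally show "interior p (\<pi> i) (basis_row i) T K = I i T K" .
qed

section \<open>Divergence and Lie derivative of symbols\<close>

definition dv :: "symb \<Rightarrow> symb" where
  "dv T = (\<Sum>j<n. ssc (sg (\<pi> j)) (I j (P j T)))"

lemma sdiv_eq: "T \<in> S \<Longrightarrow> sdiv p q T = dv T"
  unfolding sdiv_def dv_def ssc_def
  by (rule sum.cong) (auto simp: interior_eq P_def[symmetric])

definition hfield :: "nat \<Rightarrow> vfield \<Rightarrow> bool" where
  "hfield c X \<longleftrightarrow> (\<forall>i<n. X i \<in> SF \<and> homog (c + \<pi> i) (X i))"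

lemma vpart_homog: "hfield c X \<Longrightarrow> i < n \<Longrightarrow> vpart p a X i = (if even (a + c) then X i else 0)"
  unfolding vpart_def hfield_def by (subst homog_part[of "c + \<pi> i"]) auto

lemma vapply_cong: "(\<And>i. i < n \<Longrightarrow> X i = X' i) \<Longrightarrow> vapply p q X f = vapply p q X' f"
  unfolding vapply_def by (intro sum.cong) auto

lemma vdiv_cong: "(\<And>i. i < n \<Longrightarrow> X i = X' i) \<Longrightarrow> vdiv p q X = vdiv p q X'"
  unfolding vdiv_def by (intro sum.cong) auto

lemma vdiv_homog:
  assumes X: "hfield c X"
  shows "vdiv p q X = (\<Sum>i<n. scl (sg (\<pi> i * (c + 1))) (d i (X i)))"
  unfolding vdiv_def
proof (rule sum.cong[OF refl])
  fix i assume "i \<in> {..<n}"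
  then have h: "homog (c + \<pi> i) (X i)" using X by (auto simp: hfield_def)
  show "(\<Sum>b\<in>{0, 1}. scl (sg (\<pi> i * b)) (d i (part b (X i)))) = scl (sg (\<pi> i * (c + 1))) (d i (X i))"
    using par_cases[of p i] by (auto simp: homog_part[OF h] sg_if)
qed

text \<open>The supertrace part of \<open>rho\<close> adds up to \<open>\<delta>\<close> times the
  divergence and turns the derivative of the coefficient into a density action. The other part is
  \<open>E j\<close> after \<open>I i\<close>, by \<open>rho_sym_unit\<close>.\<close>

lemma lie_symbol_homog:
  assumes X: "hfield c X" and T: "T \<in> S"
  shows "lie_symbol p q \<delta> X T K = lie_density p q \<delta> X (T K) -
    (\<Sum>i<n. \<Sum>j<n. scl (sg (\<pi> i * c)) (d i (X j) \<star> E j (I i T) K))"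
proof -
  define J where "J = (\<lambda>i j. scl (sg (\<pi> i * c + 1)) (d i (X j)))"
  \<comment> \<open>\<open>J i j\<close> has parity \<open>c + \<pi> i + \<pi> j\<close>. Moving it
    to the left of \<open>f\<close> cancels the twist by \<open>c\<close> and leaves the twist that
    \<open>E j\<close> and \<open>I i\<close> put on the coefficient.\<close>
  have J: "twist c f \<star> J i j = J i j \<star> twist (\<pi> i + \<pi> j) f" if "j < n" for i j f
  proof -
    have "homog (c + \<pi> j) (X j)" "X j \<in> SF" using X that by (auto simp: hfield_def)
    then have "homog (c + \<pi> j + \<pi> i) (d i (X j))" by (rule homog_d)
    then have "twist c f \<star> J i j = J i j \<star> twist (c + \<pi> j + \<pi> i) (twist c f)"
      by (simp add: J_def smult_commute)
    also have "twist (c + \<pi> j + \<pi> i) (twist c f) = twist (\<pi> i + \<pi> j) f"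
      unfolding twist_twist by (rule twist_cong) auto
    finally show ?thesis .
  qed
  have jac: "jac p a (vpart p a X) i j = (if even (a + c) then J i j else 0)" if "j < n" for a i j
    using that par_cases[of p i] by (auto simp: jac_def J_def vpart_homog[OF X] sg_if)
  \<comment> \<open>Of the two values of \<open>a\<close> only the parity of \<open>X\<close>
    contributes, and the sum over \<open>b\<close> is a twist.\<close>
  have inner: "(\<Sum>a\<in>{0, 1}. \<Sum>b\<in>{0, 1}. scl (sg (a * b)) (part b f \<star> jac p a (vpart p a X) i j))
      = J i j \<star> twist (\<pi> i + \<pi> j) f" if "j < n" for i j f
  proof -
    have "(\<Sum>b\<in>{0, 1}. scl (sg (a * b)) (part b f \<star> g)) = twist a f \<star> g" for a g
      unfolding sum_part_twist[symmetric] smult_sum_left smult_scl_left ..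
    then have "(\<Sum>a\<in>{0, 1}. \<Sum>b\<in>{0, 1}. scl (sg (a * b)) (part b f \<star> jac p a (vpart p a X) i j))
        = (\<Sum>a\<in>{0, 1}. if even (a + c) then twist a f \<star> J i j else 0)"
      unfolding jac[OF that] by (intro sum.cong) (auto simp del: One_nat_def)
    also have "\<dots> = twist c f \<star> J i j"
      using twist_cong[of 0 c f] twist_cong[of 1 c f] by (cases "even c") auto
    finally show ?thesis using J[OF that] by simp
  qed
  have "(\<Sum>a\<in>{0, 1}. \<Sum>b\<in>{0, 1}. \<Sum>i<n. \<Sum>j<n.
        tensor (scl (sg (a * b)) (part b (T M) \<star> jac p a (vpart p a X) i j))
          (rho p q \<delta> (\<pi> i + \<pi> j) (unit_mat i j) M)) K =
      (\<Sum>i<n. \<Sum>j<n. scl (rho p q \<delta> (\<pi> i + \<pi> j) (unit_mat i j) M K)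
        (J i j \<star> twist (\<pi> i + \<pi> j) (T M)))" for M
  proof -
    have "(\<Sum>a\<in>{0, 1}. \<Sum>b\<in>{0, 1}. \<Sum>i<n. \<Sum>j<n.
        tensor (scl (sg (a * b)) (part b (T M) \<star> jac p a (vpart p a X) i j))
          (rho p q \<delta> (\<pi> i + \<pi> j) (unit_mat i j) M)) K =
      (\<Sum>a\<in>{0, 1}. \<Sum>b\<in>{0, 1}. \<Sum>i<n. \<Sum>j<n. scl (rho p q \<delta> (\<pi> i + \<pi> j) (unit_mat i j) M K)
        (scl (sg (a * b)) (part b (T M) \<star> jac p a (vpart p a X) i j)))"
      by (simp only: sum_fun_apply tensor_def)
    also have "\<dots> = (\<Sum>i<n. \<Sum>j<n. \<Sum>a\<in>{0, 1}. \<Sum>b\<in>{0, 1}. scl (rho p q \<delta> (\<pi> i + \<pi> j) (unit_mat i j) M K)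
        (scl (sg (a * b)) (part b (T M) \<star> jac p a (vpart p a X) i j)))"
      by (simp only: sum.swap[of _ "{..<n}" "{0, 1}"])
    also have "\<dots> = (\<Sum>i<n. \<Sum>j<n. scl (rho p q \<delta> (\<pi> i + \<pi> j) (unit_mat i j) M K)
        (J i j \<star> twist (\<pi> i + \<pi> j) (T M)))"
      by (intro sum.cong refl) (simp only: scl_sum[symmetric] inner lessThan_iff)
    finally show ?thesis .
  qed
  then have "lie_symbol p q \<delta> X T K = (\<Sum>M | T M \<noteq> 0. scl (smono M K) (vapply p q X (T M)) +
      (\<Sum>i<n. \<Sum>j<n. scl (rho p q \<delta> (\<pi> i + \<pi> j) (unit_mat i j) M K) (J i j \<star> twist (\<pi> i + \<pi> j) (T M))))"
    unfolding lie_symbol_def by (simp only: sum_fun_apply plus_fun_apply) (simp only: tensor_def)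
  also have "\<dots> = (\<Sum>M | T M \<noteq> 0. scl (smono M K) (vapply p q X (T M))) +
      (\<Sum>i<n. \<Sum>j<n. J i j \<star> twist (\<pi> i + \<pi> j)
        (\<Sum>M | T M \<noteq> 0. scl (rho p q \<delta> (\<pi> i + \<pi> j) (unit_mat i j) M K) (T M)))"
    by (simp only: sum.distrib sum.swap[of _ "{M. T M \<noteq> 0}"] twist_sum smult_sum_right twist_scl smult_scl_right)
  also have "(\<Sum>M | T M \<noteq> 0. scl (smono M K) (vapply p q X (T M))) = vapply p q X (T K)"
  proof -
    have "(\<Sum>M | T M \<noteq> 0. scl (smono M K) (vapply p q X (T M))) =
        (\<Sum>M | T M \<noteq> 0. if M = K then vapply p q X (T K) else 0)"
      by (intro sum.cong) (auto simp: smono_def)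
    then show ?thesis using S_finite[OF T] by (auto simp: vapply_def)
  qed
  also have "(\<Sum>i<n. \<Sum>j<n. J i j \<star> twist (\<pi> i + \<pi> j)
        (\<Sum>M | T M \<noteq> 0. scl (rho p q \<delta> (\<pi> i + \<pi> j) (unit_mat i j) M K) (T M))) =
      (\<Sum>i<n. \<Sum>j<n. (if i = j then scl (- \<delta> * sg (\<pi> i)) (J i i \<star> T K) else 0) + J i j \<star> E j (I i T) K)"
  proof (intro sum.cong refl)
    fix i j assume ij: "i \<in> {..<n}" "j \<in> {..<n}"
    have str: "str p q (unit_mat i j) = (if i = j then sg (\<pi> i) else 0)"
      using ij by (cases "i = j") (auto simp: str_def unit_mat_def if_distrib cong: if_cong intro!: sum.neutral)
    have "(\<Sum>M | T M \<noteq> 0. scl (rho p q \<delta> (\<pi> i + \<pi> j) (unit_mat i j) M K) (T M)) =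
       (\<Sum>M | T M \<noteq> 0. (if M = K then scl (if i = j then - \<delta> * sg (\<pi> i) else 0) (T K) else 0) +
          (if M = add_mset i (K - {#j#}) then twist (\<pi> i + \<pi> j) (E j (I i T) K) else 0))"
    proof (intro sum.cong refl)
      fix M assume "M \<in> {M. T M \<noteq> 0}"
      then have M: "odd_simple p M" using S_support[OF T] by simp
      have "scl (rho_sym p q (\<pi> i + \<pi> j) (unit_mat i j) M K) (T M) =
          (if M = add_mset i (K - {#j#}) then twist (\<pi> i + \<pi> j) (E j (I i T) K) else 0)"
        using ij M by (auto simp: rho_sym_unit ev_def interior_sym_basis E_def I_def add.commute[of "\<pi> j"])
      moreover have "scl (- \<delta> * str p q (unit_mat i j) * smono M K) (T M) =
          (if M = K then scl (if i = j then - \<delta> * sg (\<pi> i) else 0) (T K) else 0)"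
        by (auto simp: str smono_def)
      ultimately show "scl (rho p q \<delta> (\<pi> i + \<pi> j) (unit_mat i j) M K) (T M) =
         (if M = K then scl (if i = j then - \<delta> * sg (\<pi> i) else 0) (T K) else 0) +
          (if M = add_mset i (K - {#j#}) then twist (\<pi> i + \<pi> j) (E j (I i T) K) else 0)"
        by (simp only: rho_def scl_add_left)
    qed
    also have "\<dots> = scl (if i = j then - \<delta> * sg (\<pi> i) else 0) (T K) + twist (\<pi> i + \<pi> j) (E j (I i T) K)"
    proof -
      \<comment> \<open>If the single contributing monomial lies outside the range of summation, its
        term is 0 anyway.\<close>
      have "E j (I i T) K = 0" if "T (add_mset i (K - {#j#})) = 0"
        using that by (simp add: E_def I_def)
      then show ?thesis using S_finite[OF T] by (auto simp: sum.distrib)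
    qed
    finally show "J i j \<star> twist (\<pi> i + \<pi> j)
        (\<Sum>M | T M \<noteq> 0. scl (rho p q \<delta> (\<pi> i + \<pi> j) (unit_mat i j) M K) (T M)) =
      (if i = j then scl (- \<delta> * sg (\<pi> i)) (J i i \<star> T K) else 0) + J i j \<star> E j (I i T) K"
      by (auto simp: twist_add smult_add_right twist_same simp del: twist_twist) (auto simp: twist_twist)
  qed
  also have "\<dots> = scl \<delta> (vdiv p q X \<star> T K) -
      (\<Sum>i<n. \<Sum>j<n. scl (sg (\<pi> i * c)) (d i (X j) \<star> E j (I i T) K))"
  proof -
    have "scl (- \<delta> * sg (\<pi> i)) (J i i \<star> T K) = scl \<delta> (scl (sg (\<pi> i * (c + 1))) (d i (X i)) \<star> T K)" for i
      by (simp add: J_def sg_add distrib_left sg_Suc mult_ac)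
    moreover have "J i j \<star> E j (I i T) K = - scl (sg (\<pi> i * c)) (d i (X j) \<star> E j (I i T) K)" for i j
      by (simp add: J_def sg_Suc fun_eq_iff scl_apply)
    moreover have "(\<Sum>i<n. \<Sum>j<n. (if i = j then A i else 0) + B i j) = (\<Sum>i<n. A i) + (\<Sum>i<n. \<Sum>j<n. B i j)"
      for A :: "nat \<Rightarrow> sfun" and B
      by (simp add: sum.distrib)
    ultimately show ?thesis
      by (simp only: vdiv_homog[OF X] smult_sum_left scl_sum sum_negf diff_conv_add_uminus)
  qed
  finally show ?thesis by (simp only: lie_density_def smult_scl_left add_diff_eq)
qed

section \<open>Differential operators\<close>


text \<open>The operator with total symbol \<open>T\<close>, before the cut-off that
  \<open>diff_op\<close> makes outside the superfunctions.\<close>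

definition \<Phi> :: "symb \<Rightarrow> sfun \<Rightarrow> sfun" where
  "\<Phi> T f = (\<Sum>M | T M \<noteq> 0. T M \<star> pd_mono p M f)"

lemma foldr_d_SF: "set w \<subseteq> {..<n} \<Longrightarrow> f \<in> SF \<Longrightarrow> foldr d w f \<in> SF"
  by (induction w) auto

lemma pd_mono_SF [simp]: "set_mset M \<subseteq> {..<n} \<Longrightarrow> f \<in> SF \<Longrightarrow> pd_mono p M f \<in> SF"
  by (simp add: pd_mono_def foldr_d_SF)

lemma foldr_d_lin:
  assumes "set w \<subseteq> {..<n}" "f \<in> SF" "g \<in> SF"
  shows "foldr d w (f + g) = foldr d w f + foldr d w g" "foldr d w (scl c f) = scl c (foldr d w f)"
  using assms by (induction w) (simp_all add: d_add d_scl foldr_d_SF)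

lemma pd_mono_lin:
  assumes "set_mset M \<subseteq> {..<n}" "f \<in> SF" "g \<in> SF"
  shows "pd_mono p M (f + g) = pd_mono p M f + pd_mono p M g"
    "pd_mono p M (scl c f) = scl c (pd_mono p M f)"
  using assms by (simp_all add: pd_mono_def foldr_d_lin)

lemma pd_mono_twist:
  assumes "set_mset M \<subseteq> {..<n}" "f \<in> SF"
  shows "pd_mono p M (twist m f) = scl (sg (m * mpar M)) (twist m (pd_mono p M f))"
proof -
  have "foldr d w (twist m f) = scl (sg (m * mpar (mset w))) (twist m (foldr d w f))"
    if "set w \<subseteq> {..<n}" for w
    using that assms(2)
    by (induction w) (simp_all add: d_scl d_twist foldr_d_SF mpar_add sg_add distrib_left mult.commute)
  then show ?thesis using assms(1) by (simp add: pd_mono_def)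
qed

text \<open>The new derivative passes the smaller indices up to its sorted place, with a sign for
  each odd pair. A repeated odd derivative anticommutes with itself and gives 0.\<close>

lemma d_foldr_d:
  assumes "sorted w" "set w \<subseteq> {..<n}" "odd_simple p (mset w)" "i < n" "f \<in> SF"
  shows "d i (foldr d w f) = (if odd_simple p (add_mset i (mset w))
    then scl (sg (bel i (mset w))) (foldr d (List.insort i w) f) else 0)"
  using assms(1-3)
proof (induction w)
  case Nil
  show ?case by (simp add: odd_simple_add) (simp add: odd_simple_def)
next
  case (Cons a w)
  have w: "foldr d w f \<in> SF" using Cons.prems assms(5) by (auto intro: foldr_d_SF)
  have a: "a < n" using Cons.prems by simp
  show "d i (foldr d (a # w) f) = (if odd_simple p (add_mset i (mset (a # w)))
    then scl (sg (bel i (mset (a # w)))) (foldr d (List.insort i (a # w)) f) else 0)"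
  proof (cases "i \<le> a")
    case True
    have b: "bel i (mset (a # w)) = 0" using Cons.prems True by (intro bel_eq_0) fastforce
    show ?thesis
    proof (cases "odd_simple p (add_mset i (mset (a # w)))")
      case False
      then have "p \<le> i" "i \<in> set (a # w)" using Cons.prems(3) by (auto simp: odd_simple_add)
      moreover from this have "i = a" using True Cons.prems(1) by auto
      ultimately have "d i (d a (foldr d w f)) = scl (-1) (d i (d a (foldr d w f)))"
        using d_d[OF w a a] by (simp add: par_def)
      then have "d i (d a (foldr d w f)) = 0" by (auto simp: fun_eq_iff scl_def)
      then show ?thesis using False by simp
    qed (use b True in simp)
  next
    case False
    have ins: "foldr d (List.insort i w) f \<in> SF"
      using Cons.prems(2) assms(4,5) by (intro foldr_d_SF) (auto simp: set_insort_key)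
    have os: "odd_simple p (add_mset i (mset (a # w))) \<longleftrightarrow> odd_simple p (add_mset i (mset w))"
      using False Cons.prems(3) by (auto simp: odd_simple_add)
    have sgn: "sg (bel i (mset (a # w))) = sg (\<pi> i * \<pi> a) * sg (bel i (mset w))"
      using False by (auto simp: bel_add sg_add par_def)
    have "d i (foldr d (a # w) f) = scl (sg (\<pi> i * \<pi> a)) (d a (d i (foldr d w f)))"
      using d_d[OF w assms(4) a] by simp
    moreover have "d i (foldr d w f) = (if odd_simple p (add_mset i (mset w))
        then scl (sg (bel i (mset w))) (foldr d (List.insort i w) f) else 0)"
      using Cons by (simp add: odd_simple_add)
    ultimately have "d i (foldr d (a # w) f) = (if odd_simple p (add_mset i (mset w))
        then scl (sg (\<pi> i * \<pi> a) * sg (bel i (mset w))) (d a (foldr d (List.insort i w) f)) else 0)"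
      using ins by (cases "odd_simple p (add_mset i (mset w))") (simp_all only: d_scl scl_scl if_True if_False d_0 scl_0)
    then show ?thesis using False unfolding os sgn by simp
  qed
qed

lemma d_pd_mono:
  assumes "set_mset M \<subseteq> {..<n}" "odd_simple p M" "i < n" "f \<in> SF"
  shows "d i (pd_mono p M f) = (if odd_simple p (add_mset i M)
    then scl (sg (bel i M)) (pd_mono p (add_mset i M) f) else 0)"
  using d_foldr_d[of "sorted_list_of_multiset M" i f] assms by (simp add: pd_mono_def)

lemma \<Phi>_superset: "finite A \<Longrightarrow> {M. T M \<noteq> 0} \<subseteq> A \<Longrightarrow> \<Phi> T f = (\<Sum>M\<in>A. T M \<star> pd_mono p M f)"
  unfolding \<Phi>_def by (rule sum.mono_neutral_left) auto

lemma \<Phi>_add: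
  assumes "T \<in> S" "U \<in> S"
  shows "\<Phi> (T + U) f = \<Phi> T f + \<Phi> U f"
proof -
  define A where "A = {M. T M \<noteq> 0} \<union> {M. U M \<noteq> 0}"
  have A: "finite A" using assms by (simp add: A_def S_finite)
  have "{M. (T + U) M \<noteq> 0} \<subseteq> A" by (auto simp: A_def)
  then have "\<Phi> (T + U) f = (\<Sum>M\<in>A. (T + U) M \<star> pd_mono p M f)" using A by (rule \<Phi>_superset[rotated])
  also have "\<dots> = (\<Sum>M\<in>A. T M \<star> pd_mono p M f) + (\<Sum>M\<in>A. U M \<star> pd_mono p M f)"
    by (simp add: smult_add_left sum.distrib)
  also have "(\<Sum>M\<in>A. T M \<star> pd_mono p M f) = \<Phi> T f" by (rule \<Phi>_superset[OF A, symmetric]) (simp add: A_def)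
  also have "(\<Sum>M\<in>A. U M \<star> pd_mono p M f) = \<Phi> U f" by (rule \<Phi>_superset[OF A, symmetric]) (simp add: A_def)
  finally show ?thesis .
qed

lemma \<Phi>_0 [simp]: "\<Phi> 0 f = 0"
  by (simp add: \<Phi>_def)

lemma \<Phi>_ssc:
  assumes "T \<in> S"
  shows "\<Phi> (ssc c T) f = scl c (\<Phi> T f)"
proof -
  have "\<Phi> (ssc c T) f = (\<Sum>M\<in>{M. T M \<noteq> 0}. ssc c T M \<star> pd_mono p M f)"
    by (rule \<Phi>_superset) (auto simp: ssc_def S_finite[OF assms])
  then show ?thesis by (simp add: ssc_def \<Phi>_def scl_sum)
qed

lemma \<Phi>_sing: "\<Phi> (sing M g) f = g \<star> pd_mono p M f"
proof -
  have "{N. sing M g N \<noteq> 0} \<subseteq> {M}" by (auto simp: sing_def)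
  then have "\<Phi> (sing M g) f = (\<Sum>N\<in>{M}. sing M g N \<star> pd_mono p N f)" by (intro \<Phi>_superset) simp_all
  then show ?thesis by (simp only: sing_def) simp
qed

lemma \<Phi>_diff: "T \<in> S \<Longrightarrow> U \<in> S \<Longrightarrow> \<Phi> (T - U) f = \<Phi> T f - \<Phi> U f"
  using \<Phi>_add[of "T - U" U f] by (simp add: eq_diff_eq)

lemma \<Phi>_sum: "(\<And>a. a \<in> A \<Longrightarrow> T a \<in> S) \<Longrightarrow> \<Phi> (\<Sum>a\<in>A. T a) f = (\<Sum>a\<in>A. \<Phi> (T a) f)"
  by (induction A rule: infinite_finite_induct) (simp_all add: \<Phi>_add S_sum)

lemma \<Phi>_SF [simp]: "T \<in> S \<Longrightarrow> f \<in> SF \<Longrightarrow> \<Phi> T f \<in> SF"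
  unfolding \<Phi>_def by (intro SF_sum SF_smult pd_mono_SF) (use S_support in auto)

lemma \<Phi>_lin:
  assumes "T \<in> S" "f \<in> SF" "g \<in> SF"
  shows "\<Phi> T (f + g) = \<Phi> T f + \<Phi> T g" "\<Phi> T (scl c f) = scl c (\<Phi> T f)"
  unfolding \<Phi>_def using S_support[OF assms(1)] assms(2,3)
  by (simp_all add: pd_mono_lin smult_add_right sum.distrib[symmetric] scl_sum)

lemma \<Phi>_sum_arg: "T \<in> S \<Longrightarrow> (\<And>a. a \<in> A \<Longrightarrow> f a \<in> SF) \<Longrightarrow> \<Phi> T (\<Sum>a\<in>A. f a) = (\<Sum>a\<in>A. \<Phi> T (f a))"
proof (induction A rule: infinite_finite_induct)
  case (insert a A)
  then have "\<Phi> T (f a + sum f A) = \<Phi> T (f a) + (\<Sum>a\<in>A. \<Phi> T (f a))" by (simp add: \<Phi>_lin SF_sum)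
  then show "\<Phi> T (sum f (insert a A)) = (\<Sum>a\<in>insert a A. \<Phi> T (f a))" using insert.hyps by simp
qed (use \<Phi>_lin(2)[of T 0 0 0] in simp_all)

lemma \<Phi>_Y: "\<Phi> (Y j T) f = y j \<star> \<Phi> T f" if "T \<in> S"
proof -
  have "\<Phi> (Y j T) f = (\<Sum>M\<in>{M. T M \<noteq> 0}. Y j T M \<star> pd_mono p M f)"
    by (rule \<Phi>_superset) (auto simp: Y_def S_finite[OF that])
  then show ?thesis by (simp add: Y_def \<Phi>_def smult_assoc smult_sum_right)
qed

lemma sym_monosD: "M \<in> sym_monos p q \<Longrightarrow> set_mset M \<subseteq> {..<n}" "M \<in> sym_monos p q \<Longrightarrow> odd_simple p M"
  by (auto simp: sym_monos_def)

lemma P_sing: "P i (sing M g) = sing M (d i g)"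
  by (auto simp: P_def sing_def)

lemma Tw_sing: "Tw m (sing M g) = sing M (scl (sg (m * mpar M)) (twist m g))"
  by (auto simp: Tw_def sing_def)

text \<open>The derivative either hits the coefficient or passes it and joins the monomial; the
  twist in \<open>E i\<close> is the sign of passing.\<close>

lemma \<Phi>_PE:
  assumes T: "T \<in> S" and i: "i < n" and f: "f \<in> SF"
  shows "d i (\<Phi> T f) = \<Phi> (P i T) f + \<Phi> (E i T) f"
  using T
proof (induction rule: S_induct)
  case (sing M g)
  note M = sym_monosD[OF sing(1)]
  show ?case using M sing f i
    by (simp add: \<Phi>_sing P_sing E_sing d_smult d_pd_mono)
next
  case (add T U)
  have "d i (\<Phi> T f) = \<Phi> (P i T) f + \<Phi> (E i T) f" "d i (\<Phi> U f) = \<Phi> (P i U) f + \<Phi> (E i U) f"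
    by (rule add.IH)+
  then show "d i (\<Phi> (T + U) f) = \<Phi> (P i (T + U)) f + \<Phi> (E i (T + U)) f"
    using add.hyps i f by (simp add: \<Phi>_add P_lin E_lin d_add)
qed

text \<open>Conjugation by the parity automorphism multiplies a term by the sign of its total
  parity, coefficient plus monomial.\<close>

lemma \<Phi>_Tw:
  assumes T: "T \<in> S" and f: "f \<in> SF"
  shows "\<Phi> (Tw m T) f = twist m (\<Phi> T (twist m f))"
  using T
proof (induction rule: S_induct)
  case (sing M g)
  show ?case using sym_monosD(1)[OF sing(1)] f
    by (simp add: \<Phi>_sing Tw_sing pd_mono_twist twist_smult)
next
  case (add T U)
  then show "\<Phi> (Tw m (T + U)) f = twist m (\<Phi> (T + U) (twist m f))"
    by (simp add: \<Phi>_add Tw_lin twist_add)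
qed

text \<open>
  Every monomial is obtained from its coefficient by applying the operators \<open>E a\<close>, and
  \<open>\<Phi> (E a U) = d a \<circ> \<Phi> U - \<Phi> (P a U)\<close>.  So composition on the right with an operator \<open>op\<close> is
  given by a map \<open>R\<close> of symbols as soon as this holds on symbols of degree 0 and \<open>R\<close> commutes
  with \<open>P a + E a\<close>.
\<close>

lemma right_composition:
  assumes op: "op f \<in> SF" and f: "f \<in> SF"
    and R: "\<And>T. T \<in> S \<Longrightarrow> R T \<in> S" "\<And>T U. T \<in> S \<Longrightarrow> U \<in> S \<Longrightarrow> R (T + U) = R T + R U"
    and base: "\<And>g. g \<in> SF \<Longrightarrow> \<Phi> (sing {#} g) (op f) = \<Phi> (R (sing {#} g)) f"
    and step: "\<And>a T. T \<in> S \<Longrightarrow> a < n \<Longrightarrow> P a (R T) + E a (R T) = R (P a T) + R (E a T)"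
    and T: "T \<in> S"
  shows "\<Phi> T (op f) = \<Phi> (R T) f"
  using T
proof (induction rule: S_induct)
  case (sing M g)
  have "\<Phi> (sing (mset w) g) (op f) = \<Phi> (R (sing (mset w) g)) f"
    if "sorted w" "mset w \<in> sym_monos p q" "g \<in> SF" for w g
    using that
  proof (induction w arbitrary: g)
    case Nil
    then show ?case using base by simp
  next
    case (Cons a w)
    define U where "U = sing (mset w) (twist (\<pi> a) g)"
    have w: "sorted w" "mset w \<in> sym_monos p q" "odd_simple p (add_mset a (mset w))" and a: "a < n"
      using Cons.prems by (auto simp: sym_monos_def odd_simple_add)
    have U: "U \<in> S" using w Cons.prems by (simp add: U_def)
    have "bel a (mset w) = 0" using Cons.prems by (intro bel_eq_0) auto
    then have E: "sing (mset (a # w)) g = E a U" using w by (simp add: U_def E_sing)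
    have "\<Phi> (E a U) (op f) = d a (\<Phi> U (op f)) - \<Phi> (P a U) (op f)"
      using \<Phi>_PE[OF U a op] by simp
    also have "\<dots> = d a (\<Phi> (R U) f) - \<Phi> (R (P a U)) f"
      using Cons w a by (simp add: U_def P_sing)
    also have "\<dots> = \<Phi> (P a (R U) + E a (R U)) f - \<Phi> (R (P a U)) f"
      using \<Phi>_PE[of "R U" a f] R U a f by (simp add: \<Phi>_add)
    also have "\<dots> = \<Phi> (R (E a U)) f"
      using step[OF U a] R U a by (simp add: \<Phi>_add)
    finally show ?case by (simp only: E)
  qed
  from this[of "sorted_list_of_multiset M" g] show ?case using sing by simp
next
  case (add T U)
  then show "\<Phi> (T + U) (op f) = \<Phi> (R (T + U)) f" using R by (simp add: \<Phi>_add)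
qed

section \<open>Right composition with derivatives and coordinates\<close>

lemma empty_sym_mono [simp]: "{#} \<in> sym_monos p q"
  by (simp add: sym_monos_def odd_simple_def)

lemma pd_mono_empty [simp]: "pd_mono p {#} f = f"
  by (simp add: pd_mono_def)

text \<open>\<open>Tw (\<pi> i)\<close> is the sign for bringing the derivative from behind the
  operator to its front.\<close>

lemma \<Phi>_right_d:
  assumes T: "T \<in> S" and i: "i < n" and f: "f \<in> SF"
  shows "\<Phi> T (d i f) = \<Phi> (E i (Tw (\<pi> i) T)) f"
proof (rule right_composition[OF _ f _ _ _ _ T])
  show "\<Phi> (sing {#} g) (d i f) = \<Phi> (E i (Tw (\<pi> i) (sing {#} g))) f" for g
    using i by (simp add: \<Phi>_sing E_sing Tw_sing odd_simple_add sym_monosD pd_mono_def)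
  show "P a (E i (Tw (\<pi> i) T)) + E a (E i (Tw (\<pi> i) T)) =
      E i (Tw (\<pi> i) (P a T)) + E i (Tw (\<pi> i) (E a T))" if "T \<in> S" "a < n" for a T
    using that by (simp add: P_E Tw_P E_E[of a i] Tw_E[of "\<pi> i" a] E_lin mult.commute)
  show "E i (Tw (\<pi> i) (T + U)) = E i (Tw (\<pi> i) T) + E i (Tw (\<pi> i) U)" for T U
    by (simp add: E_lin Tw_lin)
qed (use i f in simp_all)

text \<open>Moving \<open>y j\<close> to the left through the monomial leaves one contraction for
  each occurrence of the derivative \<open>j\<close>; together these form the interior
  product.\<close>

lemma \<Phi>_right_y:
  assumes T: "T \<in> S" and j: "j < n" and f: "f \<in> SF"
  shows "\<Phi> T (y j \<star> f) = \<Phi> (Y j (Tw (\<pi> j) T) + ssc (sg (\<pi> j)) (I j (Tw (\<pi> j) T))) f"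
proof (rule right_composition[OF _ f _ _ _ _ T])
  show "\<Phi> (sing {#} g) (y j \<star> f) =
      \<Phi> (Y j (Tw (\<pi> j) (sing {#} g)) + ssc (sg (\<pi> j)) (I j (Tw (\<pi> j) (sing {#} g)))) f"
    if "g \<in> SF" for g
  proof -
    have "I j (sing {#} h) = 0" for h by (auto simp: I_def sing_def)
    then show ?thesis using that j
      by (simp add: \<Phi>_Y \<Phi>_sing Tw_sing smult_assoc[symmetric] coord_commute)
  qed
  show "P a (Y j (Tw (\<pi> j) T) + ssc (sg (\<pi> j)) (I j (Tw (\<pi> j) T))) +
      E a (Y j (Tw (\<pi> j) T) + ssc (sg (\<pi> j)) (I j (Tw (\<pi> j) T))) =
      Y j (Tw (\<pi> j) (P a T)) + ssc (sg (\<pi> j)) (I j (Tw (\<pi> j) (P a T))) +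
      (Y j (Tw (\<pi> j) (E a T)) + ssc (sg (\<pi> j)) (I j (Tw (\<pi> j) (E a T))))"
    if "T \<in> S" "a < n" for a T
  proof -
    define s where "s = sg (\<pi> a * \<pi> j)"
    have s: "s * s = 1" "\<And>x. s * (s * x) = x" by (simp_all add: s_def)
    define W where "W = Tw (\<pi> j) T"
    have W: "W \<in> S" using that by (simp add: W_def)
    have 1: "Tw (\<pi> j) (P a T) = ssc s (P a W)"
      using that by (simp add: W_def Tw_P s_def mult.commute)
    have 2: "Tw (\<pi> j) (E a T) = ssc s (E a W)"
      by (simp add: W_def Tw_E s_def mult.commute)
    have 3: "P a (Y j W) = (if a = j then W else 0) + ssc s (Y j (P a W))"
      using P_Y[OF W that(2) j] by (simp add: s_def)
    have 4: "P a (I j W) = ssc s (I j (P a W))"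
      using P_I[OF W] by (simp add: s_def)
    have 5: "E a (Y j W) = ssc s (Y j (E a W))"
      using E_Y[of a j W] by (simp add: s_def)
    have 6: "ssc s (I j (E a W)) = (if a = j then ssc s W else 0) + E a (I j W)"
      using I_E[OF W, of j a] by (auto simp: s_def ssc_add mult.commute)
    \<comment> \<open>For \<open>a = j\<close> the extra term of \<open>P a (Y j W)\<close> on the
      left is matched by that of \<open>I j (E a W)\<close> on the right, because the two signs in
      front of the latter cancel.\<close>
    have 7: "ssc (sg (\<pi> j)) (ssc s W) = W" if "a = j"
      using that par_cases[of p j] by (auto simp: s_def)
    show ?thesis
      unfolding W_def[symmetric] 1 2
      using W j that 7
      by (simp add: P_lin E_lin Y_lin I_lin ssc_add 3 4 5 6 del: ssc_ssc)
  qed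
  show "Y j (Tw (\<pi> j) (T + U)) + ssc (sg (\<pi> j)) (I j (Tw (\<pi> j) (T + U))) =
      Y j (Tw (\<pi> j) T) + ssc (sg (\<pi> j)) (I j (Tw (\<pi> j) T)) +
      (Y j (Tw (\<pi> j) U) + ssc (sg (\<pi> j)) (I j (Tw (\<pi> j) U)))" for T U
    by (simp add: Y_lin I_lin Tw_lin ssc_add)
  show "Y j (Tw (\<pi> j) T) + ssc (sg (\<pi> j)) (I j (Tw (\<pi> j) T)) \<in> S" if "T \<in> S" for T
    using that j by simp
qed (use j f in simp_all)

section \<open>Uniqueness of the total symbol\<close>

lemma twist_eq_0: "twist m f = 0 \<Longrightarrow> f = 0"
  by (metis twist_0(2) twist_same twist_twist)

text \<open>The supercommutator with \<open>y j\<close> has symbol \<open>I j T\<close> up to sign,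
  of lower degree. By induction all these contractions vanish, so \<open>T\<close> has degree 0 and
  is the value of the operator at the constant 1.\<close>

lemma \<Phi>_eq_0:
  assumes "T \<in> S" "\<And>f. f \<in> SF \<Longrightarrow> \<Phi> T f = 0"
  shows "T = 0"
proof -
  have main: "T = 0" if "T \<in> S" "\<And>f. f \<in> SF \<Longrightarrow> \<Phi> T f = 0" "\<And>M. T M \<noteq> 0 \<Longrightarrow> size M < k" for k T
    using that
  proof (induction k arbitrary: T)
    case 0
    then show "T = 0" by (metis ext less_zeroE zero_fun_apply)
  next
    case (Suc k)
    have "I j T = 0" if j: "j < n" for j
    proof (rule Suc.IH)
      show "\<Phi> (I j T) f = 0" if f: "f \<in> SF" for f
      proof -
        have "\<Phi> (Tw (\<pi> j) T) (y j \<star> f) = y j \<star> \<Phi> T f + scl (sg (\<pi> j)) (\<Phi> (I j T) f)"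
          using \<Phi>_right_y[of "Tw (\<pi> j) T" j f] Suc.prems(1) j f by (simp add: Tw_Tw \<Phi>_add \<Phi>_Y \<Phi>_ssc)
        moreover have z: "\<Phi> T g = 0" if "g \<in> SF" for g by (rule Suc.prems(2)[OF that])
        ultimately have "scl (sg (\<pi> j)) (\<Phi> (I j T) f) = 0"
          using Suc.prems(1) j f by (simp add: \<Phi>_Tw z)
        then have "scl (sg (\<pi> j)) (scl (sg (\<pi> j)) (\<Phi> (I j T) f)) = 0" by simp
        then show ?thesis unfolding scl_scl sg_sq scl_1 .
      qed
      show "size M < k" if "I j T M \<noteq> 0" for M
      proof -
        have "T (add_mset j M) \<noteq> 0" using that by (auto simp: I_def)
        then show ?thesis using Suc.prems(3) by fastforce
      qed
    qed (use Suc.prems in simp)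
    then have "I j T K = 0" if "j < n" for j K
      using that by simp
    then have "scl (real (Suc (count K j)) * sg (bel j K)) (twist (\<pi> j) (T (add_mset j K))) = 0" if "j < n" for j K
      using that unfolding I_def by blast
    then have "twist (\<pi> j) (T (add_mset j K)) = 0" if "j < n" for j K
      using that by (simp add: fun_eq_iff scl_def sg_def)
    then have T0: "T (add_mset j K) = 0" if "j < n" for j K
      using that twist_eq_0 by blast
    have T1: "T M = 0" if "M \<noteq> {#}" for M
    proof (rule ccontr)
      assume "T M \<noteq> 0"
      moreover obtain j K where M: "M = add_mset j K" using \<open>M \<noteq> {#}\<close> by (cases M) auto
      ultimately have "j < n" using S_support[OF Suc.prems(1), of M] by simp
      then show False using T0 M \<open>T M \<noteq> 0\<close> by blast
    qed
    have "T = sing {#} (T {#})" by (rule ext) (auto simp: sing_def T1)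
    then have "\<Phi> T (const_sfun 1) = \<Phi> (sing {#} (T {#})) (const_sfun 1)" by (rule arg_cong)
    also have "\<dots> = T {#}" using Suc.prems(1) by (simp add: \<Phi>_sing smult_const)
    finally have "T {#} = \<Phi> T (const_sfun 1)" ..
    also have "\<dots> = 0" by (rule Suc.prems(2)) simp
    finally have "T M = 0" for M using T1 by (cases "M = {#}") auto
    then show "T = 0" by auto
  qed
  obtain k where k: "\<And>M. T M \<noteq> 0 \<Longrightarrow> size M < k"
  proof
    show "size M < Suc (Max (size ` {M. T M \<noteq> 0}))" if "T M \<noteq> 0" for M
      using that S_finite[OF assms(1)] by (auto simp: less_Suc_eq_le)
  qed
  show ?thesis
  proof (rule main)
    show "size M < k" if "T M \<noteq> 0" for M by (rule k[OF that])
  qed (fact assms)+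
qed

lemma diff_op_\<Phi>: "diff_op p q T = (\<lambda>f. if f \<in> SF then \<Phi> T f else 0)"
  by (rule ext) (simp add: diff_op_def \<Phi>_def)

lemma diff_op_inj: "T \<in> S \<Longrightarrow> U \<in> S \<Longrightarrow> diff_op p q T = diff_op p q U \<Longrightarrow> T = U"
proof -
  assume *: "T \<in> S" "U \<in> S" "diff_op p q T = diff_op p q U"
  then have "\<Phi> T f = \<Phi> U f" if "f \<in> SF" for f
    using that by (metis diff_op_\<Phi>)
  then have "T - U = 0" using * by (intro \<Phi>_eq_0) (simp_all add: \<Phi>_diff)
  then show "T = U" by simp
qed

lemma S_le_degree: "T \<in> S \<Longrightarrow> \<exists>k. T \<in> symbols_le p q k"
proof -
  assume T: "T \<in> S"
  have "size M \<le> Max (size ` {M. T M \<noteq> 0})" if "T M \<noteq> 0" for M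
    by (rule Max_ge) (use S_finite[OF T] that in blast)+
  with T show ?thesis unfolding symbols_le_def by blast
qed

lemma diff_ops_eq: "diff_ops p q = diff_op p q ` S"
proof -
  have "(\<Union>k. symbols_le p q k) = S" using S_le_degree unfolding symbols_le_def by blast
  then show ?thesis unfolding diff_ops_def diff_ops_le_def by blast
qed

lemma total_symbol_diff_op: "T \<in> S \<Longrightarrow> total_symbol p q (diff_op p q T) = T"
  unfolding total_symbol_def by (rule the_equality) (auto intro: diff_op_inj)

lemma Q_aff_eq: "T \<in> S \<Longrightarrow> Q_aff p q T = diff_op p q T"
  unfolding Q_aff_def
  by (rule inv_into_f_eq) (auto simp: diff_ops_eq inj_on_def total_symbol_diff_op)

end

section \<open>Lie derivatives\<close>

lemmas fun_apply = plus_fun_apply zero_fun_apply minus_apply uminus_apply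

text \<open>
  Calculations and inductions return function-valued terms eta-expanded, and these rules would then
  rewrite the sums inside them into abstractions.
\<close>

declare fun_apply [simp del]

context superspace
begin

section \<open>Parity components and linearity in the vector field\<close>

definition vfields :: "vfield set" where
  "vfields = {X. \<forall>i<n. X i \<in> SF}"

lemma vfieldsD: "X \<in> vfields \<Longrightarrow> i < n \<Longrightarrow> X i \<in> SF"
  by (simp add: vfields_def)

lemma hfield_vfields: "hfield c X \<Longrightarrow> X \<in> vfields"
  by (simp add: hfield_def vfields_def)

lemma vpart_vfields: "X \<in> vfields \<Longrightarrow> vpart p a X \<in> vfields"
  by (simp add: vfields_def vpart_def)

lemma vapply_SF: "X \<in> vfields \<Longrightarrow> f \<in> SF \<Longrightarrow> vapply p q X f \<in> SF"
  unfolding vapply_def by (intro SF_sum SF_smult) (auto dest: vfieldsD)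

lemma vdiv_SF: "X \<in> vfields \<Longrightarrow> vdiv p q X \<in> SF"
  unfolding vdiv_def by (intro SF_sum SF_scl SF_d SF_part) (auto dest: vfieldsD)

lemma lie_density_SF: "X \<in> vfields \<Longrightarrow> f \<in> SF \<Longrightarrow> lie_density p q l X f \<in> SF"
  unfolding lie_density_def by (simp add: vapply_SF vdiv_SF)

lemma lie_density_add: "f \<in> SF \<Longrightarrow> g \<in> SF \<Longrightarrow>
    lie_density p q l X (f + g) = lie_density p q l X f + lie_density p q l X g"
  unfolding lie_density_def vapply_def
  by (simp add: d_add smult_add_right scl_add sum.distrib)

lemma vdiv_add:
  assumes "X \<in> vfields" "X' \<in> vfields"
  shows "vdiv p q (X + X') = vdiv p q X + vdiv p q X'"
proof -
  have "d i (part b ((X + X') i)) = d i (part b (X i)) + d i (part b (X' i))" if "i < n" for i b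
    using that assms by (simp add: part_add d_add vfieldsD plus_fun_apply)
  then show ?thesis
    unfolding vdiv_def sum.distrib[symmetric] by (intro sum.cong refl) (simp add: scl_add)
qed

lemma vdiv_scl:
  assumes "X \<in> vfields"
  shows "vdiv p q (\<lambda>i. scl c (X i)) = scl c (vdiv p q X)"
proof -
  have "d i (part b (scl c (X i))) = scl c (d i (part b (X i)))" if "i < n" for i b
    using that assms by (simp add: d_scl vfieldsD)
  then show ?thesis
    unfolding vdiv_def scl_sum by (intro sum.cong refl) (simp add: mult.commute)
qed

lemma lie_density_field_add:
  assumes "X \<in> vfields" "X' \<in> vfields"
  shows "lie_density p q l (X + X') f = lie_density p q l X f + lie_density p q l X' f"
proof -
  have "vapply p q (X + X') f = vapply p q X f + vapply p q X' f"
    by (simp add: vapply_def smult_add_left sum.distrib plus_fun_apply)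
  then show ?thesis unfolding lie_density_def vdiv_add[OF assms] smult_add_left scl_add
    by (simp only: add_ac)
qed

lemma lie_density_field_scl:
  assumes "X \<in> vfields"
  shows "lie_density p q l (\<lambda>i. scl c (X i)) f = scl c (lie_density p q l X f)"
  by (simp add: lie_density_def vapply_def vdiv_scl[OF assms] scl_add scl_sum mult.commute)

lemma lie_density_field_0: "(\<And>i. i < n \<Longrightarrow> X i = 0) \<Longrightarrow> lie_density p q l X f = 0"
  by (simp add: lie_density_def vapply_def vdiv_def)

lemma lie_density_cong: "(\<And>i. i < n \<Longrightarrow> X i = X' i) \<Longrightarrow> lie_density p q l X f = lie_density p q l X' f"
  by (simp add: lie_density_def cong: vapply_cong vdiv_cong)

lemma vpart_add: "vpart p a (X + X') = vpart p a X + vpart p a X'"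
  by (rule ext) (simp add: vpart_def part_add plus_fun_apply)

lemma vpart_scl: "vpart p a (\<lambda>i. scl c (X i)) = (\<lambda>i. scl c (vpart p a X i))"
  by (rule ext) (simp add: vpart_def)

text \<open>Conjugation by \<open>twist m\<close> multiplies the component of parity
  \<open>b\<close> of an operator by \<open>(-1)^(m * b)\<close>, so the operator itself need not be
  homogeneous.\<close>

lemma sum_op_part:
  assumes T: "T \<in> S" and f: "f \<in> SF"
  shows "(\<Sum>b\<in>{0, 1}. scl (sg (m * b)) (op_part b (diff_op p q T) f)) = twist m (\<Phi> T (twist m f))"
proof -
  have *: "(\<Sum>b\<in>{0, 1}. scl (sg (m * b)) (part (b + c) g)) = twist m (scl (sg (m * c)) g)" for c g
    by (auto simp: fun_eq_iff scl_def part_def twist_def sg_if fun_apply)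
  have "(\<Sum>b\<in>{0, 1}. scl (sg (m * b)) (op_part b (diff_op p q T) f)) =
      (\<Sum>c\<in>{0, 1}. \<Sum>b\<in>{0, 1}. scl (sg (m * b)) (part (b + c) (\<Phi> T (part c f))))"
    unfolding op_part_def scl_sum by (subst sum.swap) (simp only: diff_op_\<Phi> SF_part[OF f] if_True)
  also have "\<dots> = (\<Sum>c\<in>{0, 1}. twist m (\<Phi> T (scl (sg (m * c)) (part c f))))"
    unfolding * using T f by (simp only: \<Phi>_lin(2)[OF T _ SF_0] SF_part)
  also have "\<dots> = twist m (\<Phi> T (\<Sum>c\<in>{0, 1}. scl (sg (m * c)) (part c f)))"
    unfolding twist_sum[symmetric] by (subst \<Phi>_sum_arg) (use T f in simp_all)
  also have "\<dots> = twist m (\<Phi> T (twist m f))" unfolding sum_part_twist ..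
  finally show ?thesis .
qed

lemma op_part_SF: "T \<in> S \<Longrightarrow> f \<in> SF \<Longrightarrow> op_part b (diff_op p q T) f \<in> SF"
  unfolding op_part_def diff_op_\<Phi> by (intro SF_sum) simp

lemma lie_op_eq:
  assumes T: "T \<in> S" and X: "X \<in> vfields" and f: "f \<in> SF"
  shows "lie_op p q lam mu X (diff_op p q T) f = (\<Sum>a\<in>{0, 1}.
    lie_density p q mu (vpart p a X) (\<Phi> T f) - twist a (\<Phi> T (twist a (lie_density p q lam (vpart p a X) f))))"
proof -
  have "(\<Sum>b\<in>{0, 1}. lie_density p q mu Z (op_part b (diff_op p q T) f)) = lie_density p q mu Z (\<Phi> T f)" for Z
  proof -
    have "(\<Sum>b\<in>{0, 1}. lie_density p q mu Z (op_part b (diff_op p q T) f)) =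
        lie_density p q mu Z (\<Sum>b\<in>{0, 1}. scl (sg (0 * b)) (op_part b (diff_op p q T) f))"
      using op_part_SF[OF T f] by (simp add: lie_density_add)
    then show ?thesis unfolding sum_op_part[OF T f] by simp
  qed
  moreover have "(\<Sum>b\<in>{0, 1}. scl (sg (a * b)) (op_part b (diff_op p q T) (lie_density p q lam (vpart p a X) f))) =
      twist a (\<Phi> T (twist a (lie_density p q lam (vpart p a X) f)))" for a
    by (rule sum_op_part[OF T lie_density_SF[OF vpart_vfields[OF X] f]])
  ultimately show ?thesis using f unfolding lie_op_def by (simp only: if_True sum_subtractf)
qed

lemma lie_op_outside: "f \<notin> SF \<Longrightarrow> lie_op p q lam mu X D f = 0"
  by (simp add: lie_op_def)

text \<open>Only the component of parity \<open>c\<close> of the field can contribute. The sign of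
  the commutator is conjugation by \<open>twist c\<close>, which is \<open>Tw c\<close> on the
  symbol.\<close>

lemma lie_op_homog:
  assumes T: "T \<in> S" and X: "hfield c X" and f: "f \<in> SF"
  shows "lie_op p q lam mu X (diff_op p q T) f =
    lie_density p q mu X (\<Phi> T f) - \<Phi> (Tw c T) (lie_density p q lam X f)"
proof -
  note Xv = hfield_vfields[OF X]
  have "lie_density p q l (vpart p a X) g = (if even (a + c) then lie_density p q l X g else 0)" for a l g
    using vpart_homog[OF X, of _ a]
    by (cases "even (a + c)") (auto intro: lie_density_cong lie_density_field_0)
  moreover have "\<Phi> T 0 = 0" using \<Phi>_lin(2)[OF T SF_0 SF_0, of 0] by simp
  ultimately have "lie_op p q lam mu X (diff_op p q T) f = (\<Sum>a\<in>{0, 1}. if even (a + c) then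
      lie_density p q mu X (\<Phi> T f) - twist a (\<Phi> T (twist a (lie_density p q lam X f))) else 0)"
    unfolding lie_op_eq[OF T Xv f] by (intro sum.cong refl) simp
  also have "\<dots> = (\<Sum>a\<in>{0, 1}. if even (a + c) then
      lie_density p q mu X (\<Phi> T f) - twist c (\<Phi> T (twist c (lie_density p q lam X f))) else 0)"
  proof (intro sum.cong refl)
    show "(if even (a + c) then lie_density p q mu X (\<Phi> T f) -
        twist a (\<Phi> T (twist a (lie_density p q lam X f))) else 0) =
      (if even (a + c) then lie_density p q mu X (\<Phi> T f) -
        twist c (\<Phi> T (twist c (lie_density p q lam X f))) else 0)" for a
    proof (cases "even (a + c)")
      case True
      show ?thesis unfolding twist_cong[OF True] ..
    qed simp
  qed
  also have "\<dots> = lie_density p q mu X (\<Phi> T f) - twist c (\<Phi> T (twist c (lie_density p q lam X f)))"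
    by (cases "even c") simp_all
  finally show ?thesis using \<Phi>_Tw[OF T lie_density_SF[OF Xv f]] by simp
qed

lemma lie_op_field_add:
  assumes T: "T \<in> S" and X: "X \<in> vfields" "X' \<in> vfields"
  shows "lie_op p q lam mu (X + X') (diff_op p q T) =
    lie_op p q lam mu X (diff_op p q T) + lie_op p q lam mu X' (diff_op p q T)"
proof
  fix f
  show "lie_op p q lam mu (X + X') (diff_op p q T) f =
    (lie_op p q lam mu X (diff_op p q T) + lie_op p q lam mu X' (diff_op p q T)) f"
  proof (cases "f \<in> SF")
    case True
    have XX: "X + X' \<in> vfields" using X by (simp add: vfields_def plus_fun_apply)
    note V = vpart_vfields[OF X(1)] vpart_vfields[OF X(2)]
    have "lie_density p q mu (vpart p a (X + X')) (\<Phi> T f) -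
        twist a (\<Phi> T (twist a (lie_density p q lam (vpart p a (X + X')) f))) =
       (lie_density p q mu (vpart p a X) (\<Phi> T f) - twist a (\<Phi> T (twist a (lie_density p q lam (vpart p a X) f)))) +
       (lie_density p q mu (vpart p a X') (\<Phi> T f) - twist a (\<Phi> T (twist a (lie_density p q lam (vpart p a X') f))))" for a
      unfolding vpart_add lie_density_field_add[OF V] twist_add
      by (simp only: \<Phi>_lin(1)[OF T] SF_twist lie_density_SF V True twist_add) (simp only: add_diff_add)
    then have "lie_op p q lam mu (X + X') (diff_op p q T) f =
        lie_op p q lam mu X (diff_op p q T) f + lie_op p q lam mu X' (diff_op p q T) f"
      unfolding lie_op_eq[OF T XX True] lie_op_eq[OF T X(1) True] lie_op_eq[OF T X(2) True]
      by (simp only: sum.distrib)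
    then show ?thesis by (simp only: plus_fun_apply[of "lie_op p q lam mu X (diff_op p q T)"])
  qed (simp add: lie_op_outside plus_fun_apply)
qed

lemma scl_diff: "scl c (f - g) = scl c f - scl c g"
  by (auto simp: fun_eq_iff scl_def algebra_simps fun_apply)

lemma lie_op_field_scl:
  assumes T: "T \<in> S" and X: "X \<in> vfields"
  shows "lie_op p q lam mu (\<lambda>i. scl c (X i)) (diff_op p q T) f =
    scl c (lie_op p q lam mu X (diff_op p q T) f)"
proof (cases "f \<in> SF")
  case True
  have XX: "(\<lambda>i. scl c (X i)) \<in> vfields" using X by (simp add: vfields_def)
  note V = vpart_vfields[OF X]
  have "lie_density p q mu (vpart p a (\<lambda>i. scl c (X i))) (\<Phi> T f) -
        twist a (\<Phi> T (twist a (lie_density p q lam (vpart p a (\<lambda>i. scl c (X i))) f))) =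
      scl c (lie_density p q mu (vpart p a X) (\<Phi> T f) - twist a (\<Phi> T (twist a (lie_density p q lam (vpart p a X) f))))" for a
    unfolding vpart_scl lie_density_field_scl[OF V] twist_scl scl_diff
    by (simp only: \<Phi>_lin(2)[OF T _ SF_0] SF_twist lie_density_SF V True twist_scl)
  then show ?thesis
    unfolding lie_op_eq[OF T XX True] lie_op_eq[OF T X True] scl_sum by simp
qed (simp add: lie_op_outside)

lemma tensor_add: "tensor (f + g) v = tensor f v + tensor g v"
  by (rule ext) (simp add: tensor_def scl_add plus_fun_apply)

lemma tensor_scl: "tensor (scl c f) v = ssc c (tensor f v)"
  by (rule ext) (simp add: tensor_def ssc_def mult.commute)

lemma lie_symbol_field_add:
  assumes X: "X \<in> vfields" "X' \<in> vfields"
  shows "lie_symbol p q \<delta> (X + X') T = lie_symbol p q \<delta> X T + lie_symbol p q \<delta> X' T"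
proof -
  have v: "vapply p q (X + X') f = vapply p q X f + vapply p q X' f" for f
    by (simp add: vapply_def smult_add_left sum.distrib plus_fun_apply)
  have j: "jac p a (vpart p a (X + X')) i j = jac p a (vpart p a X) i j + jac p a (vpart p a X') i j"
    if "j < n" for a i j
    using that vpart_vfields[OF X(1)] vpart_vfields[OF X(2)]
    by (simp add: jac_def vpart_add d_add vfieldsD scl_add plus_fun_apply)
  have "(\<Sum>i<n. \<Sum>j<n. tensor (scl (sg (a * b)) (part b (T M) \<star> jac p a (vpart p a (X + X')) i j)) (R i j)) =
      (\<Sum>i<n. \<Sum>j<n. tensor (scl (sg (a * b)) (part b (T M) \<star> jac p a (vpart p a X) i j)) (R i j)) +
      (\<Sum>i<n. \<Sum>j<n. tensor (scl (sg (a * b)) (part b (T M) \<star> jac p a (vpart p a X') i j)) (R i j))"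
    for a b M and R :: "nat \<Rightarrow> nat \<Rightarrow> ssym"
    unfolding sum.distrib[symmetric]
    by (intro sum.cong refl) (simp only: j lessThan_iff smult_add_right scl_add tensor_add)
  then show ?thesis unfolding lie_symbol_def v tensor_add
    by (simp only: sum.distrib add_ac)
qed

lemma lie_symbol_field_scl:
  assumes X: "X \<in> vfields"
  shows "lie_symbol p q \<delta> (\<lambda>i. scl c (X i)) T = ssc c (lie_symbol p q \<delta> X T)"
proof -
  have v: "vapply p q (\<lambda>i. scl c (X i)) f = scl c (vapply p q X f)" for f
    by (simp add: vapply_def scl_sum)
  have j: "jac p a (vpart p a (\<lambda>i. scl c (X i))) i j = scl c (jac p a (vpart p a X) i j)" if "j < n" for a i j
    using that vpart_vfields[OF X] by (simp add: jac_def vpart_scl d_scl vfieldsD mult.commute)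
  have "(\<Sum>i<n. \<Sum>j<n. tensor (scl (sg (a * b)) (part b (T M) \<star> jac p a (vpart p a (\<lambda>i. scl c (X i))) i j)) (R i j)) =
      ssc c (\<Sum>i<n. \<Sum>j<n. tensor (scl (sg (a * b)) (part b (T M) \<star> jac p a (vpart p a X) i j)) (R i j))"
    for a b M and R :: "nat \<Rightarrow> nat \<Rightarrow> ssym"
    unfolding ssc_sum
    by (intro sum.cong refl) (simp only: j lessThan_iff smult_scl_right scl_scl tensor_scl ssc_ssc mult.commute)
  then show ?thesis unfolding lie_symbol_def v tensor_scl
    by (simp only: ssc_sum ssc_add)
qed

section \<open>The generating vector fields and their actions\<close>

definition YP :: "symb \<Rightarrow> symb" where "YP T = (\<Sum>m<n. Y m (P m T))"
text \<open>Multiplication by the symbol of the Euler field, whereas \<open>YP\<close> is the Euler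
  field acting on coefficients.\<close>

definition YE :: "symb \<Rightarrow> symb" where "YE T = (\<Sum>m<n. Y m (E m T))"

lemma S_YP [simp]: "T \<in> S \<Longrightarrow> YP T \<in> S" and S_YE [simp]: "T \<in> S \<Longrightarrow> YE T \<in> S"
  by (auto simp: YP_def YE_def intro!: S_sum)

text \<open>Contracting and multiplying by the same index undo each other's signs, so the
  multiplicities of a monomial are added up to its degree.\<close>

lemma sum_E_I:
  assumes T: "T \<in> S"
  shows "(\<Sum>m<n. E m (I m T)) = Dg real T"
proof
  fix M
  have EI: "E m (I m T) M = scl (real (count M m)) (T M)" for m
  proof (cases "odd_simple p M \<and> m \<in># M")
    case True
    then obtain M' where M: "M = add_mset m M'" by (metis insert_DiffM)
    with True show ?thesis
      by (simp add: E_def I_def bel_add mult.commute mult.left_commute)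
  next
    case False
    then have "E m (I m T) M = 0" by (auto simp: E_def)
    moreover have "count M m = 0 \<or> T M = 0"
      using False S_odd_simple[OF T, of M] by (auto simp: count_eq_zero_iff)
    ultimately show ?thesis by auto
  qed
  have "(\<Sum>m<n. E m (I m T)) M = scl (\<Sum>m<n. real (count M m)) (T M)"
    unfolding sum_fun_apply[of "\<lambda>m. E m (I m T)"] EI by (rule scl_sum_left[symmetric])
  also have "\<dots> = scl (real (size M)) (T M)"
  proof (cases "T M = 0")
    case False
    then have "set_mset M \<subseteq> {..<n}" using S_support[OF T] by blast
    then have "(\<Sum>m<n. count M m) = size M"
      unfolding size_multiset_overloaded_eq
      by (intro sum.mono_neutral_right) (auto simp: count_eq_zero_iff)
    then show ?thesis by (metis of_nat_sum)
  qed simp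
  finally show "(\<Sum>m<n. E m (I m T)) M = Dg real T M" by (simp add: Dg_def)
qed

definition DX :: "nat \<Rightarrow> vfield" where
  "DX i = (\<lambda>m. if m = i then const_sfun 1 else 0)"

definition LX :: "nat \<Rightarrow> nat \<Rightarrow> vfield" where
  "LX i j = (\<lambda>m. if m = i then y j else 0)"

definition QX :: "nat \<Rightarrow> vfield" where
  "QX j = (\<lambda>m. y j \<star> y m)"

lemma homog_0 [simp]: "homog c 0"
  by (simp add: homog_def zero_fun_apply)

lemma homog_cong: "homog a f \<Longrightarrow> even (a + b) \<Longrightarrow> homog b f"
  by (auto simp: homog_def)

lemma hfield_DX: "hfield (\<pi> i) (DX i)"
  by (auto simp: hfield_def DX_def intro: homog_cong[OF homog_const])

lemma hfield_LX: "j < n \<Longrightarrow> hfield (\<pi> i + \<pi> j) (LX i j)"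
  by (auto simp: hfield_def LX_def intro: homog_cong[OF homog_coord])

lemma hfield_QX: "j < n \<Longrightarrow> hfield (\<pi> j) (QX j)"
  by (auto simp: hfield_def QX_def intro: homog_smult homog_coord)

lemma if_app: "(if b then f else 0) \<star> g = (if b then f \<star> g else 0)" for f g :: sfun
  by simp

lemma lie_density_DX:
  assumes "i < n" "f \<in> SF"
  shows "lie_density p q l (DX i) f = d i f"
proof -
  have "d m (DX i k) = 0" for m k by (simp add: DX_def)
  then have "vdiv p q (DX i) = 0" unfolding vdiv_homog[OF hfield_DX] by simp
  moreover have "vapply p q (DX i) f = d i f"
    using assms by (simp add: vapply_def DX_def if_app const_smult)
  ultimately show ?thesis by (simp add: lie_density_def)
qed

lemma lie_density_LX:
  assumes "i < n" "j < n" "f \<in> SF"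
  shows "lie_density p q l (LX i j) f = y j \<star> d i f + scl (l * (if i = j then sg (\<pi> i) else 0)) f"
proof -
  have "vapply p q (LX i j) f = y j \<star> d i f"
    using assms by (simp add: vapply_def LX_def if_app)
  moreover have "vdiv p q (LX i j) = const_sfun (if i = j then sg (\<pi> i) else 0)"
  proof -
    have "vdiv p q (LX i j) = (\<Sum>m<n. if m = i then scl (sg (\<pi> i * (\<pi> i + \<pi> j + 1))) (d i (y j)) else 0)"
      unfolding vdiv_homog[OF hfield_LX[OF assms(2)]] unfolding LX_def by (intro sum.cong) auto
    also have "\<dots> = scl (sg (\<pi> i * (\<pi> i + \<pi> j + 1))) (d i (y j))" using assms by simp
    also have "\<dots> = const_sfun (if i = j then sg (\<pi> i) else 0)"
      using par_cases[of p i] by (auto simp: d_coord fun_eq_iff scl_def const_sfun_def sg_if fun_apply)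
    finally show ?thesis .
  qed
  ultimately show ?thesis using assms by (simp add: lie_density_def const_smult)
qed

lemma d_coord_coord:
  "i < n \<Longrightarrow> j < n \<Longrightarrow> m < n \<Longrightarrow>
    d i (y j \<star> y m) = (if i = j then y m else 0) + (if i = m then scl (sg (\<pi> i * \<pi> j)) (y j) else 0)"
  by (simp add: d_smult d_coord const_smult twist_homog[OF homog_coord] smult_const)

lemma sum_sg: "(\<Sum>m<n. sg (\<pi> m)) = real p - real q"
proof -
  have "(\<Sum>m<n. sg (\<pi> m)) = (\<Sum>m\<in>{..<p} \<union> {p..<n}. sg (\<pi> m))"
    by (rule sum.cong) auto
  also have "\<dots> = (\<Sum>m\<in>{..<p}. sg (\<pi> m)) + (\<Sum>m\<in>{p..<n}. sg (\<pi> m))"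
    by (rule sum.union_disjoint) auto
  finally have "(\<Sum>m<n. sg (\<pi> m)) = (\<Sum>m\<in>{..<p}. sg (\<pi> m)) + (\<Sum>m\<in>{p..<n}. sg (\<pi> m))" .
  moreover have "(\<Sum>m\<in>{..<p}. sg (\<pi> m)) = (\<Sum>m\<in>{..<p}. 1)" by (rule sum.cong) (auto simp: par_def)
  moreover have "(\<Sum>m\<in>{p..<n}. sg (\<pi> m)) = (\<Sum>m\<in>{p..<n}. -1)" by (rule sum.cong) (auto simp: par_def)
  ultimately show ?thesis by simp
qed

text \<open>The divergence is \<open>1 + (p - q)\<close> times \<open>y j\<close>: the 1 comes from
  differentiating \<open>y j\<close>, and \<open>p - q\<close> is the divergence of the Euler field.
  For \<open>q = p + 1\<close> it is 0, and the weight \<open>l\<close> disappears.\<close>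

lemma lie_density_QX:
  assumes j: "j < n" and f: "f \<in> SF" and q: "q = p + 1"
  shows "lie_density p q l (QX j) f = y j \<star> (\<Sum>m<n. y m \<star> d m f)"
proof -
  have "vapply p q (QX j) f = y j \<star> (\<Sum>m<n. y m \<star> d m f)"
    by (simp add: vapply_def QX_def smult_assoc smult_sum_right)
  moreover have "vdiv p q (QX j) = 0"
  proof -
    have "vdiv p q (QX j) = (\<Sum>m<n. (if m = j then scl (sg (\<pi> m * (\<pi> j + 1)) * 1) (y m) else 0) +
        scl (sg (\<pi> m * (\<pi> j + 1)) * sg (\<pi> m * \<pi> j)) (y j))"
      unfolding vdiv_homog[OF hfield_QX[OF j]] unfolding QX_def
      by (intro sum.cong refl) (use j in \<open>simp add: d_coord_coord scl_add\<close>)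
    also have "\<dots> = (\<Sum>m<n. (if m = j then y j else 0) + scl (sg (\<pi> m)) (y j))"
      using par_cases[of p j] by (intro sum.cong refl arg_cong2[where f = plus] arg_cong2[where f = scl])
        (auto simp: sg_add distrib_left)
    also have "\<dots> = y j + scl (\<Sum>m<n. sg (\<pi> m)) (y j)"
      using j by (simp add: sum.distrib scl_sum_left)
    also have "(\<Sum>m<n. sg (\<pi> m)) = -1" using q unfolding sum_sg by simp
    also have "y j + scl (-1) (y j) = 0" by (auto simp: fun_eq_iff scl_def fun_apply)
    finally show ?thesis .
  qed
  ultimately show ?thesis by (simp add: lie_density_def)
qed

lemma lie_symbol_DX:
  assumes T: "T \<in> S" and i: "i < n"
  shows "lie_symbol p q \<delta> (DX i) T = P i T"
proof
  fix K
  have "d m (DX i k) = 0" for m k by (simp add: DX_def)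
  then show "lie_symbol p q \<delta> (DX i) T K = P i T K"
    using T i by (simp add: lie_symbol_homog[OF hfield_DX T] lie_density_DX P_def)
qed

text \<open>The action of the field \<open>LX i j\<close> on symbols and, as it turns out, on total
  symbols of operators. The last term is \<open>\<delta>\<close> times the divergence of the
  field.\<close>

definition LB :: "real \<Rightarrow> nat \<Rightarrow> nat \<Rightarrow> symb \<Rightarrow> symb" where
  "LB \<delta> i j T = Y j (P i T) - ssc (sg (\<pi> j) * sg (\<pi> i * \<pi> j)) (E i (I j T))
     + ssc (\<delta> * (if i = j then sg (\<pi> i) else 0)) T"

text \<open>The action of \<open>QX j\<close> on symbols. The last two terms come from the Jacobian
  of \<open>y^j y^k\<close>: differentiating \<open>y^k\<close> yields the degree, differentiating
  \<open>y^j\<close> yields the Euler symbol times a contraction.\<close>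

definition LQ :: "nat \<Rightarrow> symb \<Rightarrow> symb" where
  "LQ j T = Y j (YP T) - Y j (Dg real T) - ssc (sg (\<pi> j)) (YE (I j T))"

lemma sg_par_sq: "sg (\<pi> j * \<pi> j) = sg (\<pi> j)"
  using par_cases[of p j] by auto

lemma lie_symbol_LX:
  assumes T: "T \<in> S" and i: "i < n" and j: "j < n"
  shows "lie_symbol p q \<delta> (LX i j) T = LB \<delta> i j T"
proof
  fix K
  define c where "c = \<pi> i + \<pi> j"
  have "(\<Sum>m<n. \<Sum>k<n. scl (sg (\<pi> m * c)) (d m (LX i j k) \<star> E k (I m T) K)) =
      (\<Sum>m<n. \<Sum>k<n. if k = i then (if m = j then scl (sg (\<pi> j * c)) (E i (I j T) K) else 0) else 0)"
    using T i j by (intro sum.cong refl) (auto simp: LX_def d_coord const_smult)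
  also have "\<dots> = scl (sg (\<pi> j * c)) (E i (I j T) K)" using i j by simp
  finally show "lie_symbol p q \<delta> (LX i j) T K = LB \<delta> i j T K"
    unfolding lie_symbol_homog[OF hfield_LX[OF j] T] c_def[symmetric] using T i j
    by (simp add: lie_density_LX LB_def Y_def P_def ssc_def c_def distrib_left sg_add sg_par_sq
        mult.commute fun_apply)
qed

lemma lie_symbol_QX:
  assumes T: "T \<in> S" and j: "j < n" and q: "q = p + 1"
  shows "lie_symbol p q \<delta> (QX j) T = LQ j T"
proof
  fix K
  have "(\<Sum>m<n. \<Sum>k<n. scl (sg (\<pi> m * \<pi> j)) (d m (QX j k) \<star> E k (I m T) K)) =
      (\<Sum>m<n. \<Sum>k<n. (if m = j then scl (sg (\<pi> j)) (y k \<star> E k (I j T) K) else 0) +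
        (if m = k then y j \<star> E k (I k T) K else 0))"
    using j by (intro sum.cong refl) (auto simp: QX_def d_coord_coord smult_add_left scl_add sg_par_sq)
  also have "\<dots> = (\<Sum>k<n. \<Sum>m<n. if m = j then scl (sg (\<pi> j)) (y k \<star> E k (I j T) K) else 0) +
      (\<Sum>m<n. \<Sum>k<n. if m = k then y j \<star> E k (I k T) K else 0)"
    unfolding sum.distrib by (subst sum.swap) (rule refl)
  also have "\<dots> = scl (sg (\<pi> j)) (\<Sum>k<n. y k \<star> E k (I j T) K) + y j \<star> (\<Sum>m<n. E m (I m T)) K"
    using j by (simp add: scl_sum smult_sum_right sum_fun_apply[of "\<lambda>m. E m (I m T)"])
  also have "(\<Sum>m<n. E m (I m T)) = Dg real T" by (rule sum_E_I[OF T])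
  finally have e: "(\<Sum>m<n. \<Sum>k<n. scl (sg (\<pi> m * \<pi> j)) (d m (QX j k) \<star> E k (I m T) K)) =
      scl (sg (\<pi> j)) (\<Sum>k<n. y k \<star> E k (I j T) K) + y j \<star> Dg real T K" .
  have YP: "YP T K = (\<Sum>m<n. y m \<star> d m (T K))"
    unfolding YP_def Y_def P_def by (rule sum_fun_apply)
  have YE: "YE (I j T) K = (\<Sum>m<n. y m \<star> E m (I j T) K)"
    unfolding YE_def Y_def by (rule sum_fun_apply)
  show "lie_symbol p q \<delta> (QX j) T K = LQ j T K"
    unfolding lie_symbol_homog[OF hfield_QX[OF j] T] lie_density_QX[OF j S_SF[OF T] q] e YP[symmetric] YE[symmetric]
    by (simp add: LQ_def Y_def ssc_def fun_apply algebra_simps)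
qed

lemma lie_op_DX:
  assumes T: "T \<in> S" and i: "i < n"
  shows "lie_op p q lam mu (DX i) (diff_op p q T) = diff_op p q (P i T)"
proof
  fix f
  show "lie_op p q lam mu (DX i) (diff_op p q T) f = diff_op p q (P i T) f"
  proof (cases "f \<in> SF")
    case True
    then have "lie_op p q lam mu (DX i) (diff_op p q T) f = \<Phi> (P i T) f" using T i
      by (simp add: lie_op_homog[OF T hfield_DX] lie_density_DX \<Phi>_PE \<Phi>_right_d Tw_Tw)
    with True show ?thesis by (simp add: diff_op_\<Phi>[of "P i T"])
  qed (simp add: lie_op_outside diff_op_\<Phi>)
qed

lemma \<Phi>_right_yd:
  assumes T: "T \<in> S" and i: "i < n" and j: "j < n" and f: "f \<in> SF"
  shows "\<Phi> (Tw (\<pi> i + \<pi> j) T) (y j \<star> d i f) =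
    \<Phi> (Y j (E i T) + ssc (sg (\<pi> j) * sg (\<pi> i * \<pi> j)) (E i (I j T))) f"
proof -
  have tw: "twist (\<pi> j + (\<pi> i + \<pi> j)) g = twist (\<pi> i) g" for g
    by (rule twist_cong) auto
  \<comment> \<open>Right composition with \<open>y j\<close> uses up the twist by
    \<open>\<pi> j\<close>; the twist by \<open>\<pi> i\<close> is left for the derivative.\<close>
  have V: "Tw (\<pi> j) (Tw (\<pi> i + \<pi> j) T) = Tw (\<pi> i) T"
  proof
    fix M
    have "sg (\<pi> j * mpar M) * sg ((\<pi> i + \<pi> j) * mpar M) = sg (\<pi> i * mpar M)"
      by (simp add: distrib_right sg_add mult.left_commute)
    then show "Tw (\<pi> j) (Tw (\<pi> i + \<pi> j) T) M = Tw (\<pi> i) T M"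
      by (simp add: Tw_def tw)
  qed
  have "\<Phi> (Tw (\<pi> i + \<pi> j) T) (y j \<star> d i f) =
      \<Phi> (Y j (Tw (\<pi> i) T) + ssc (sg (\<pi> j)) (I j (Tw (\<pi> i) T))) (d i f)"
    using \<Phi>_right_y[of "Tw (\<pi> i + \<pi> j) T" j "d i f"] T i j f by (simp add: V)
  also have "\<dots> = \<Phi> (E i (Tw (\<pi> i) (Y j (Tw (\<pi> i) T) + ssc (sg (\<pi> j)) (I j (Tw (\<pi> i) T))))) f"
    using T i j f by (intro \<Phi>_right_d) simp_all
  also have "E i (Tw (\<pi> i) (Y j (Tw (\<pi> i) T) + ssc (sg (\<pi> j)) (I j (Tw (\<pi> i) T)))) =
      Y j (E i T) + ssc (sg (\<pi> j) * sg (\<pi> i * \<pi> j)) (E i (I j T))"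
    by (simp add: Tw_lin E_lin Tw_Y Tw_I Tw_Tw E_Y[of i j])
  finally show ?thesis .
qed

lemma lie_op_LX:
  assumes T: "T \<in> S" and i: "i < n" and j: "j < n"
  shows "lie_op p q lam mu (LX i j) (diff_op p q T) = diff_op p q (LB (mu - lam) i j T)"
proof
  fix f
  define \<kappa> where "\<kappa> = (if i = j then sg (\<pi> i) else 0)"
  show "lie_op p q lam mu (LX i j) (diff_op p q T) f = diff_op p q (LB (mu - lam) i j T) f"
  proof (cases "f \<in> SF")
    case True
    \<comment> \<open>\<open>\<kappa>\<close> is nonzero only for \<open>i = j\<close>, where the
      twist by \<open>\<pi> i + \<pi> j\<close> is the identity.\<close>
    have k: "scl (lam * \<kappa>) (\<Phi> (Tw (\<pi> i + \<pi> j) T) f) = scl (lam * \<kappa>) (\<Phi> T f)"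
      by (simp add: \<kappa>_def)
    have "lie_op p q lam mu (LX i j) (diff_op p q T) f =
        y j \<star> d i (\<Phi> T f) + scl (mu * \<kappa>) (\<Phi> T f) - \<Phi> (Tw (\<pi> i + \<pi> j) T) (y j \<star> d i f + scl (lam * \<kappa>) f)"
      using True T i j by (simp add: lie_op_homog[OF T hfield_LX] lie_density_LX \<kappa>_def[symmetric])
    also have "\<Phi> (Tw (\<pi> i + \<pi> j) T) (y j \<star> d i f + scl (lam * \<kappa>) f) =
        \<Phi> (Y j (E i T) + ssc (sg (\<pi> j) * sg (\<pi> i * \<pi> j)) (E i (I j T))) f + scl (lam * \<kappa>) (\<Phi> T f)"
      using True T i j by (simp add: \<Phi>_lin(1) \<Phi>_lin(2)[OF _ _ SF_0] \<Phi>_right_yd k)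
    also have "y j \<star> d i (\<Phi> T f) = \<Phi> (Y j (P i T)) f + \<Phi> (Y j (E i T)) f"
      using True T i j by (simp add: \<Phi>_PE \<Phi>_Y smult_add_right)
    \<comment> \<open>The terms \<open>Y j (E i T)\<close> of the left and the right composition
      cancel; they are the ones that raise the degree.\<close>
    finally have "lie_op p q lam mu (LX i j) (diff_op p q T) f =
        \<Phi> (Y j (P i T)) f - scl (sg (\<pi> j) * sg (\<pi> i * \<pi> j)) (\<Phi> (E i (I j T)) f) +
        (scl (mu * \<kappa>) (\<Phi> T f) - scl (lam * \<kappa>) (\<Phi> T f))"
      using T i j by (simp only: \<Phi>_add S_Y S_E S_I S_ssc \<Phi>_ssc) (simp add: algebra_simps)
    also have "scl (mu * \<kappa>) (\<Phi> T f) - scl (lam * \<kappa>) (\<Phi> T f) = scl ((mu - lam) * \<kappa>) (\<Phi> T f)"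
      by (simp add: fun_eq_iff scl_def algebra_simps fun_apply)
    also have "\<Phi> (Y j (P i T)) f - scl (sg (\<pi> j) * sg (\<pi> i * \<pi> j)) (\<Phi> (E i (I j T)) f) +
        scl ((mu - lam) * \<kappa>) (\<Phi> T f) = \<Phi> (LB (mu - lam) i j T) f"
      using T i j by (simp only: LB_def \<kappa>_def[symmetric] \<Phi>_add \<Phi>_diff \<Phi>_ssc S_Y S_E S_I S_P S_ssc S_diff)
    finally show ?thesis using True by (simp add: diff_op_\<Phi>)
  qed (simp add: lie_op_outside diff_op_\<Phi>)
qed

lemma YE_lin: "YE (T + U) = YE T + YE U" "YE (ssc c T) = ssc c (YE T)"
  by (simp_all add: YE_def Y_lin E_lin sum.distrib ssc_sum)

lemma YE_Y: "YE (Y j T) = Y j (YE T)"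
proof -
  have "Y m (E m (Y j T)) = Y j (Y m (E m T))" for m
    using par_cases[of p m] by (simp add: E_Y[of m j] Y_lin Y_Y[of m j])
  moreover have "Y j (\<Sum>m<n. Y m (E m T)) = (\<Sum>m<n. Y j (Y m (E m T)))"
    by (rule additive_sum[of "Y j"]) (simp_all add: Y_lin)
  ultimately show ?thesis by (simp add: YE_def)
qed

text \<open>On the right, the coordinate first turns \<open>T\<close> into \<open>U\<close>; the
  Euler field then adds \<open>YE U\<close> and the degree of \<open>U\<close>. Compared with
  \<open>LQ\<close>, only the degree applied to the contraction in \<open>U\<close> is new.\<close>

lemma lie_op_QX:
  assumes T: "T \<in> S" and j: "j < n" and q: "q = p + 1"
  shows "lie_op p q lam mu (QX j) (diff_op p q T) =
    diff_op p q (LQ j T - Dg real (ssc (sg (\<pi> j)) (I j T)))"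
proof
  fix f
  show "lie_op p q lam mu (QX j) (diff_op p q T) f =
    diff_op p q (LQ j T - Dg real (ssc (sg (\<pi> j)) (I j T))) f"
  proof (cases "f \<in> SF")
    case f: True
    define e where "e = (\<lambda>g. \<Sum>m<n. y m \<star> d m g)"
    have e_SF: "e g \<in> SF" if "g \<in> SF" for g using that by (auto simp: e_def intro!: SF_sum)
    have left: "e (\<Phi> T f) = \<Phi> (YP T + YE T) f"
    proof -
      have "e (\<Phi> T f) = (\<Sum>m<n. \<Phi> (Y m (P m T)) f + \<Phi> (Y m (E m T)) f)"
        unfolding e_def using T f by (intro sum.cong refl) (simp add: \<Phi>_PE \<Phi>_Y smult_add_right)
      moreover have "\<Phi> (YP T) f = (\<Sum>m<n. \<Phi> (Y m (P m T)) f)"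
        unfolding YP_def using T by (intro \<Phi>_sum) simp
      moreover have "\<Phi> (YE T) f = (\<Sum>m<n. \<Phi> (Y m (E m T)) f)"
        unfolding YE_def using T by (intro \<Phi>_sum) simp
      ultimately show ?thesis using T by (simp only: \<Phi>_add sum.distrib S_YP S_YE)
    qed
    have right: "\<Phi> U (e f) = \<Phi> (YE U + Dg real U) f" if U: "U \<in> S" for U
    proof -
      have "\<Phi> U (e f) = (\<Sum>m<n. \<Phi> U (y m \<star> d m f))"
        unfolding e_def using U f by (intro \<Phi>_sum_arg) simp_all
      also have "\<dots> = (\<Sum>m<n. \<Phi> (Y m (E m U) + E m (I m U)) f)"
      proof (intro sum.cong refl)
        fix m assume "m \<in> {..<n}"
        then show "\<Phi> U (y m \<star> d m f) = \<Phi> (Y m (E m U) + E m (I m U)) f"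
          using \<Phi>_right_yd[OF U _ _ f, of m m] by (simp add: sg_par_sq)
      qed
      also have "\<dots> = \<Phi> (\<Sum>m<n. Y m (E m U) + E m (I m U)) f"
        using U by (intro \<Phi>_sum[symmetric]) simp
      also have "(\<Sum>m<n. Y m (E m U) + E m (I m U)) = YE U + Dg real U"
        unfolding sum.distrib YE_def sum_E_I[OF U] ..
      finally show ?thesis .
    qed
    define U where "U = Y j T + ssc (sg (\<pi> j)) (I j T)"
    have U: "U \<in> S" using T j by (simp add: U_def)
    have "lie_op p q lam mu (QX j) (diff_op p q T) f =
        y j \<star> e (\<Phi> T f) - \<Phi> (Tw (\<pi> j) T) (y j \<star> e f)"
      unfolding lie_op_homog[OF T hfield_QX[OF j] f] lie_density_QX[OF j f q]
        lie_density_QX[OF j \<Phi>_SF[OF T f] q] e_def ..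
    also have "\<Phi> (Tw (\<pi> j) T) (y j \<star> e f) = \<Phi> U (e f)"
      using T j e_SF[OF f] by (simp add: \<Phi>_right_y Tw_Tw U_def)
    also have "y j \<star> e (\<Phi> T f) - \<Phi> U (e f) = \<Phi> (Y j (YP T + YE T) - (YE U + Dg real U)) f"
      using T U j f by (simp only: left right \<Phi>_Y \<Phi>_diff S_add S_Y S_YP S_YE S_Dg)
    also have "Y j (YP T + YE T) - (YE U + Dg real U) = LQ j T - Dg real (ssc (sg (\<pi> j)) (I j T))"
      unfolding U_def LQ_def by (simp only: Y_lin YE_lin YE_Y Dg_lin Dg_Y) (simp add: algebra_simps)
    finally show ?thesis using f by (simp add: diff_op_\<Phi>)
  qed (simp add: lie_op_outside diff_op_\<Phi>)
qed

section \<open>The divergence and the quantization map\<close>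


lemma S_dv [simp]: "T \<in> S \<Longrightarrow> dv T \<in> S"
  unfolding dv_def by (intro S_sum) simp

lemma dv_lin: "T \<in> S \<Longrightarrow> U \<in> S \<Longrightarrow> dv (T + U) = dv T + dv U"
  "T \<in> S \<Longrightarrow> dv (ssc c T) = ssc c (dv T)"
  by (simp_all add: dv_def P_lin I_lin ssc_add ssc_sum sum.distrib mult.commute)

lemma ssc_uminus: "- T = ssc (-1) T"
  by (simp add: ssc_minus_left)

lemma dv_diff: "T \<in> S \<Longrightarrow> U \<in> S \<Longrightarrow> dv (T - U) = dv T - dv U"
  by (simp only: diff_conv_add_uminus ssc_uminus dv_lin S_ssc)

lemma dv_0 [simp]: "dv 0 = 0"
  by (simp add: dv_def)

lemma Dg_diff: "Dg \<phi> (T - U) = Dg \<phi> T - Dg \<phi> U"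
  by (simp only: diff_conv_add_uminus ssc_uminus Dg_lin)

lemma sum_delta': "j < n \<Longrightarrow> (\<Sum>i<n. (if i = j then T i else 0) + U i) = T j + (\<Sum>i<n. U i)"
  for T :: "nat \<Rightarrow> symb"
  by (simp add: sum.distrib)

lemma Y_sum: "Y j (\<Sum>a\<in>A. f a) = (\<Sum>a\<in>A. Y j (f a))"
  by (rule additive_sum[of "Y j"]) (simp_all add: Y_lin)

lemma E_sum: "E j (\<Sum>a\<in>A. f a) = (\<Sum>a\<in>A. E j (f a))"
  by (rule additive_sum[of "E j"]) (simp_all add: E_lin)

lemma I_sum: "I j (\<Sum>a\<in>A. f a) = (\<Sum>a\<in>A. I j (f a))"
  by (rule additive_sum[of "I j"]) (simp_all add: I_lin)

lemma Dg_sum: "Dg \<phi> (\<Sum>a\<in>A. f a) = (\<Sum>a\<in>A. Dg \<phi> (f a))"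
  by (rule additive_sum[of "Dg \<phi>"]) (simp_all add: Dg_lin)

lemma P_sum: "(\<And>a. a \<in> A \<Longrightarrow> f a \<in> S) \<Longrightarrow> P j (\<Sum>a\<in>A. f a) = (\<Sum>a\<in>A. P j (f a))"
  by (induction A rule: infinite_finite_induct) (simp_all add: P_lin S_sum)

lemma dv_sum: "(\<And>a. a \<in> A \<Longrightarrow> f a \<in> S) \<Longrightarrow> dv (\<Sum>a\<in>A. f a) = (\<Sum>a\<in>A. dv (f a))"
  by (induction A rule: infinite_finite_induct) (simp_all add: dv_lin S_sum)

text \<open>The divergence is even, so it passes \<open>Y j\<close> without a sign; the extra term
  is the one in which \<open>P j\<close> differentiates the coordinate.\<close>

lemma dv_Y:
  assumes T: "T \<in> S" and j: "j < n"
  shows "dv (Y j T) = Y j (dv T) + ssc (sg (\<pi> j)) (I j T)"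
proof -
  have "dv (Y j T) = (\<Sum>i<n. (if i = j then ssc (sg (\<pi> i)) (I i T) else 0) + ssc (sg (\<pi> i)) (Y j (I i (P i T))))"
    unfolding dv_def
  proof (intro sum.cong refl)
    fix i assume "i \<in> {..<n}"
    then have "P i (Y j T) = (if i = j then T else 0) + ssc (sg (\<pi> i * \<pi> j)) (Y j (P i T))"
      using T j by (intro P_Y) simp_all
    then show "ssc (sg (\<pi> i)) (I i (P i (Y j T))) =
        (if i = j then ssc (sg (\<pi> i)) (I i T) else 0) + ssc (sg (\<pi> i)) (Y j (I i (P i T)))"
      by (cases "i = j") (simp_all add: I_lin I_Y[of i j] I_Y[of j j] ssc_add)
  qed
  then show ?thesis
    unfolding sum_delta'[OF j] by (simp add: dv_def Y_sum Y_lin add.commute)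
qed

lemma dv_E:
  assumes T: "T \<in> S" and j: "j < n"
  shows "dv (E j T) = E j (dv T) + P j T"
proof -
  have "dv (E j T) = (\<Sum>i<n. (if i = j then P i T else 0) + ssc (sg (\<pi> i)) (E j (I i (P i T))))"
    unfolding dv_def
  proof (intro sum.cong refl)
    fix i assume i: "i \<in> {..<n}"
    then have PT: "P i T \<in> S" using T by simp
    have "I i (P i (E j T)) = ssc (sg (\<pi> i * \<pi> j)) (if i = j then P i T else 0) + E j (I i (P i T))"
      using T PT by (simp add: P_E[of _ i j] I_lin I_E[of _ i j] ssc_add)
    then show "ssc (sg (\<pi> i)) (I i (P i (E j T))) =
        (if i = j then P i T else 0) + ssc (sg (\<pi> i)) (E j (I i (P i T)))"
      by (cases "i = j") (simp_all add: ssc_add sg_par_sq)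
  qed
  then show ?thesis
    unfolding sum_delta'[OF j] by (simp add: dv_def E_sum E_lin add.commute)
qed

lemma dv_I:
  assumes T: "T \<in> S" and j: "j < n"
  shows "dv (I j T) = I j (dv T)"
proof -
  have "dv (I j T) = (\<Sum>i<n. ssc (sg (\<pi> i)) (I j (I i (P i T))))"
    unfolding dv_def
    by (intro sum.cong refl) (use T in \<open>simp add: P_I[of _ _ j] I_lin I_I[of _ _ j]\<close>)
  then show ?thesis by (simp add: dv_def I_sum I_lin)
qed

lemma dv_P:
  assumes T: "T \<in> S" and j: "j < n"
  shows "dv (P j T) = P j (dv T)"
proof -
  have "I i (P i (P j T)) = P j (I i (P i T))" if i: "i < n" for i
  proof -
    have "P j (I i (P i T)) = ssc (sg (\<pi> j * \<pi> i)) (I i (P j (P i T)))"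
      using T i by (intro P_I) simp
    also have "P j (P i T) = ssc (sg (\<pi> j * \<pi> i)) (P i (P j T))"
      using T i j by (intro P_P) simp_all
    finally show ?thesis by (simp add: I_lin)
  qed
  then have "dv (P j T) = (\<Sum>i<n. P j (ssc (sg (\<pi> i)) (I i (P i T))))"
    unfolding dv_def by (intro sum.cong refl) (use T in \<open>simp add: P_lin\<close>)
  also have "\<dots> = P j (dv T)"
    unfolding dv_def by (rule P_sum[symmetric]) (use T in simp)
  finally show ?thesis .
qed

lemma dv_Dg: "T \<in> S \<Longrightarrow> dv (Dg \<phi> T) = Dg (\<lambda>k. \<phi> (Suc k)) (dv T)"
  unfolding dv_def Dg_sum by (intro sum.cong refl) (simp add: Dg_P[symmetric] Dg_I Dg_lin)

lemma YP_lin: "T \<in> S \<Longrightarrow> U \<in> S \<Longrightarrow> YP (T + U) = YP T + YP U"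
  "T \<in> S \<Longrightarrow> YP (ssc c T) = ssc c (YP T)"
  by (simp_all add: YP_def Y_lin P_lin sum.distrib ssc_sum)

lemma dv_YP:
  assumes T: "T \<in> S"
  shows "dv (YP T) = YP (dv T) + dv T"
proof -
  have "dv (YP T) = (\<Sum>m<n. dv (Y m (P m T)))"
    unfolding YP_def by (rule dv_sum) (use T in simp)
  also have "\<dots> = (\<Sum>m<n. Y m (P m (dv T)) + ssc (sg (\<pi> m)) (I m (P m T)))"
    by (intro sum.cong refl) (use T in \<open>simp add: dv_Y dv_P\<close>)
  finally show ?thesis by (simp add: sum.distrib YP_def dv_def)
qed

text \<open>Differentiating \<open>y^m\<close> leaves \<open>I m (E m T)\<close> with the sign of
  \<open>m\<close>; reordering it produces the superdimension \<open>p - q\<close> and the degree.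
  Contracting \<open>e_m\<close> leaves \<open>YP T\<close>.\<close>

lemma dv_YE:
  assumes T: "T \<in> S"
  shows "dv (YE T) = YE (dv T) + YP T + ssc (real p - real q) T + Dg real T"
proof -
  have "dv (YE T) = (\<Sum>m<n. dv (Y m (E m T)))"
    unfolding YE_def by (rule dv_sum) (use T in simp)
  also have "\<dots> = (\<Sum>m<n. Y m (E m (dv T)) + Y m (P m T) + (ssc (sg (\<pi> m)) T + E m (I m T)))"
    by (intro sum.cong refl)
       (use T in \<open>simp add: dv_Y dv_E Y_lin I_E[of _ m m for m] ssc_add sg_par_sq\<close>)
  also have "\<dots> = YE (dv T) + YP T + ((\<Sum>m<n. ssc (sg (\<pi> m)) T) + Dg real T)"
    by (simp add: sum.distrib YE_def YP_def sum_E_I[OF T])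
  also have "(\<Sum>m<n. ssc (sg (\<pi> m)) T) = ssc (\<Sum>m<n. sg (\<pi> m)) T"
    by (rule additive_sum[of "\<lambda>c. ssc c T", symmetric]) (simp_all add: ssc_add_left)
  finally show ?thesis by (simp add: sum_sg add.assoc)
qed

lemma I_YP:
  assumes T: "T \<in> S" and j: "j < n"
  shows "I j (YP T) = YP (I j T)"
proof -
  have "I j (Y m (P m T)) = Y m (P m (I j T))" if "m < n" for m
    using T that by (simp add: I_Y[of j m] P_I[of T m j] Y_lin mult.commute)
  then show ?thesis unfolding YP_def I_sum by (intro sum.cong refl) simp
qed

lemma S_LQ [simp]: "T \<in> S \<Longrightarrow> j < n \<Longrightarrow> LQ j T \<in> S"
  by (simp add: LQ_def)

lemma S_LB [simp]: "T \<in> S \<Longrightarrow> i < n \<Longrightarrow> j < n \<Longrightarrow> LB \<delta> i j T \<in> S"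
  by (simp add: LB_def)

lemma Dg_Suc: "Dg (\<lambda>k. real (Suc k)) T = Dg real T + T"
  by (rule ext) (simp add: Dg_def fun_apply scl_add_left add.commute)

text \<open>The terms \<open>YP (I j T)\<close> cancel, as do the terms \<open>Y j (dv T)\<close>.
  The two single copies of \<open>I j T\<close>, one from the shift of the degree and one from
  \<open>p - q = -1\<close>, cancel too. The degree of the contraction survives, twice.\<close>

lemma dv_LQ:
  assumes T: "T \<in> S" and j: "j < n" and q: "q = p + 1"
  shows "dv (LQ j T) = LQ j (dv T) - Dg (\<lambda>k. 2 * real k) (ssc (sg (\<pi> j)) (I j T))"
proof -
  define s where "s = sg (\<pi> j)"
  have pq: "real p - real q = -1" using q by simp
  have D: "Dg (\<lambda>k. 2 * real k) U = Dg real U + Dg real U" for U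
    by (rule ext) (simp only: Dg_def plus_fun_apply mult_2 scl_add_left)
  have "dv (LQ j T) = dv (Y j (YP T)) - dv (Y j (Dg real T)) - ssc s (dv (YE (I j T)))"
    using T j by (simp add: LQ_def dv_diff dv_lin s_def)
  also have "dv (Y j (YP T)) = Y j (YP (dv T)) + Y j (dv T) + ssc s (YP (I j T))"
    using T j by (simp add: dv_Y dv_YP Y_lin I_YP s_def)
  also have "dv (Y j (Dg real T)) = Y j (Dg real (dv T)) + Y j (dv T) + ssc s (Dg real (I j T)) + ssc s (I j T)"
    using T j by (simp add: dv_Y dv_Dg Dg_I Dg_Suc Y_lin ssc_add s_def add.assoc del: of_nat_Suc)
  also have "dv (YE (I j T)) = YE (I j (dv T)) + YP (I j T) - I j T + Dg real (I j T)"
    using T j by (simp add: dv_YE dv_I pq ssc_minus_left)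
  finally show ?thesis
    unfolding LQ_def s_def[symmetric] D Dg_lin
    by (simp only: ssc_add ssc_diff) (simp add: algebra_simps)
qed

text \<open>The extra terms of \<open>dv_Y\<close> and \<open>dv_E\<close> are both
  \<open>I j (P i T)\<close> up to sign, and they cancel. The weight term is a multiple of
  \<open>T\<close>, so fields of nonzero divergence behave like the others.\<close>

lemma dv_LB:
  assumes T: "T \<in> S" and i: "i < n" and j: "j < n"
  shows "dv (LB \<delta> i j T) = LB \<delta> i j (dv T)"
proof -
  have "P i (I j T) = ssc (sg (\<pi> i * \<pi> j)) (I j (P i T))" by (rule P_I[OF T])
  then show ?thesis using T i j
    by (simp add: LB_def dv_diff dv_lin dv_Y dv_E dv_I dv_P ssc_add) (simp add: algebra_simps)
qed


section \<open>The filtration by degree\<close>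

text \<open>Strict, so that the bound 0 forces \<open>T = 0\<close> and inductions on the bound can
  start there.\<close>

definition deg_lt :: "nat \<Rightarrow> symb \<Rightarrow> bool" where
  "deg_lt k T \<longleftrightarrow> (\<forall>M. T M \<noteq> 0 \<longrightarrow> size M < k)"

lemma deg_lt_ex: "T \<in> S \<Longrightarrow> \<exists>k. deg_lt k T"
proof -
  assume "T \<in> S"
  then obtain k where "T \<in> symbols_le p q k" using S_le_degree by blast
  then have "deg_lt (Suc k) T" unfolding deg_lt_def symbols_le_def less_Suc_eq_le by blast
  then show ?thesis ..
qed

lemma deg_lt_mono: "deg_lt k T \<Longrightarrow> k \<le> l \<Longrightarrow> deg_lt l T"
  unfolding deg_lt_def by (meson less_le_trans)

lemma deg_lt_0: "deg_lt 0 T \<Longrightarrow> T = 0"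
  unfolding deg_lt_def by (auto simp: fun_eq_iff zero_fun_apply)

lemma deg_ltD: "deg_lt k T \<Longrightarrow> k \<le> size M \<Longrightarrow> T M = 0"
  unfolding deg_lt_def by (meson not_less)

lemma deg_lt_add: "deg_lt k T \<Longrightarrow> deg_lt k U \<Longrightarrow> deg_lt k (T + U)"
  unfolding deg_lt_def by (metis plus_fun_apply add.right_neutral)

lemma deg_lt_diff: "deg_lt k T \<Longrightarrow> deg_lt k U \<Longrightarrow> deg_lt k (T - U)"
  unfolding deg_lt_def by (metis minus_apply diff_zero)

lemma deg_lt_Dg: "deg_lt k T \<Longrightarrow> deg_lt k (Dg \<phi> T)"
  unfolding deg_lt_def Dg_def by (metis scl_0(2))

lemma deg_lt_ssc: "deg_lt k T \<Longrightarrow> deg_lt k (ssc c T)"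
  unfolding deg_lt_def ssc_def by (metis scl_0(2))

lemma deg_lt_sum: "(\<And>a. a \<in> A \<Longrightarrow> deg_lt k (f a)) \<Longrightarrow> deg_lt k (\<Sum>a\<in>A. f a)"
proof (induction A rule: infinite_finite_induct)
  case (insert a A)
  then show ?case by (simp add: deg_lt_add)
qed (simp_all add: deg_lt_def zero_fun_apply)

lemma deg_lt_dv: "deg_lt (Suc k) T \<Longrightarrow> deg_lt k (dv T)"
proof -
  assume "deg_lt (Suc k) T"
  then have "T (add_mset j M) = 0" if "k \<le> size M" for j M
    using that by (intro deg_ltD[of "Suc k"]) auto
  then have "ssc c (I j (P j T)) M = 0" if "k \<le> size M" for j M c
    using that by (simp add: ssc_def I_def P_def)
  then have "dv T M = 0" if "k \<le> size M" for M
    using that by (simp add: dv_def sum_fun_apply[of "\<lambda>j. ssc (sg (\<pi> j)) (I j (P j T))"])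
  then show ?thesis unfolding deg_lt_def using not_le by blast
qed

lemma deg_lt_dv_pow: "deg_lt k T \<Longrightarrow> deg_lt (k - r) ((dv ^^ r) T)"
proof (induction r)
  case (Suc r)
  then have "deg_lt (k - r) ((dv ^^ r) T)" by simp
  then have "deg_lt (Suc (k - Suc r)) ((dv ^^ r) T)" by (rule deg_lt_mono) simp
  then show ?case using deg_lt_dv by simp
qed simp

lemma S_dv_pow [simp]: "T \<in> S \<Longrightarrow> (dv ^^ r) T \<in> S"
  by (induction r) simp_all

lemma dv_pow_lin: "T \<in> S \<Longrightarrow> U \<in> S \<Longrightarrow> (dv ^^ r) (T + U) = (dv ^^ r) T + (dv ^^ r) U"
  "T \<in> S \<Longrightarrow> (dv ^^ r) (ssc c T) = ssc c ((dv ^^ r) T)"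
  by (induction r) (simp_all add: dv_lin)

lemma dv_pow_Dg: "T \<in> S \<Longrightarrow> (dv ^^ r) (Dg \<phi> T) = Dg (\<lambda>k. \<phi> (k + r)) ((dv ^^ r) T)"
  by (induction r) (simp_all add: dv_Dg)

lemma dv_pow_0: "deg_lt r T \<Longrightarrow> (dv ^^ r) T = 0"
  using deg_lt_dv_pow[of r T r] deg_lt_0 by simp

text \<open>
  For \<open>k = 1\<close> the denominators in \<open>C_coeff\<close> vanish, and the
  recurrence below leaves the coefficient of the divergence free.
\<close>

definition cc :: "real \<Rightarrow> nat \<Rightarrow> nat \<Rightarrow> real" where
  "cc t k r = (if k = 1 then (if r = 0 then 1 else if r = 1 then t else 0)
     else if r \<le> k then C_coeff k r else 0)"

section \<open>The coefficients and the operator that conjugates the two actions\<close>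

lemma cc_0 [simp]: "cc t k 0 = 1"
  by (simp add: cc_def C_coeff_def)

lemma C_coeff_Suc:
  "C_coeff k (Suc r) = C_coeff k r * ((real k - real (Suc r)) / (real (Suc r) * (2 * real k - 1 - real (Suc r))))"
  by (simp add: C_coeff_def divide_inverse mult_ac)

text \<open>Indexed by the degree \<open>k\<close> reached after \<open>Suc r\<close> divergences.
  For \<open>k + r = 0\<close> both sides are 0 whatever \<open>t\<close> is. Otherwise the starting
  degree is at least 2, the new denominator is nonzero, and the claim is the ratio of consecutive
  coefficients.\<close>

lemma cc_recurrence:
  "cc t (k + Suc r) (Suc r) * (real (Suc r) * (2 * real k + real r)) = real k * cc t (Suc k + r) r"
proof (cases "k + r = 0")
  case False
  then have "2 * real k + real r \<noteq> 0" by (cases k) auto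
  moreover have "2 * real (k + Suc r) - 1 - real (Suc r) = 2 * real k + real r"
    "real (k + Suc r) - real (Suc r) = real k" by simp_all
  ultimately show ?thesis using False
    by (simp add: cc_def C_coeff_Suc del: of_nat_Suc of_nat_add)
qed simp

text \<open>All degrees at once: the part of degree \<open>k\<close> in the \<open>r\<close>-th
  divergence stems from degree \<open>k + r\<close>, hence the index of the coefficient. Every
  \<open>N\<close> that bounds the degree gives the same value, as further divergences are
  0.\<close>

definition G :: "real \<Rightarrow> nat \<Rightarrow> symb \<Rightarrow> symb" where
  "G t N T = (\<Sum>r\<le>N. Dg (\<lambda>k. cc t (k + r) r) ((dv ^^ r) T))"

lemma S_G [simp]: "T \<in> S \<Longrightarrow> G t N T \<in> S"
  unfolding G_def by (intro S_sum) simp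

lemma G_lin: "T \<in> S \<Longrightarrow> U \<in> S \<Longrightarrow> G t N (T + U) = G t N T + G t N U"
  "T \<in> S \<Longrightarrow> G t N (ssc c T) = ssc c (G t N T)"
  by (simp_all add: G_def dv_pow_lin Dg_lin sum.distrib ssc_sum)

lemma G_0 [simp]: "G t N 0 = 0"
  using G_lin(2)[of 0 t N 0] by simp

lemma G_diff: "T \<in> S \<Longrightarrow> U \<in> S \<Longrightarrow> G t N (T - U) = G t N T - G t N U"
  by (simp only: diff_conv_add_uminus ssc_uminus G_lin S_ssc)

lemma G_sum: "(\<And>a. a \<in> A \<Longrightarrow> f a \<in> S) \<Longrightarrow> G t N (\<Sum>a\<in>A. f a) = (\<Sum>a\<in>A. G t N (f a))"
  by (induction A rule: infinite_finite_induct) (simp_all add: G_lin S_sum)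

text \<open>Divergences do not reach the top degree, so \<open>G\<close> is the identity plus terms
  of lower degree. Injectivity, surjectivity and the principal symbol rest on this.\<close>

lemma G_top:
  assumes T: "deg_lt (Suc k) T" and M: "k \<le> size M"
  shows "G t N T M = T M"
proof -
  have "(dv ^^ Suc r) T M = 0" for r
    using deg_lt_dv_pow[OF T, of "Suc r"] M by (intro deg_ltD[of "Suc k - Suc r"]) auto
  then have "Dg (\<lambda>k. cc t (k + r) r) ((dv ^^ r) T) M = (if r = 0 then T M else 0)" for r
    by (cases r) (simp_all add: Dg_def)
  then show ?thesis
    by (simp add: G_def sum_fun_apply[of "\<lambda>r. Dg (\<lambda>k. cc t (k + r) r) ((dv ^^ r) T)"])
qed

lemma deg_lt_G: "deg_lt k T \<Longrightarrow> deg_lt k (G t N T)"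
  unfolding G_def
  by (intro deg_lt_sum deg_lt_Dg deg_lt_mono[OF deg_lt_dv_pow]) auto

lemma deg_lt_if_top: "deg_lt (Suc k) T \<Longrightarrow> (\<And>M. k \<le> size M \<Longrightarrow> T M = 0) \<Longrightarrow> deg_lt k T"
  unfolding deg_lt_def using not_le by blast

lemma G_inj:
  assumes "T \<in> S" "G t N T = 0"
  shows "T = 0"
proof -
  have "T = 0" if "deg_lt k T" for k
    using that
  proof (induction k)
    case 0
    then show ?case by (rule deg_lt_0)
  next
    case (Suc k)
    have "T M = 0" if "k \<le> size M" for M
      using G_top[OF Suc.prems that, of t N] assms(2) by (simp add: zero_fun_apply)
    then show ?case using Suc deg_lt_if_top by blast
  qed
  then show ?thesis using deg_lt_ex[OF assms(1)] by blast
qed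

lemma G_surj:
  assumes "T \<in> S" "deg_lt k T"
  shows "\<exists>U\<in>S. deg_lt k U \<and> G t N U = T"
  using assms
proof (induction k arbitrary: T)
  case 0
  then have "T = 0" by (auto intro: deg_lt_0)
  then show ?case using 0 by (intro bexI[of _ 0]) simp_all
next
  case (Suc k)
  \<comment> \<open>As an approximate preimage of itself, \<open>T\<close> has an error of lower
    degree; adding the preimage \<open>U\<close> of the error corrects it.\<close>
  have "deg_lt k (T - G t N T)"
  proof (rule deg_lt_if_top)
    show "deg_lt (Suc k) (T - G t N T)" by (intro deg_lt_diff deg_lt_G Suc.prems)
    show "(T - G t N T) M = 0" if "k \<le> size M" for M
      using G_top[OF Suc.prems(2) that] by (simp add: minus_apply)
  qed
  then obtain U where U: "U \<in> S" "deg_lt k U" "G t N U = T - G t N T"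
    using Suc.IH[of "T - G t N T"] Suc.prems(1) by auto
  have "deg_lt (Suc k) (T + U)"
    by (intro deg_lt_add Suc.prems deg_lt_mono[OF U(2)]) simp
  moreover have "G t N (T + U) = T" using U Suc.prems(1) by (simp add: G_lin)
  ultimately show ?case using U(1) Suc.prems(1) by (intro bexI[of _ "T + U"]) simp_all
qed

text \<open>
  If \<open>L\<close> fails to commute with the divergence by \<open>2 deg \<circ> \<iota>\<close>, then \<open>G\<close> conjugates \<open>L\<close> to
  \<open>L - deg \<circ> \<iota>\<close>: this is what the recurrence of the coefficients says.
\<close>

lemma G_intertwines:
  assumes T: "T \<in> S" and N: "deg_lt N T"
    and L: "\<And>T. T \<in> S \<Longrightarrow> L T \<in> S" "\<And>T U. T \<in> S \<Longrightarrow> U \<in> S \<Longrightarrow> L (T + U) = L T + L U"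
      "\<And>T \<phi>. T \<in> S \<Longrightarrow> L (Dg \<phi> T) = Dg \<phi> (L T)"
    and \<iota>: "\<And>T. T \<in> S \<Longrightarrow> \<iota> T \<in> S" "\<And>T U. T \<in> S \<Longrightarrow> U \<in> S \<Longrightarrow> \<iota> (T + U) = \<iota> T + \<iota> U"
      "\<And>T \<phi>. T \<in> S \<Longrightarrow> \<iota> (Dg \<phi> T) = Dg (\<lambda>k. \<phi> (Suc k)) (\<iota> T)"
      "\<And>T. T \<in> S \<Longrightarrow> dv (\<iota> T) = \<iota> (dv T)"
    and comm: "\<And>T. T \<in> S \<Longrightarrow> dv (L T) = L (dv T) - Dg (\<lambda>k. 2 * real k) (\<iota> T)"
  shows "G t N (L T) = L (G t N T) - Dg real (\<iota> (G t N T))"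
proof -
  \<comment> \<open>Each divergence contributes twice the degree, shifted by the divergences applied
    after it: the sum of \<open>2 * (k + s)\<close> over \<open>s \<le> r\<close> is
    \<open>(r + 1) * (2 * k + r)\<close>.\<close>
  have pow: "(dv ^^ Suc r) (L T) = L ((dv ^^ Suc r) T)
      - Dg (\<lambda>k. real (Suc r) * (2 * real k + real r)) (\<iota> ((dv ^^ r) T))" for r
  proof (induction r)
    case 0
    show ?case using comm[OF T] by simp
  next
    case (Suc r)
    have "(dv ^^ Suc (Suc r)) (L T) = dv (L ((dv ^^ Suc r) T)) -
        dv (Dg (\<lambda>k. real (Suc r) * (2 * real k + real r)) (\<iota> ((dv ^^ r) T)))"
      using Suc T L \<iota> by (simp add: dv_diff)
    also have "\<dots> = L ((dv ^^ Suc (Suc r)) T) - (Dg (\<lambda>k. 2 * real k) (\<iota> ((dv ^^ Suc r) T)) +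
        Dg (\<lambda>k. real (Suc r) * (2 * real (Suc k) + real r)) (\<iota> ((dv ^^ Suc r) T)))"
      using comm[of "(dv ^^ Suc r) T"] T L \<iota> by (simp add: dv_Dg)
    also have "Dg (\<lambda>k. 2 * real k) (\<iota> ((dv ^^ Suc r) T)) +
        Dg (\<lambda>k. real (Suc r) * (2 * real (Suc k) + real r)) (\<iota> ((dv ^^ Suc r) T)) =
        Dg (\<lambda>k. real (Suc (Suc r)) * (2 * real k + real (Suc r))) (\<iota> ((dv ^^ Suc r) T))"
      by (rule ext) (simp add: Dg_def plus_fun_apply scl_add_left[symmetric] algebra_simps)
    finally show ?case .
  qed
  have sumL: "L (\<Sum>a\<in>A. f a) = (\<Sum>a\<in>A. L (f a))" and sumI: "\<iota> (\<Sum>a\<in>A. f a) = (\<Sum>a\<in>A. \<iota> (f a))"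
    if "finite A" "\<And>a. a \<in> A \<Longrightarrow> f a \<in> S" for A :: "nat set" and f
  proof -
    have "L 0 = 0" "\<iota> 0 = 0" using L(2)[of 0 0] \<iota>(2)[of 0 0] by simp_all
    with that show "L (\<Sum>a\<in>A. f a) = (\<Sum>a\<in>A. L (f a))" "\<iota> (\<Sum>a\<in>A. f a) = (\<Sum>a\<in>A. \<iota> (f a))"
      by (induction A) (simp_all add: L \<iota> S_sum)
  qed
  have "G t N (L T) = Dg (\<lambda>k. cc t k 0) (L T) + (\<Sum>r<N. Dg (\<lambda>k. cc t (k + Suc r) (Suc r)) ((dv ^^ Suc r) (L T)))"
    unfolding G_def sum.atMost_shift by simp
  also have "\<dots> = Dg (\<lambda>k. cc t k 0) (L T) + (\<Sum>r<N. Dg (\<lambda>k. cc t (k + Suc r) (Suc r)) (L ((dv ^^ Suc r) T)))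
      - (\<Sum>r<N. Dg (\<lambda>k. real k * cc t (Suc k + r) r) (\<iota> ((dv ^^ r) T)))"
    unfolding pow Dg_diff Dg_Dg sum_subtractf cc_recurrence by (rule add_diff_eq)
  also have "Dg (\<lambda>k. cc t k 0) (L T) + (\<Sum>r<N. Dg (\<lambda>k. cc t (k + Suc r) (Suc r)) (L ((dv ^^ Suc r) T))) =
      (\<Sum>r\<le>N. Dg (\<lambda>k. cc t (k + r) r) (L ((dv ^^ r) T)))"
    unfolding sum.atMost_shift by simp
  also have "\<dots> = L (G t N T)"
    unfolding G_def using T L by (subst sumL) simp_all
  also have "(\<Sum>r<N. Dg (\<lambda>k. real k * cc t (Suc k + r) r) (\<iota> ((dv ^^ r) T))) =
      (\<Sum>r\<le>N. Dg (\<lambda>k. real k * cc t (Suc k + r) r) (\<iota> ((dv ^^ r) T)))"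
  proof -
    \<comment> \<open>The two sums differ by the term \<open>r = N\<close>, which is 0 because
      \<open>N\<close> bounds the degree strictly.\<close>
    have "\<iota> ((dv ^^ N) T) = 0" unfolding dv_pow_0[OF N] using \<iota>(2)[of 0 0] by simp
    then show ?thesis by (simp add: lessThan_Suc_atMost[symmetric])
  qed
  also have "\<dots> = Dg real (\<iota> (G t N T))"
    unfolding G_def using T \<iota> by (subst sumI) (simp_all add: Dg_sum Dg_Dg)
  finally show ?thesis .
qed

section \<open>The quantization map as an operator on total symbols\<close>

lemma deg_part_Dg: "deg_part k T = Dg (\<lambda>j. if j = k then 1 else 0) T"
  by (rule ext) (simp add: deg_part_def Dg_def)

lemma sdiv_pow: "T \<in> S \<Longrightarrow> (sdiv p q ^^ r) T = (dv ^^ r) T"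
  by (induction r) (simp_all add: sdiv_eq)

lemma Q_deg_eq:
  assumes T: "T \<in> S" and k: "\<And>M. T M \<noteq> 0 \<Longrightarrow> size M = k" and N: "k \<le> N" and f: "f \<in> SF"
  shows "Q_deg p q t k T f = \<Phi> (G t N T) f"
proof -
  have pure: "Dg (\<lambda>j. if j = k then 1 else 0) T = T"
    by (rule ext) (use k in \<open>auto simp: Dg_def\<close>)
  \<comment> \<open>The \<open>r\<close>-th divergence of a symbol of pure degree \<open>k\<close>
    is pure of degree \<open>k - r\<close>, and 0 for \<open>r > k\<close>. On it the
    degree-dependent coefficient is the constant \<open>cc t k r\<close>.\<close>
  have dvp: "(dv ^^ r) T = Dg (\<lambda>j. if j + r = k then 1 else 0) ((dv ^^ r) T)" for r
    using dv_pow_Dg[OF T, of r "\<lambda>j. if j = k then 1 else 0"] unfolding pure .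
  have "Dg (\<lambda>j. cc t (j + r) r) ((dv ^^ r) T) = ssc (cc t k r) ((dv ^^ r) T)" for r
  proof -
    have "Dg (\<lambda>j. cc t (j + r) r) ((dv ^^ r) T) =
        Dg (\<lambda>j. cc t (j + r) r * (if j + r = k then 1 else 0)) ((dv ^^ r) T)"
      by (subst dvp) (rule Dg_Dg)
    also have "\<dots> = Dg (\<lambda>j. cc t k r * (if j + r = k then 1 else 0)) ((dv ^^ r) T)"
      by (rule arg_cong[of _ _ "\<lambda>\<phi>. Dg \<phi> _"]) auto
    also have "\<dots> = ssc (cc t k r) (Dg (\<lambda>j. if j + r = k then 1 else 0) ((dv ^^ r) T))"
      by (rule ext) (simp add: Dg_def ssc_def)
    finally show ?thesis unfolding dvp[symmetric] .
  qed
  then have "G t N T = (\<Sum>r\<le>N. ssc (cc t k r) ((dv ^^ r) T))" by (simp add: G_def)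
  then have "\<Phi> (G t N T) f = (\<Sum>r\<le>N. scl (cc t k r) (\<Phi> ((dv ^^ r) T) f))"
    using T by (simp add: \<Phi>_sum \<Phi>_ssc)
  also have "\<dots> = (\<Sum>r\<le>k. scl (cc t k r) (\<Phi> ((dv ^^ r) T) f))"
    by (rule sum.mono_neutral_right) (use N in \<open>auto simp: cc_def\<close>)
  also have "\<dots> = Q_deg p q t k T f"
  proof (cases "k = 1")
    case True
    \<comment> \<open>The divergence of a symbol of degree 1 is a single function at the empty
      monomial, the one by which \<open>Q_deg\<close> multiplies.\<close>
    have "dv T M = 0" if "M \<noteq> {#}" for M
      using fun_cong[OF dvp[of 1], of M] that True by (auto simp: Dg_def)
    then have "dv T = sing {#} (dv T {#})" by (auto simp: sing_def)
    then have "\<Phi> (dv T) f = dv T {#} \<star> f" by (metis \<Phi>_sing pd_mono_empty)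
    then show ?thesis using True T f
      by (simp add: Q_deg_def cc_def Q_aff_eq diff_op_\<Phi> sdiv_eq)
  next
    case False
    then show ?thesis using T f
      by (simp add: Q_deg_def cc_def sdiv_pow Q_aff_eq diff_op_\<Phi> atMost_atLeast0)
  qed
  finally show ?thesis ..
qed

text \<open>\<open>G\<close> is linear and agrees with \<open>Q_deg\<close> on each pure degree,
  with one \<open>N\<close> for all degrees. Properties of the quantization thus become properties
  of \<open>G\<close>.\<close>

lemma Q_map_eq:
  assumes T: "T \<in> S" and N: "deg_lt N T"
  shows "Q_map p q t T = diff_op p q (G t N T)"
proof
  fix f
  define K where "K = size ` {M. T M \<noteq> 0}"
  have K: "finite K" using S_finite[OF T] by (simp add: K_def)
  show "Q_map p q t T f = diff_op p q (G t N T) f"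
  proof (cases "f \<in> SF")
    case True
    have "Q_map p q t T f = (\<Sum>k\<in>K. Q_deg p q t k (deg_part k T) f)"
      unfolding Q_map_def K_def by (rule sum_fun_apply)
    also have "\<dots> = (\<Sum>k\<in>K. \<Phi> (G t N (deg_part k T)) f)"
    proof (intro sum.cong refl Q_deg_eq)
      show "deg_part k T \<in> S" for k using T by (simp add: deg_part_Dg)
      show "size M = k" if "deg_part k T M \<noteq> 0" for k M
        using that by (simp add: deg_part_def split: if_splits)
      show "k \<le> N" if "k \<in> K" for k using that N by (auto simp: K_def deg_lt_def)
    qed (rule True)
    also have "\<dots> = \<Phi> (\<Sum>k\<in>K. G t N (deg_part k T)) f"
      using T by (intro \<Phi>_sum[symmetric]) (simp add: deg_part_Dg)
    also have "(\<Sum>k\<in>K. G t N (deg_part k T)) = G t N (\<Sum>k\<in>K. deg_part k T)"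
      using T by (intro G_sum[symmetric]) (simp add: deg_part_Dg)
    also have "(\<Sum>k\<in>K. deg_part k T) = T"
    proof
      fix M
      have "(\<Sum>k\<in>K. deg_part k T) M = (\<Sum>k\<in>K. if size M = k then T M else 0)"
        unfolding sum_fun_apply[of "\<lambda>k. deg_part k T"] unfolding deg_part_def ..
      also have "\<dots> = T M" using K by (auto simp: K_def)
      finally show "(\<Sum>k\<in>K. deg_part k T) M = T M" .
    qed
    finally show ?thesis using True by (simp add: diff_op_\<Phi>)
  next
    case False
    then show ?thesis
      unfolding Q_map_def sum_fun_apply[of "\<lambda>k. Q_deg p q t k (deg_part k T)"]
      by (simp add: Q_deg_def diff_op_\<Phi>)
  qed
qed

lemma deg_lt_common:
  assumes "T \<in> S" "U \<in> S"
  shows "\<exists>N. deg_lt N T \<and> deg_lt N U"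
proof -
  obtain k l where "deg_lt k T" "deg_lt l U" using assms deg_lt_ex by blast
  then have "deg_lt (max k l) T" "deg_lt (max k l) U" by (simp_all add: deg_lt_mono)
  then show ?thesis by blast
qed

lemma diff_op_add: "T \<in> S \<Longrightarrow> U \<in> S \<Longrightarrow> diff_op p q (T + U) = diff_op p q T + diff_op p q U"
  by (rule ext) (simp add: diff_op_\<Phi> \<Phi>_add plus_fun_apply)

lemma diff_op_ssc: "T \<in> S \<Longrightarrow> diff_op p q (ssc c T) = (\<lambda>f. scl c (diff_op p q T f))"
  by (rule ext) (simp add: diff_op_\<Phi> \<Phi>_ssc)

lemma Q_map_lin:
  assumes T: "T \<in> S"
  shows "U \<in> S \<Longrightarrow> Q_map p q t (T + U) = Q_map p q t T + Q_map p q t U"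
    "Q_map p q t (ssc c T) = (\<lambda>f. scl c (Q_map p q t T f))"
proof -
  assume U: "U \<in> S"
  obtain N where N: "deg_lt N T" "deg_lt N U" using deg_lt_common[OF T U] by blast
  show "Q_map p q t (T + U) = Q_map p q t T + Q_map p q t U"
    using T U N by (simp add: Q_map_eq[of _ N] deg_lt_add G_lin diff_op_add)
next
  obtain N where N: "deg_lt N T" using deg_lt_ex[OF T] by blast
  show "Q_map p q t (ssc c T) = (\<lambda>f. scl c (Q_map p q t T f))"
    using T N by (simp add: Q_map_eq[of _ N] deg_lt_ssc G_lin diff_op_ssc)
qed

lemma quantization_Q_map: "quantization p q (Q_map p q t)"
  unfolding quantization_def
proof (intro conjI ballI allI)
  show "Q_map p q t (T + U) = Q_map p q t T + Q_map p q t U" if "T \<in> S" "U \<in> S" for T U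
    using that by (rule Q_map_lin)
  show "Q_map p q t (\<lambda>M. scl c (T M)) = (\<lambda>f. scl c (Q_map p q t T f))" if "T \<in> S" for c T
    using Q_map_lin(2)[OF that] by (simp add: ssc_def)
  show "bij_betw (Q_map p q t) S (diff_ops p q)"
    unfolding bij_betw_def
  proof
    show "inj_on (Q_map p q t) S"
    proof (rule inj_onI)
      fix T U assume T: "T \<in> S" and U: "U \<in> S" and eq: "Q_map p q t T = Q_map p q t U"
      obtain N where N: "deg_lt N T" "deg_lt N U" using deg_lt_common[OF T U] by blast
      have "G t N T = G t N U"
        using eq unfolding Q_map_eq[OF T N(1)] Q_map_eq[OF U N(2)] by (rule diff_op_inj[rotated 2]) (simp_all add: T U)
      then have "G t N (T - U) = 0" using T U by (simp add: G_diff)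
      then have "T - U = 0" using G_inj[OF S_diff[OF T U]] by blast
      then show "T = U" by simp
    qed
    show "Q_map p q t ` S = diff_ops p q"
    proof
      show "Q_map p q t ` S \<subseteq> diff_ops p q"
        using deg_lt_ex Q_map_eq unfolding diff_ops_eq by (metis S_G image_subsetI imageI)
      show "diff_ops p q \<subseteq> Q_map p q t ` S"
      proof
        fix D assume "D \<in> diff_ops p q"
        then obtain T where T: "T \<in> S" "D = diff_op p q T" unfolding diff_ops_eq by blast
        obtain N where "deg_lt N T" using deg_lt_ex[OF T(1)] by blast
        then obtain U where "U \<in> S" "deg_lt N U" "G t N U = T" using G_surj[OF T(1)] by blast
        then have "U \<in> S" "D = Q_map p q t U" using Q_map_eq[of U N t] T(2) by simp_all
        then show "D \<in> Q_map p q t ` S" by blast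
      qed
    qed
  qed
  fix k T assume T: "T \<in> symbols_deg p q k"
  then have TS: "T \<in> S" and Tk: "\<And>M. T M \<noteq> 0 \<Longrightarrow> size M = k" unfolding symbols_deg_def by blast+
  then have lt: "deg_lt (Suc k) T" unfolding deg_lt_def by auto
  have Q: "Q_map p q t T = diff_op p q (G t (Suc k) T)" by (rule Q_map_eq[OF TS lt])
  have "deg_lt (Suc k) (G t (Suc k) T)" by (rule deg_lt_G[OF lt])
  then have "G t (Suc k) T \<in> symbols_le p q k"
    unfolding symbols_le_def deg_lt_def less_Suc_eq_le using S_G[OF TS] by blast
  then show "Q_map p q t T \<in> diff_ops_le p q k" unfolding Q diff_ops_le_def by (rule imageI)
  have "principal_symbol p q k (Q_map p q t T) = deg_part k (G t (Suc k) T)"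
    unfolding principal_symbol_def Q total_symbol_diff_op[OF S_G[OF TS]] ..
  also have "\<dots> = T"
  proof
    fix M
    show "deg_part k (G t (Suc k) T) M = T M"
      using G_top[OF lt, of M t "Suc k"] Tk[of M] by (auto simp: deg_part_def)
  qed
  finally show "principal_symbol p q k (Q_map p q t T) = T" .
qed

section \<open>Equivariance, from generators to the whole algebra\<close>

text \<open>The membership conditions accompany the intertwining property so that the predicate
  passes to sums and multiples of fields.\<close>

definition equi :: "real \<Rightarrow> real \<Rightarrow> real \<Rightarrow> vfield \<Rightarrow> bool" where
  "equi lam mu t X \<longleftrightarrow> X \<in> vfields \<and> (\<forall>T\<in>S. lie_symbol p q (mu - lam) X T \<in> S \<and>
     lie_op p q lam mu X (Q_map p q t T) = Q_map p q t (lie_symbol p q (mu - lam) X T))"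

lemma Q_map_diff_op: "T \<in> S \<Longrightarrow> \<exists>U\<in>S. Q_map p q t T = diff_op p q U"
  using deg_lt_ex Q_map_eq S_G by metis

lemma equi_add: "equi lam mu t X \<Longrightarrow> equi lam mu t X' \<Longrightarrow> equi lam mu t (X + X')"
  unfolding equi_def
proof (intro conjI ballI)
  assume X: "X \<in> vfields \<and> (\<forall>T\<in>S. lie_symbol p q (mu - lam) X T \<in> S \<and>
      lie_op p q lam mu X (Q_map p q t T) = Q_map p q t (lie_symbol p q (mu - lam) X T))"
    and X': "X' \<in> vfields \<and> (\<forall>T\<in>S. lie_symbol p q (mu - lam) X' T \<in> S \<and>
      lie_op p q lam mu X' (Q_map p q t T) = Q_map p q t (lie_symbol p q (mu - lam) X' T))"
  show "X + X' \<in> vfields" using X X' by (simp add: vfields_def plus_fun_apply)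
  fix T assume T: "T \<in> S"
  have ls: "lie_symbol p q (mu - lam) (X + X') T = lie_symbol p q (mu - lam) X T + lie_symbol p q (mu - lam) X' T"
    using X X' by (intro lie_symbol_field_add) simp_all
  show "lie_symbol p q (mu - lam) (X + X') T \<in> S" unfolding ls using X X' T by simp
  obtain U where U: "U \<in> S" "Q_map p q t T = diff_op p q U" using Q_map_diff_op[OF T] by blast
  have "lie_op p q lam mu (X + X') (Q_map p q t T) =
      lie_op p q lam mu X (Q_map p q t T) + lie_op p q lam mu X' (Q_map p q t T)"
    unfolding U(2) using X X' U(1) by (intro lie_op_field_add) simp_all
  also have "\<dots> = Q_map p q t (lie_symbol p q (mu - lam) (X + X') T)"
    unfolding ls using X X' T by (simp add: Q_map_lin(1))
  finally show "lie_op p q lam mu (X + X') (Q_map p q t T) = Q_map p q t (lie_symbol p q (mu - lam) (X + X') T)" .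
qed

lemma equi_scl: "equi lam mu t X \<Longrightarrow> equi lam mu t (\<lambda>i. scl c (X i))"
  unfolding equi_def
proof (intro conjI ballI)
  assume X: "X \<in> vfields \<and> (\<forall>T\<in>S. lie_symbol p q (mu - lam) X T \<in> S \<and>
      lie_op p q lam mu X (Q_map p q t T) = Q_map p q t (lie_symbol p q (mu - lam) X T))"
  show "(\<lambda>i. scl c (X i)) \<in> vfields" using X by (simp add: vfields_def)
  fix T assume T: "T \<in> S"
  have ls: "lie_symbol p q (mu - lam) (\<lambda>i. scl c (X i)) T = ssc c (lie_symbol p q (mu - lam) X T)"
    using X by (intro lie_symbol_field_scl) simp
  show "lie_symbol p q (mu - lam) (\<lambda>i. scl c (X i)) T \<in> S" unfolding ls using X T by simp
  obtain U where U: "U \<in> S" "Q_map p q t T = diff_op p q U" using Q_map_diff_op[OF T] by blast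
  have "lie_op p q lam mu (\<lambda>i. scl c (X i)) (Q_map p q t T) = (\<lambda>f. scl c (lie_op p q lam mu X (Q_map p q t T) f))"
    unfolding U(2) using X U(1) by (intro ext lie_op_field_scl) simp_all
  also have "\<dots> = Q_map p q t (lie_symbol p q (mu - lam) (\<lambda>i. scl c (X i)) T)"
    unfolding ls using X T by (simp add: Q_map_lin(2))
  finally show "lie_op p q lam mu (\<lambda>i. scl c (X i)) (Q_map p q t T) =
      Q_map p q t (lie_symbol p q (mu - lam) (\<lambda>i. scl c (X i)) T)" .
qed

lemma equi_0: "equi lam mu t X \<Longrightarrow> equi lam mu t 0"
  using equi_scl[of lam mu t X 0] by (simp add: zero_fun_def)

lemma equi_sum:
  assumes "equi lam mu t Z" "\<And>a. a \<in> A \<Longrightarrow> equi lam mu t (X a)"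
  shows "equi lam mu t (\<Sum>a\<in>A. X a)"
  using assms(2) by (induction A rule: infinite_finite_induct) (simp_all add: equi_0[OF assms(1)] equi_add)

text \<open>A common frame for the three kinds of generators. \<open>\<iota>\<close> measures the
  difference between the two actions: 0 for constant and linear fields, the signed contraction for
  quadratic ones.\<close>

lemma equi_intertwines:
  assumes X: "X \<in> vfields"
    and symbol: "\<And>T. T \<in> S \<Longrightarrow> lie_symbol p q (mu - lam) X T = L T"
    and operator: "\<And>T. T \<in> S \<Longrightarrow> lie_op p q lam mu X (diff_op p q T) = diff_op p q (L T - Dg real (\<iota> T))"
    and L: "\<And>T. T \<in> S \<Longrightarrow> L T \<in> S" "\<And>T U. T \<in> S \<Longrightarrow> U \<in> S \<Longrightarrow> L (T + U) = L T + L U"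
      "\<And>T \<phi>. T \<in> S \<Longrightarrow> L (Dg \<phi> T) = Dg \<phi> (L T)"
    and \<iota>: "\<And>T. T \<in> S \<Longrightarrow> \<iota> T \<in> S" "\<And>T U. T \<in> S \<Longrightarrow> U \<in> S \<Longrightarrow> \<iota> (T + U) = \<iota> T + \<iota> U"
      "\<And>T \<phi>. T \<in> S \<Longrightarrow> \<iota> (Dg \<phi> T) = Dg (\<lambda>k. \<phi> (Suc k)) (\<iota> T)"
      "\<And>T. T \<in> S \<Longrightarrow> dv (\<iota> T) = \<iota> (dv T)"
    and comm: "\<And>T. T \<in> S \<Longrightarrow> dv (L T) = L (dv T) - Dg (\<lambda>k. 2 * real k) (\<iota> T)"
  shows "equi lam mu t X"
  unfolding equi_def
proof (intro conjI ballI)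
  fix T assume T: "T \<in> S"
  show "lie_symbol p q (mu - lam) X T \<in> S" unfolding symbol[OF T] by (rule L(1)[OF T])
  \<comment> \<open>A common bound, so that \<open>T\<close> and \<open>L T\<close> are quantized
    through the same \<open>G\<close>.\<close>
  obtain N where N: "deg_lt N T" "deg_lt N (L T)" using deg_lt_common[OF T L(1)[OF T]] by blast
  have "lie_op p q lam mu X (Q_map p q t T) = diff_op p q (L (G t N T) - Dg real (\<iota> (G t N T)))"
    unfolding Q_map_eq[OF T N(1)] by (rule operator[OF S_G[OF T]])
  also have "L (G t N T) - Dg real (\<iota> (G t N T)) = G t N (L T)"
    by (rule G_intertwines[OF T N(1) L \<iota> comm, symmetric])
  also have "diff_op p q (G t N (L T)) = Q_map p q t (lie_symbol p q (mu - lam) X T)"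
    unfolding symbol[OF T] Q_map_eq[OF L(1)[OF T] N(2)] ..
  finally show "lie_op p q lam mu X (Q_map p q t T) = Q_map p q t (lie_symbol p q (mu - lam) X T)" .
qed (rule X)

lemma equi_DX:
  assumes i: "i < n"
  shows "equi lam mu t (DX i)"
proof (rule equi_intertwines[where L = "P i" and \<iota> = "\<lambda>_. 0"])
  show "DX i \<in> vfields" by (rule hfield_vfields[OF hfield_DX])
qed (use i in \<open>simp_all add: lie_symbol_DX lie_op_DX P_lin Dg_P dv_P\<close>)

lemma LB_lin: "T \<in> S \<Longrightarrow> U \<in> S \<Longrightarrow> LB \<delta> i j (T + U) = LB \<delta> i j T + LB \<delta> i j U"
  by (simp add: LB_def P_lin Y_lin E_lin I_lin ssc_add)

lemma LB_Dg: "T \<in> S \<Longrightarrow> LB \<delta> i j (Dg \<phi> T) = Dg \<phi> (LB \<delta> i j T)"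
  by (simp add: LB_def Dg_lin Dg_diff Dg_Y Dg_P Dg_E Dg_I)

lemma LQ_lin: "T \<in> S \<Longrightarrow> U \<in> S \<Longrightarrow> LQ j (T + U) = LQ j T + LQ j U"
  by (simp add: LQ_def YP_lin YE_lin Dg_lin Y_lin I_lin ssc_add)

lemma LQ_Dg: "T \<in> S \<Longrightarrow> LQ j (Dg \<phi> T) = Dg \<phi> (LQ j T)"
proof -
  assume T: "T \<in> S"
  have "YP (Dg \<phi> T) = Dg \<phi> (YP T)" using T by (simp add: YP_def Dg_sum Dg_Y Dg_P)
  moreover have "YE (Dg (\<lambda>k. \<phi> (Suc k)) U) = Dg \<phi> (YE U)" for U by (simp add: YE_def Dg_sum Dg_Y Dg_E)
  ultimately show ?thesis
    by (simp add: LQ_def Dg_diff Dg_lin Dg_Y Dg_I Dg_Dg mult.commute)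
qed

lemma equi_LX:
  assumes i: "i < n" and j: "j < n"
  shows "equi lam mu t (LX i j)"
proof (rule equi_intertwines[where L = "LB (mu - lam) i j" and \<iota> = "\<lambda>_. 0"])
  show "LX i j \<in> vfields" by (rule hfield_vfields[OF hfield_LX[OF j]])
qed (use i j in \<open>simp_all add: lie_symbol_LX lie_op_LX LB_lin LB_Dg dv_LB\<close>)

lemma equi_QX:
  assumes j: "j < n" and q: "q = p + 1"
  shows "equi lam mu t (QX j)"
proof (rule equi_intertwines[where L = "LQ j" and \<iota> = "\<lambda>T. ssc (sg (\<pi> j)) (I j T)"])
  show "QX j \<in> vfields" by (rule hfield_vfields[OF hfield_QX[OF j]])
  show "lie_symbol p q (mu - lam) (QX j) T = LQ j T" if "T \<in> S" for T
    using that j q by (rule lie_symbol_QX)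
  show "lie_op p q lam mu (QX j) (diff_op p q T) = diff_op p q (LQ j T - Dg real (ssc (sg (\<pi> j)) (I j T)))"
    if "T \<in> S" for T using that j q by (rule lie_op_QX)
  show "dv (LQ j T) = LQ j (dv T) - Dg (\<lambda>k. 2 * real k) (ssc (sg (\<pi> j)) (I j T))" if "T \<in> S" for T
    using that j q by (rule dv_LQ)
qed (use j in \<open>simp_all add: LQ_lin LQ_Dg I_lin ssc_add Dg_I Dg_lin dv_lin dv_I\<close>)

lemma equi_pgl_field:
  assumes q: "q = p + 1" and h: "h \<in> pgl p q"
  shows "equi lam mu t (pgl_field p q h)"
proof -
  obtain v A \<xi> where h': "h = (v, A, \<xi>)" by (cases h) auto
  obtain B where B: "B \<in> gl (Suc p) q" "h = pgl_ident p q B" using h unfolding pgl_def by blast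
  \<comment> \<open>Coefficients of fields are indexed by all natural numbers, so the decompositions
    below also use that \<open>v\<close> and the rows of \<open>A\<close> vanish from index
    \<open>n\<close> on.\<close>
  have out: "B i j = 0" if "\<not> (i < Suc n \<and> j < Suc n)" for i j
    using B(1) that unfolding gl_def by auto
  have v: "v i = 0" if "n \<le> i" for i
    using B(2) h' out[of "Suc i" 0] that by (auto simp: pgl_ident_def)
  have A: "A i j = 0" if "n \<le> i" for i j
    using B(2) h' out[of "Suc i" "Suc j"] that by (auto simp: pgl_ident_def)
  \<comment> \<open>Any equivariant field will do: its multiple by 0 covers empty sums. Index 0
    exists because \<open>q > 0\<close>.\<close>
  have Z: "equi lam mu t (DX 0)" using q by (intro equi_DX) simp
  have "X_vec v = (\<Sum>k<n. (\<lambda>i. scl (- v k) (DX k i)))"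
  proof
    fix i
    have "(\<Sum>k<n. (\<lambda>i. scl (- v k) (DX k i))) i = (\<Sum>k<n. if i = k then const_sfun (- v i) else 0)"
      unfolding sum_fun_apply[of "\<lambda>k i. scl (- v k) (DX k i)"]
      by (intro sum.cong refl) (auto simp: DX_def scl_def const_sfun_def fun_eq_iff fun_apply)
    also have "\<dots> = const_sfun (- v i)"
      using v[of i] by (auto simp: const_sfun_def fun_eq_iff fun_apply)
    finally show "X_vec v i = (\<Sum>k<n. (\<lambda>i. scl (- v k) (DX k i))) i" by (simp add: X_vec_def)
  qed
  then have 1: "equi lam mu t (X_vec v)" by (auto intro!: equi_sum[OF Z] equi_scl equi_DX)
  define c where "c = (\<lambda>i j. - (sg (\<pi> j * (\<pi> i + \<pi> j)) * A i j))"
  have "X_mat p q A = (\<Sum>k<n. \<Sum>j<n. (\<lambda>i. scl (c k j) (LX k j i)))"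
  proof
    fix i
    have "(\<Sum>k<n. \<Sum>j<n. (\<lambda>i. scl (c k j) (LX k j i))) i = (\<Sum>k<n. \<Sum>j<n. scl (c k j) (LX k j i))"
      unfolding sum_fun_apply[of "\<lambda>k. \<Sum>j<n. (\<lambda>i. scl (c k j) (LX k j i))"]
        sum_fun_apply[of "\<lambda>j i. scl (c _ j) (LX _ j i)"] ..
    also have "\<dots> = (\<Sum>k<n. if i = k then \<Sum>j<n. scl (c i j) (y j) else 0)"
      by (intro sum.cong refl) (auto simp: LX_def)
    also have "\<dots> = (\<Sum>j<n. scl (c i j) (y j))"
      using A[of i] by (auto simp: c_def)
    finally show "X_mat p q A i = (\<Sum>k<n. \<Sum>j<n. (\<lambda>i. scl (c k j) (LX k j i))) i"
      by (simp add: X_mat_def c_def)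
  qed
  then have 2: "equi lam mu t (X_mat p q A)" by (auto intro!: equi_sum[OF Z] equi_scl equi_LX)
  have "X_row p q \<xi> = (\<Sum>j<n. (\<lambda>i. scl (\<xi> j * sg (\<pi> j)) (QX j i)))"
  proof
    fix i
    show "X_row p q \<xi> i = (\<Sum>j<n. (\<lambda>i. scl (\<xi> j * sg (\<pi> j)) (QX j i))) i"
      unfolding sum_fun_apply[of "\<lambda>j i. scl (\<xi> j * sg (\<pi> j)) (QX j i)"]
      unfolding X_row_def QX_def ..
  qed
  moreover have "equi lam mu t (QX j)" if "j < n" for j using that q by (rule equi_QX)
  ultimately have 3: "equi lam mu t (X_row p q \<xi>)" by (auto intro!: equi_sum[OF Z] equi_scl)
  show ?thesis unfolding h' pgl_field_def prod.case by (intro equi_add 1 2 3)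
qed

end

theorem theorem5p2p3:
  fixes p q :: nat and lam mu t :: real
  assumes "q = p + 1"
  shows "quantization p q (Q_map p q t) \<and>
         equivariant p q lam mu (psl p q) (Q_map p q t) \<and>
         equivariant p q lam mu (pgl p q) (Q_map p q t)"
proof -
  have pgl: "equivariant p q lam mu (pgl p q) (Q_map p q t)"
    unfolding equivariant_def
    using superspace.equi_pgl_field[OF assms] unfolding superspace.equi_def by blast
  \<comment> \<open>Traceless matrices form a subset of all matrices, so equivariance restricts to
    their image.\<close>
  have "psl p q \<subseteq> pgl p q" unfolding psl_def pgl_def sl_def by blast
  then have "equivariant p q lam mu (psl p q) (Q_map p q t)"
    using pgl unfolding equivariant_def by blast
  with pgl superspace.quantization_Q_map show ?thesis by blast
qed

end
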